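(* Let $D$ be a two-dimensional regular local ring with quotient field $F$. Every integrally closed local overring of $D$ of Krull dimension one is vacant.
   Context: An overring of $D$ is a ring $R$ with $D \subseteq R \subseteq F$; "local" means having a unique maximal ideal (not necessarily Noetherian). "Integrally closed" means integrally closed in $F$. For an integral domain $A$ with quotient field $F$, $\operatorname{Zar}(A)$ is the set of valuation rings of $F$ containing $A$ (including $F$ itself). The Zariski topology on $\operatorname{Zar}(A)$ has as basic open sets $\{V \in \operatorname{Zar}(A) : x_1,\ldots,x_n \in V\}$ with $x_1,\ldots,x_n \in F$. The patch topology on $\operatorname{Zar}(A)$ is the coarsest topology in which every set $\{V \in \operatorname{Zar}(A) : x \in V\}$, $x \in F$, is both open and closed. The inverse topology on $\operatorname{Zar}(A)$ is the topology whose basic closed sets are the Zariski quasicompact open sets of $\operatorname{Zar}(A)$; equivalently, a set $Z \subseteq \operatorname{Zar}(A)$ is inverse closed if and only if there is a patch closed set $Y$ in $\operatorname{Zar}(A)$ such that $Z = \{V \in \operatorname{Zar}(A) : U \subseteq V \text{ for some } U \in Y\}$. An inverse closed representation of $A$ is a nonempty inverse closed subset $Z$ of $\operatorname{Zar}(A)$ such that $A$ is the intersection of the rings in $Z$. An integrally closed domain $A$ is vacant if the only inverse closed representation of $A$ in $\operatorname{Zar}(A)$ is $\operatorname{Zar}(A)$ itself. *)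

theory Defs
  imports
    "HOL-Library.Extended_Nat"
    "HOL-Analysis.Abstract_Topology"
    "HOL-Algebra.Algebra"
begin

text \<open>
  All rings below are subrings of a field \<open>F\<close>, given as subsets \<open>A\<close> of \<open>carrier F\<close>; the
  corresponding ring structure is \<open>F\<lparr>carrier := A\<rparr>\<close>.
\<close>

definition local_ring :: "('a, 'b) ring_scheme \<Rightarrow> bool" where
  "local_ring R \<longleftrightarrow> cring R \<and> (\<exists>!M. maximalideal M R)"

text \<open>
  The supremum of the lengths \<open>n\<close> of chains \<open>P 0 \<subset> P 1 \<subset> \<dots> \<subset> P n\<close> of prime ideals.
  (For the zero ring, which is not of interest here, this gives \<open>0\<close>.)
\<close>

definition krull_dim :: "('a, 'b) ring_scheme \<Rightarrow> enat" where
  "krull_dim R = Sup {enat n | n. \<exists>P :: nat \<Rightarrow> 'a set.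
     (\<forall>i\<le>n. primeideal (P i) R) \<and> (\<forall>i<n. P i \<subset> P (Suc i))}"

text \<open>
  The minimal number of generators of the maximal ideal. Only meaningful for a Noetherian local
  ring, where \<open>maximalideal (Idl\<^bsub>R\<^esub> S) R\<close> says that \<open>S\<close> generates the unique maximal ideal
  and a finite such \<open>S\<close> exists.
\<close>

definition embedding_dim :: "('a, 'b) ring_scheme \<Rightarrow> nat" where
  "embedding_dim R =
     (LEAST n. \<exists>S \<subseteq> carrier R. finite S \<and> card S = n \<and> maximalideal (Idl\<^bsub>R\<^esub> S) R)"

definition regular_local_ring :: "('a, 'b) ring_scheme \<Rightarrow> bool" where
  "regular_local_ring R \<longleftrightarrow>
     noetherian_ring R \<and> local_ring R \<and> krull_dim R = enat (embedding_dim R)"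

definition quotient_field :: "('a, 'b) ring_scheme \<Rightarrow> 'a set \<Rightarrow> bool" where
  "quotient_field F D \<longleftrightarrow> field F \<and> subring D F \<and>
     carrier F = {a \<otimes>\<^bsub>F\<^esub> inv\<^bsub>F\<^esub> b | a b. a \<in> D \<and> b \<in> D - {\<zero>\<^bsub>F\<^esub>}}"

definition overring :: "('a, 'b) ring_scheme \<Rightarrow> 'a set \<Rightarrow> 'a set \<Rightarrow> bool" where
  "overring F D A \<longleftrightarrow> subring A F \<and> D \<subseteq> A"

text \<open>Polynomials are coefficient lists with the leading coefficient first.\<close>

definition integral_over :: "('a, 'b) ring_scheme \<Rightarrow> 'a set \<Rightarrow> 'a \<Rightarrow> bool" where
  "integral_over F A x \<longleftrightarrow> x \<in> carrier F \<and>
     (\<exists>p. p \<in> carrier (univ_poly F A) \<and> p \<noteq> [] \<and> hd p = \<one>\<^bsub>F\<^esub> \<and> ring.eval F p x = \<zero>\<^bsub>F\<^esub>)"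

definition integrally_closed :: "('a, 'b) ring_scheme \<Rightarrow> 'a set \<Rightarrow> bool" where
  "integrally_closed F A \<longleftrightarrow> (\<forall>x. integral_over F A x \<longrightarrow> x \<in> A)"

definition valuation_ring :: "('a, 'b) ring_scheme \<Rightarrow> 'a set \<Rightarrow> bool" where
  "valuation_ring F V \<longleftrightarrow> subring V F \<and>
     (\<forall>x \<in> carrier F - {\<zero>\<^bsub>F\<^esub>}. x \<in> V \<or> inv\<^bsub>F\<^esub> x \<in> V)"

definition Zar :: "('a, 'b) ring_scheme \<Rightarrow> 'a set \<Rightarrow> 'a set set" where
  "Zar F A = {V. valuation_ring F V \<and> A \<subseteq> V}"

definition zariski_topology :: "('a, 'b) ring_scheme \<Rightarrow> 'a set \<Rightarrow> 'a set topology" where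
  "zariski_topology F A =
     topology_generated_by {{V \<in> Zar F A. S \<subseteq> V} | S. finite S \<and> S \<subseteq> carrier F}"

text \<open>
  The quasicompact open sets are closed under finite unions and include the empty set, so their
  complements, which generate this topology, are a basis.
\<close>

definition inverse_topology :: "('a, 'b) ring_scheme \<Rightarrow> 'a set \<Rightarrow> 'a set topology" where
  "inverse_topology F A =
     topology_generated_by {Zar F A - U | U.
       openin (zariski_topology F A) U \<and> compactin (zariski_topology F A) U}"

definition inverse_closed_representation ::
    "('a, 'b) ring_scheme \<Rightarrow> 'a set \<Rightarrow> 'a set set \<Rightarrow> bool" where
  "inverse_closed_representation F A Z \<longleftrightarrow>
     Z \<noteq> {} \<and> closedin (inverse_topology F A) Z \<and> \<Inter>Z = A"

definition vacant :: "('a, 'b) ring_scheme \<Rightarrow> 'a set \<Rightarrow> bool" where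
  "vacant F A \<longleftrightarrow> quotient_field F A \<and> integrally_closed F A \<and>
     {Z. inverse_closed_representation F A Z} = {Zar F A}"

end

theory Submission
  imports Defs
begin

text \<open>
  Let \<open>Z\<close> be an inverse closed representation of \<open>A\<close>, and suppose that some \<open>V\<close> in \<open>Zar A\<close> is
  missing from \<open>Z\<close>. Then there are finitely many \<open>y\<close> outside \<open>V\<close> such that every member of \<open>Z\<close>
  contains one of them (\<open>inverse_closed_separation\<close>). Since \<open>A\<close> is local of dimension one, every
  valuation ring over \<open>A\<close> other than \<open>F\<close> is centred on the maximal ideal of \<open>A\<close>
  (\<open>one_dim_local_center\<close>). If this ideal lies over the maximal ideal of \<open>D\<close>, then all these
  valuation rings dominate \<open>D\<close>, and \<open>common_pole_finite\<close> replaces the elements \<open>y\<close> by one: there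
  is \<open>w\<close> outside \<open>V\<close> that lies in every valuation ring that dominates \<open>D\<close> and contains some \<open>y\<close>.
  So \<open>w\<close> lies in all members of \<open>Z\<close>, hence in \<open>A\<close>, hence in \<open>V\<close>, a contradiction. If the maximal
  ideal of \<open>A\<close> lies over a smaller prime, then \<open>A\<close> is a valuation ring, \<open>Zar A\<close> consists of \<open>A\<close>
  and \<open>F\<close>, and the claim is clear. That \<open>Zar A\<close> itself represents \<open>A\<close> is the theorem that an
  integrally closed domain is the intersection of its valuation overrings
  (\<open>valuation_ring_avoiding\<close>).

  The element \<open>w\<close> depends only on \<open>D\<close>, \<open>V\<close> and the \<open>y\<close>. Geometrically, on some iterated blow-up
  of the closed point of \<open>Spec D\<close> the \<open>y\<close> have poles along the centre of \<open>V\<close>, and a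
  rational function is wanted whose polar curve meets the closed fibre only near that centre.
  It exists because the exceptional curves are projective lines: a closed point of such a line is
  the zero set of one polynomial. It is built by induction along the quadratic transforms of \<open>D\<close>
  along \<open>V\<close>. Let \<open>s, t\<close> be parameters of \<open>D\<close> with \<open>x = s / t\<close> in \<open>V\<close>. Then \<open>t = 0\<close> is the
  exceptional curve in the chart \<open>D[x]\<close> of the blow-up, and \<open>D[x] / t D[x]\<close> is a polynomial ring in
  one variable over the residue field of \<open>D\<close>.

  If the centre of \<open>V\<close> on \<open>D[x]\<close> is a closed point of that curve, it is generated by \<open>t\<close> and a
  monic polynomial \<open>p\<close> in \<open>x\<close>, and the local ring \<open>D1\<close> there is again of the same kind, with
  parameters \<open>p, t\<close> (\<open>D1_regular_pair\<close>). If \<open>y = G / F\<close> with \<open>D / (F, G)\<close> of finite length, then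
  after removing the common power of \<open>t\<close> this length has dropped, unless it was \<open>0\<close>
  (\<open>length_transform\<close>), so by induction there is \<open>w1\<close> that works over \<open>D1\<close>. The lemma \<open>blowup_step\<close> makes \<open>w\<close> from
  \<open>w1 = G / F\<close>: it arranges that \<open>F\<close> does not vanish on the exceptional curve, lifts the
  factorization \<open>F = p ^ k * g\<close> modulo \<open>t\<close> to a high power of \<open>t\<close> by Hensel's argument
  (\<open>hensel\<close>), so that \<open>F\<close> is there a monic polynomial \<open>F'\<close> times a unit of \<open>D1\<close>, and puts
  \<open>w = \<rho> / F'\<close>, where \<open>\<rho>\<close> is the remainder of \<open>G\<close> on division by \<open>F'\<close>. The degrees prevent a pole
  of \<open>w\<close> at the point at infinity, the congruence of \<open>F'\<close> with \<open>p ^ k\<close> prevents poles at the other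
  points of the curve, and at the point \<open>p = 0\<close> the elements \<open>w\<close> and \<open>w1\<close> have a pole at the same
  valuation rings, because \<open>(F, G)\<close> contains a power of \<open>t\<close>. If the centre of \<open>V\<close> is the generic point of the
  curve, \<open>w\<close> is written down directly (\<open>generic_step\<close>). If both lengths are \<open>0\<close>, no valuation ring
  dominating \<open>D\<close> contains any of the two given elements (\<open>frac_len_zero\<close>).

  The induction uses of \<open>D\<close> only the properties collected in the locale \<open>regular_pair\<close>; that a
  two-dimensional regular local ring has them is \<open>regular_local_ring_pair\<close>.
\<close>

section \<open>Ideals of a subring and their length\<close>

text \<open>
  Subrings of the field are plain sets here, and so are their ideals. The notions below make
  no use of the records \<open>R\<lparr>carrier := D\<rparr>\<close>; \<open>ideal_iff_subideal\<close> connects the two.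
\<close>
definition (in ring) subideal :: "'a set \<Rightarrow> 'a set \<Rightarrow> bool" where
  "subideal D I \<longleftrightarrow> I \<subseteq> D \<and> \<zero> \<in> I \<and> (\<forall>a\<in>I. \<forall>b\<in>I. a \<oplus> b \<in> I) \<and> (\<forall>c\<in>D. \<forall>a\<in>I. c \<otimes> a \<in> I)"

definition (in ring) gen2 :: "'a set \<Rightarrow> 'a \<Rightarrow> 'a \<Rightarrow> 'a set" where
  "gen2 D a b = {a \<otimes> c \<oplus> b \<otimes> d | c d. c \<in> D \<and> d \<in> D}"

text \<open>
  The \<open>D\<close>-module \<open>D / I\<close> has length at most \<open>n\<close>. Bounding chains avoids any
  vector space dimension over residue fields, which change from one blow-up to the next.
\<close>
definition (in ring) len_le :: "'a set \<Rightarrow> 'a set \<Rightarrow> nat \<Rightarrow> bool" where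
  "len_le D I n \<longleftrightarrow> (\<forall>k Q. (\<forall>i\<le>k. subideal D (Q i) \<and> I \<subseteq> Q i) \<and> (\<forall>i<k. Q i \<subset> Q (Suc i)) \<longrightarrow> k \<le> n)"

context cring
begin

lemma subring_closed:
  assumes "subring D R"
  shows "a \<in> D \<Longrightarrow> a \<in> carrier R" "\<zero> \<in> D" "\<one> \<in> D" "a \<in> D \<Longrightarrow> \<ominus> a \<in> D"
    "a \<in> D \<Longrightarrow> b \<in> D \<Longrightarrow> a \<oplus> b \<in> D" "a \<in> D \<Longrightarrow> b \<in> D \<Longrightarrow> a \<ominus> b \<in> D"
    "a \<in> D \<Longrightarrow> b \<in> D \<Longrightarrow> a \<otimes> b \<in> D"
  using subringE[OF assms] by (auto simp: a_minus_def)

lemma subring_pow: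
  assumes "subring D R" "a \<in> D" shows "a [^] (n::nat) \<in> D"
  by (induct n) (auto simp: subring_closed[OF assms(1)] assms(2))

lemma subidealD:
  assumes "subideal D I"
  shows "a \<in> I \<Longrightarrow> a \<in> D" "\<zero> \<in> I" "a \<in> I \<Longrightarrow> b \<in> I \<Longrightarrow> a \<oplus> b \<in> I" "c \<in> D \<Longrightarrow> a \<in> I \<Longrightarrow> c \<otimes> a \<in> I"
  using assms unfolding subideal_def by auto

lemma subideal_r:
  assumes "subring D R" "subideal D I" "c \<in> D" "a \<in> I" shows "a \<otimes> c \<in> I"
  using subidealD(4)[OF assms(2-4)] subidealD(1)[OF assms(2,4)] assms(1,3)
  by (metis m_comm subring_closed(1))

lemma subideal_minus:
  assumes "subring D R" "subideal D I" "a \<in> I" "b \<in> I" shows "a \<ominus> b \<in> I"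
proof -
  have c: "a \<in> carrier R" "b \<in> carrier R"
    using assms subidealD(1)[OF assms(2)] subring_closed(1)[OF assms(1)] by auto
  have "\<ominus> \<one> \<otimes> b \<in> I"
    using assms by (intro subidealD(4)[OF assms(2)]) (auto simp: subring_closed)
  hence "a \<oplus> (\<ominus> \<one> \<otimes> b) \<in> I" using assms subidealD(3) by blast
  thus ?thesis using c by (simp add: a_minus_def l_minus)
qed

lemma subideal_one:
  assumes "subring D R" "subideal D I" "\<one> \<in> I" shows "I = D"
proof -
  have "c \<in> I" if "c \<in> D" for c
    using subidealD(4)[OF assms(2) that assms(3)] subring_closed(1)[OF assms(1) that] by simp
  thus ?thesis using subidealD(1)[OF assms(2)] by blast
qed

lemma subideal_self: "subring D R \<Longrightarrow> subideal D D"
  unfolding subideal_def by (auto simp: subring_closed)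

lemma gen2_subideal:
  assumes D: "subring D R" and a: "a \<in> D" and b: "b \<in> D"
  shows "subideal D (gen2 D a b)"
proof -
  note cl = subring_closed[OF D]
  have ac: "a \<in> carrier R" "b \<in> carrier R" using a b cl by auto
  show ?thesis unfolding subideal_def
  proof (intro conjI ballI)
    show "gen2 D a b \<subseteq> D" unfolding gen2_def using a b by (auto intro!: cl(5,7))
    have "\<zero> = a \<otimes> \<zero> \<oplus> b \<otimes> \<zero>" using ac by simp
    thus "\<zero> \<in> gen2 D a b" unfolding gen2_def using cl(2) by blast
  next
    fix u v assume "u \<in> gen2 D a b" "v \<in> gen2 D a b"
    then obtain c d c' d' where *: "c \<in> D" "d \<in> D" "c' \<in> D" "d' \<in> D"
      "u = a \<otimes> c \<oplus> b \<otimes> d" "v = a \<otimes> c' \<oplus> b \<otimes> d'" unfolding gen2_def by auto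
    have "u \<oplus> v = a \<otimes> (c \<oplus> c') \<oplus> b \<otimes> (d \<oplus> d')"
      unfolding *(5,6) using ac *(1-4)[THEN cl(1)] by algebra
    thus "u \<oplus> v \<in> gen2 D a b" unfolding gen2_def using * cl(5) by blast
  next
    fix u v assume u: "u \<in> D" and "v \<in> gen2 D a b"
    then obtain c' d' where *: "c' \<in> D" "d' \<in> D" "v = a \<otimes> c' \<oplus> b \<otimes> d'" unfolding gen2_def by auto
    have "u \<otimes> v = a \<otimes> (u \<otimes> c') \<oplus> b \<otimes> (u \<otimes> d')"
      unfolding *(3) using ac cl(1)[OF u] *(1-2)[THEN cl(1)] by algebra
    thus "u \<otimes> v \<in> gen2 D a b" unfolding gen2_def using * u cl(7) by blast
  qed
qed

lemma gen2_in:
  assumes D: "subring D R" and a: "a \<in> D" and b: "b \<in> D"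
  shows "a \<in> gen2 D a b" "b \<in> gen2 D a b"
proof -
  note cl = subring_closed[OF D]
  have ac: "a \<in> carrier R" "b \<in> carrier R" using a b cl by auto
  have "a = a \<otimes> \<one> \<oplus> b \<otimes> \<zero>" "b = a \<otimes> \<zero> \<oplus> b \<otimes> \<one>" using ac by simp_all
  thus "a \<in> gen2 D a b" "b \<in> gen2 D a b" unfolding gen2_def using cl(2,3) by blast+
qed

lemma gen2_least:
  assumes I: "subideal D I" and D: "subring D R" and a: "a \<in> I" and b: "b \<in> I"
  shows "gen2 D a b \<subseteq> I"
  unfolding gen2_def using subideal_r[OF D I _ a] subideal_r[OF D I _ b] subidealD(3)[OF I] by auto

lemma gen2_comm:
  assumes D: "subring D R" and a: "a \<in> D" and b: "b \<in> D"
  shows "gen2 D a b = gen2 D b a"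
  using gen2_least[OF gen2_subideal[OF D b a] D gen2_in(2,1)[OF D b a]]
    gen2_least[OF gen2_subideal[OF D a b] D gen2_in(2,1)[OF D a b]] by blast

lemma len_leD:
  assumes "len_le D I n" "\<And>i. i \<le> k \<Longrightarrow> subideal D (Q i)" "\<And>i. i \<le> k \<Longrightarrow> I \<subseteq> Q i"
    "\<And>i. i < k \<Longrightarrow> Q i \<subset> Q (Suc i)"
  shows "k \<le> n"
  using assms unfolding len_le_def by blast

lemma len_le_zero:
  assumes "subring D R" "subideal D I" "len_le D I 0" shows "I = D"
proof (rule ccontr)
  assume "I \<noteq> D"
  hence "I \<subset> D" using subidealD(1)[OF assms(2)] by blast
  moreover have "subideal D D" using subideal_self assms by blast
  ultimately have "Suc 0 \<le> 0"
    by (intro len_leD[OF assms(3), of "Suc 0" "\<lambda>i. if i = 0 then I else D"])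
      (use assms in auto)
  thus False by simp
qed

lemma len_le_top:
  assumes "subring D R" shows "len_le D D n"
  unfolding len_le_def
proof (intro allI impI)
  fix k Q assume *: "(\<forall>i\<le>k. subideal D (Q i) \<and> D \<subseteq> Q i) \<and> (\<forall>i<k. Q i \<subset> Q (Suc i))"
  show "k \<le> n"
  proof (cases k)
    case (Suc k')
    hence "Q 0 = D" "Q 1 \<subseteq> D" "Q 0 \<subset> Q 1"
      using * unfolding subideal_def by auto
    thus ?thesis by blast
  qed simp
qed

lemma subideal_extend:
  assumes D: "subring D R" and I: "subideal D I" and u: "u \<in> D"
  shows "subideal D {i \<oplus> u \<otimes> c | i c. i \<in> I \<and> c \<in> D}"
proof -
  note cl = subring_closed[OF D]
  have Ic: "i \<in> I \<Longrightarrow> i \<in> carrier R" for i using subidealD(1)[OF I] cl by blast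
  have uc: "u \<in> carrier R" using u cl by auto
  show ?thesis unfolding subideal_def
  proof (intro conjI ballI)
    show "{i \<oplus> u \<otimes> c | i c. i \<in> I \<and> c \<in> D} \<subseteq> D" using subidealD(1)[OF I] u cl by auto
    have "\<zero> = \<zero> \<oplus> u \<otimes> \<zero>" using uc by simp
    thus "\<zero> \<in> {i \<oplus> u \<otimes> c | i c. i \<in> I \<and> c \<in> D}" using subidealD(2)[OF I] cl(2) by blast
  next
    fix a b assume "a \<in> {i \<oplus> u \<otimes> c | i c. i \<in> I \<and> c \<in> D}" "b \<in> {i \<oplus> u \<otimes> c | i c. i \<in> I \<and> c \<in> D}"
    then obtain i c j d where *: "i \<in> I" "c \<in> D" "j \<in> I" "d \<in> D" "a = i \<oplus> u \<otimes> c" "b = j \<oplus> u \<otimes> d" by auto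
    have "a \<oplus> b = (i \<oplus> j) \<oplus> u \<otimes> (c \<oplus> d)" unfolding *(5,6)
      using * Ic cl(1) uc by algebra
    thus "a \<oplus> b \<in> {i \<oplus> u \<otimes> c | i c. i \<in> I \<and> c \<in> D}" using * cl(5) subidealD(3)[OF I] by blast
  next
    fix a b assume a: "a \<in> D" and "b \<in> {i \<oplus> u \<otimes> c | i c. i \<in> I \<and> c \<in> D}"
    then obtain j d where *: "j \<in> I" "d \<in> D" "b = j \<oplus> u \<otimes> d" by auto
    have "a \<otimes> b = a \<otimes> j \<oplus> u \<otimes> (a \<otimes> d)" unfolding *(3)
      using * Ic cl(1) uc a by algebra
    thus "a \<otimes> b \<in> {i \<oplus> u \<otimes> c | i c. i \<in> I \<and> c \<in> D}" using * a cl(7) subidealD(4)[OF I] by blast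
  qed
qed

text \<open>
  A nonunit is nilpotent modulo an ideal of finite length: the ideals \<open>I + s ^ i D\<close> descend, so
  two consecutive ones agree, and then \<open>s ^ m * (1 - s * c)\<close> lies in \<open>I\<close>.
\<close>
lemma len_le_power:
  assumes D: "subring D R" and I: "subideal D I" and len: "len_le D I n" and s: "s \<in> D"
    and unit: "\<And>c. c \<in> D \<Longrightarrow> \<exists>b\<in>D. (\<one> \<ominus> s \<otimes> c) \<otimes> b = \<one>"
  shows "\<exists>a. s [^] (a::nat) \<in> I"
proof -
  note cl = subring_closed[OF D]
  define Q where "Q = (\<lambda>i. {j \<oplus> s [^] (Suc n - i) \<otimes> c | j c. j \<in> I \<and> c \<in> D})"
  have sc: "s \<in> carrier R" using s cl by auto
  have sub: "subideal D (Q i)" for i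
    unfolding Q_def by (rule subideal_extend[OF D I subring_pow[OF D s]])
  have IQ: "I \<subseteq> Q i" for i
  proof
    fix j assume j: "j \<in> I"
    have "j = j \<oplus> s [^] (Suc n - i) \<otimes> \<zero>" using j subidealD(1)[OF I] cl sc by simp
    thus "j \<in> Q i" unfolding Q_def using j cl(2) by blast
  qed
  have "\<exists>i<Suc n. \<not> Q i \<subset> Q (Suc i)"
  proof (rule ccontr)
    assume "\<not> ?thesis"
    hence "Suc n \<le> n" by (intro len_leD[OF len, of "Suc n" Q]) (use sub IQ in auto)
    thus False by simp
  qed
  then obtain i where i: "i < Suc n" "\<not> Q i \<subset> Q (Suc i)" by blast
  define m where "m = n - i"
  have m: "Suc n - i = Suc m" "Suc n - Suc i = m" using i unfolding m_def by auto
  have incl: "Q i \<subseteq> Q (Suc i)"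
  proof
    fix b assume "b \<in> Q i"
    then obtain j c where *: "j \<in> I" "c \<in> D" "b = j \<oplus> s [^] (Suc m) \<otimes> c" unfolding Q_def m by auto
    have "b = j \<oplus> s [^] m \<otimes> (s \<otimes> c)" unfolding *(3) using sc cl(1)[OF *(2)] by (simp add: m_assoc)
    thus "b \<in> Q (Suc i)" unfolding Q_def m using * s cl(7) by blast
  qed
  have "s [^] m = \<zero> \<oplus> s [^] m \<otimes> \<one>" using sc by simp
  hence "s [^] m \<in> Q (Suc i)" unfolding Q_def m using subidealD(2)[OF I] cl(3) by blast
  hence "s [^] m \<in> Q i" using incl i by blast
  then obtain j c where *: "j \<in> I" "c \<in> D" "s [^] m = j \<oplus> s [^] (Suc m) \<otimes> c" unfolding Q_def m by auto
  have jc: "j \<in> carrier R" and cc: "c \<in> carrier R" using *(1,2) subidealD(1)[OF I] cl by auto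
  have "s [^] m \<otimes> (\<one> \<ominus> s \<otimes> c) = (j \<oplus> s [^] (Suc m) \<otimes> c) \<ominus> s [^] (Suc m) \<otimes> c"
    unfolding *(3)[symmetric] using sc cc nat_pow_closed[OF sc] by (simp, algebra)
  also have "\<dots> = j" using jc cc nat_pow_closed[OF sc] by algebra
  finally have e: "s [^] m \<otimes> (\<one> \<ominus> s \<otimes> c) = j" .
  obtain b where b: "b \<in> D" "(\<one> \<ominus> s \<otimes> c) \<otimes> b = \<one>" using unit[OF *(2)] by blast
  have "s [^] m = s [^] m \<otimes> ((\<one> \<ominus> s \<otimes> c) \<otimes> b)" using b sc by simp
  also have "\<dots> = j \<otimes> b" unfolding e[symmetric] using sc cc cl(1)[OF b(1)] by (simp add: m_assoc)
  also have "\<dots> \<in> I" using subideal_r[OF D I b(1) *(1)] .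
  finally show ?thesis by blast
qed

end

section \<open>Valuation rings\<close>

lemma (in domain) pow_nz: "a \<in> carrier R \<Longrightarrow> a \<noteq> \<zero> \<Longrightarrow> a [^] (n::nat) \<noteq> \<zero>"
  by (induct n) (auto simp: integral_iff)

text \<open>
  For a valuation ring \<open>V\<close> with valuation \<open>v\<close> this says \<open>v a \<le> v b\<close>. All comparisons of values are
  expressed in this way, so no value group has to be constructed.
\<close>
definition (in ring) vdvd :: "'a set \<Rightarrow> 'a \<Rightarrow> 'a \<Rightarrow> bool" where
  "vdvd V a b \<longleftrightarrow> (\<exists>c\<in>V. b = a \<otimes> c)"

definition (in ring) nonunits :: "'a set \<Rightarrow> 'a set" where
  "nonunits V = {a \<in> V. \<not> vdvd V a \<one>}"

context field
begin

lemma inv_facts: "a \<in> carrier R \<Longrightarrow> a \<noteq> \<zero> \<Longrightarrow> inv a \<in> carrier R \<and> a \<otimes> inv a = \<one> \<and> inv a \<otimes> a = \<one> \<and> inv a \<noteq> \<zero>"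
  using field_Units by (auto simp: Units_r_inv Units_l_inv dest: Units_inv_Units)

lemma vdvdI: "c \<in> V \<Longrightarrow> b = a \<otimes> c \<Longrightarrow> vdvd V a b"
  unfolding vdvd_def by blast

lemma vdvd_one: "vdvd V a \<one> \<longleftrightarrow> (\<exists>c\<in>V. a \<otimes> c = \<one>)"
  unfolding vdvd_def by metis

lemma vdvd_trans:
  assumes V: "subring V R" and "vdvd V a b" "vdvd V b c" "a \<in> carrier R" shows "vdvd V a c"
proof -
  note cl = subring_closed[OF V]
  obtain u v where *: "u \<in> V" "v \<in> V" "b = a \<otimes> u" "c = b \<otimes> v" using assms unfolding vdvd_def by blast
  have "c = a \<otimes> (u \<otimes> v)" unfolding *(4,3) using cl(1)[OF *(1)] cl(1)[OF *(2)] assms(4) by (simp add: m_assoc)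
  thus ?thesis using * cl(7) vdvdI by blast
qed

lemma vdvd_mult:
  assumes V: "subring V R" and "vdvd V a b" "a \<in> carrier R" "c \<in> carrier R" shows "vdvd V (a \<otimes> c) (b \<otimes> c)"
proof -
  note cl = subring_closed[OF V]
  obtain u where *: "u \<in> V" "b = a \<otimes> u" using assms unfolding vdvd_def by blast
  have "b \<otimes> c = (a \<otimes> c) \<otimes> u" unfolding *(2) using cl(1)[OF *(1)] assms(3,4) by algebra
  thus ?thesis using * vdvdI by blast
qed

lemma vdvd_cancel:
  assumes V: "subring V R" and "vdvd V (a \<otimes> c) (b \<otimes> c)" "a \<in> carrier R" "b \<in> carrier R" "c \<in> carrier R" "c \<noteq> \<zero>"
  shows "vdvd V a b"
proof -
  note cl = subring_closed[OF V]
  obtain u where *: "u \<in> V" "b \<otimes> c = (a \<otimes> c) \<otimes> u" using assms unfolding vdvd_def by blast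
  have "b \<otimes> c = (a \<otimes> u) \<otimes> c" unfolding *(2) using cl(1)[OF *(1)] assms(3,5) by algebra
  hence "b = a \<otimes> u" using assms cl(1)[OF *(1)] m_rcancel by (metis m_closed)
  thus ?thesis using * vdvdI by blast
qed

lemma vdvd_add:
  assumes V: "subring V R" and "vdvd V a b" "vdvd V a c" "a \<in> carrier R" shows "vdvd V a (b \<oplus> c)" "vdvd V a (b \<ominus> c)"
proof -
  note cl = subring_closed[OF V]
  obtain u v where *: "u \<in> V" "v \<in> V" "b = a \<otimes> u" "c = a \<otimes> v" using assms unfolding vdvd_def by blast
  have "b \<oplus> c = a \<otimes> (u \<oplus> v)" "b \<ominus> c = a \<otimes> (u \<ominus> v)" unfolding *(4,3) using cl(1)[OF *(1)] cl(1)[OF *(2)] assms(4) by algebra+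
  thus "vdvd V a (b \<oplus> c)" "vdvd V a (b \<ominus> c)"
    using vdvdI[OF cl(5)[OF *(1,2)]] vdvdI[OF cl(6)[OF *(1,2)]] by auto
qed

lemma vdvd_total:
  assumes V: "valuation_ring R V" and a: "a \<in> carrier R" and b: "b \<in> carrier R"
  shows "vdvd V a b \<or> vdvd V b a"
proof -
  have sV: "subring V R" using V valuation_ring_def by blast
  note cl = subring_closed[OF sV]
  show ?thesis
  proof (cases "a = \<zero> \<or> b = \<zero>")
    case True
    thus ?thesis using a b cl(2) unfolding vdvd_def by (metis r_null)
  next
    case False
    define y where "y = inv a \<otimes> b"
    have ia: "inv a \<in> carrier R" "a \<otimes> inv a = \<one>" "inv a \<noteq> \<zero>" using inv_facts[OF a] False by auto
    have y: "y \<in> carrier R" "y \<noteq> \<zero>" unfolding y_def using ia b False by (auto simp: integral_iff)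
    have "a \<otimes> y = (a \<otimes> inv a) \<otimes> b" unfolding y_def using a b ia(1) by (simp add: m_assoc)
    hence ay: "b = a \<otimes> y" using ia(2) b by simp
    have iy: "inv y \<in> carrier R" "y \<otimes> inv y = \<one>" using inv_facts[OF y] by auto
    have "b \<otimes> inv y = a \<otimes> (y \<otimes> inv y)" unfolding ay using a y iy(1) by (simp add: m_assoc)
    hence "a = b \<otimes> inv y" using iy a by simp
    moreover have "y \<in> V \<or> inv y \<in> V" using V y unfolding valuation_ring_def by auto
    ultimately show ?thesis using ay unfolding vdvd_def by blast
  qed
qed

lemma unitD: "a \<in> V \<Longrightarrow> a \<notin> nonunits V \<Longrightarrow> \<exists>c\<in>V. a \<otimes> c = \<one>"
  unfolding nonunits_def vdvd_one by blast

lemma nonunitsD: "a \<in> nonunits V \<Longrightarrow> a \<in> V" "a \<in> nonunits V \<Longrightarrow> \<not> vdvd V a \<one>"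
  unfolding nonunits_def by auto

text \<open>
  By totality, failure of \<open>v a \<le> v b\<close> means \<open>v b < v a\<close>.
\<close>
lemma not_vdvd:
  assumes V: "valuation_ring R V" and a: "a \<in> carrier R" and b: "b \<in> carrier R" and "\<not> vdvd V a b"
  shows "\<exists>c\<in>nonunits V. a = b \<otimes> c"
proof -
  have sV: "subring V R" using V valuation_ring_def by blast
  note cl = subring_closed[OF sV]
  have "vdvd V b a" using vdvd_total[OF V a b] assms by blast
  then obtain c where c: "c \<in> V" "a = b \<otimes> c" unfolding vdvd_def by blast
  have "\<not> vdvd V c \<one>"
  proof
    assume "vdvd V c \<one>"
    then obtain d where d: "d \<in> V" "c \<otimes> d = \<one>" unfolding vdvd_one by blast
    have "b = b \<otimes> (c \<otimes> d)" using b d by simp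
    also have "\<dots> = a \<otimes> d" unfolding c(2) using b c d cl(1) by (simp add: m_assoc)
    finally have "vdvd V a b" using d(1) vdvdI by blast
    thus False using assms by blast
  qed
  thus ?thesis using c unfolding nonunits_def by blast
qed

lemma not_vdvd_mult_nonunit:
  assumes V: "subring V R" and "c \<in> nonunits V" "b \<in> carrier R" "b \<noteq> \<zero>" shows "\<not> vdvd V (b \<otimes> c) b"
proof
  note cl = subring_closed[OF V]
  assume "vdvd V (b \<otimes> c) b"
  then obtain d where d: "d \<in> V" "b = b \<otimes> c \<otimes> d" unfolding vdvd_def by blast
  have cd: "c \<in> carrier R" "d \<in> carrier R" using d nonunitsD(1)[OF assms(2)] cl by auto
  have "b \<otimes> \<one> = b \<otimes> (c \<otimes> d)" using d(2) assms(3) cd by (simp add: m_assoc)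
  hence "c \<otimes> d = \<one>" using m_lcancel[OF assms(4,3), of \<one> "c \<otimes> d"] cd by simp
  thus False using assms(2) d(1) unfolding nonunits_def vdvd_one by blast
qed

lemma nonunits_mult:
  assumes V: "subring V R" and "a \<in> nonunits V" "b \<in> V" shows "a \<otimes> b \<in> nonunits V" "b \<otimes> a \<in> nonunits V"
proof -
  note cl = subring_closed[OF V]
  have c: "a \<in> carrier R" "b \<in> carrier R" "a \<in> V" using assms cl nonunitsD by auto
  have "\<not> vdvd V (a \<otimes> b) \<one>"
  proof
    assume "vdvd V (a \<otimes> b) \<one>"
    then obtain d where "d \<in> V" "a \<otimes> b \<otimes> d = \<one>" unfolding vdvd_one by blast
    hence "a \<otimes> (b \<otimes> d) = \<one>" "b \<otimes> d \<in> V" using c cl assms by (auto simp: m_assoc)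
    thus False using nonunitsD(2)[OF assms(2)] unfolding vdvd_one by blast
  qed
  thus "a \<otimes> b \<in> nonunits V" unfolding nonunits_def using c assms cl by auto
  thus "b \<otimes> a \<in> nonunits V" using c m_comm by auto
qed

lemma nonunits_one: "subring V R \<Longrightarrow> \<one> \<notin> nonunits V"
  unfolding nonunits_def vdvd_one using subring_closed(3) by (auto intro!: bexI[of _ \<one>])

text \<open>
  The nonunits form an ideal because one of the two summands divides the other.
\<close>
lemma nonunits_add:
  assumes V: "valuation_ring R V" and "a \<in> nonunits V" "b \<in> nonunits V"
  shows "a \<oplus> b \<in> nonunits V"
proof -
  have sV: "subring V R" using V valuation_ring_def by blast
  note cl = subring_closed[OF sV]
  have *: "a \<oplus> b \<in> nonunits V" if ab: "vdvd V a b" "a \<in> nonunits V" "b \<in> nonunits V" for a b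
  proof -
    obtain c where c: "c \<in> V" "b = a \<otimes> c" using ab unfolding vdvd_def by blast
    have "a \<in> carrier R" using ab nonunitsD cl by blast
    hence "a \<oplus> b = a \<otimes> (\<one> \<oplus> c)" unfolding c(2) using cl(1)[OF c(1)] by algebra
    thus ?thesis using nonunits_mult(1)[OF sV ab(2)] c cl by auto
  qed
  have c: "a \<in> carrier R" "b \<in> carrier R" using assms nonunitsD cl by auto
  show ?thesis using vdvd_total[OF V c] *[of a b] *[of b a] assms a_comm[OF c] by auto
qed

lemma nonunits_subideal: "valuation_ring R V \<Longrightarrow> subideal V (nonunits V)"
  unfolding subideal_def
proof (intro conjI ballI)
  assume V: "valuation_ring R V"
  hence sV: "subring V R" using valuation_ring_def by blast
  show "nonunits V \<subseteq> V" unfolding nonunits_def by auto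
  show "\<zero> \<in> nonunits V" unfolding nonunits_def vdvd_def using subring_closed[OF sV] by auto
  show "a \<oplus> b \<in> nonunits V" if "a \<in> nonunits V" "b \<in> nonunits V" for a b
    using nonunits_add[OF V that] .
  show "c \<otimes> a \<in> nonunits V" if "a \<in> nonunits V" "c \<in> V" for a c
    using nonunits_mult(2)[OF sV that] .
qed

lemma unit_add_nonunit:
  assumes V: "valuation_ring R V" and "a \<in> V" "a \<notin> nonunits V" "b \<in> nonunits V"
  shows "a \<oplus> b \<in> V" "a \<oplus> b \<notin> nonunits V"
proof -
  have sV: "subring V R" using V valuation_ring_def by blast
  note cl = subring_closed[OF sV]
  have b: "b \<in> V" using assms nonunitsD by blast
  show "a \<oplus> b \<in> V" using assms b cl by blast
  have e: "a = (a \<oplus> b) \<ominus> b" using assms(2) b cl(1) by algebra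
  show "a \<oplus> b \<notin> nonunits V"
    using subideal_minus[OF sV nonunits_subideal[OF V], of "a \<oplus> b" b] e assms by auto
qed

lemma unit_vdvd:
  assumes V: "subring V R" and "a \<in> V" "a \<notin> nonunits V" and b: "b \<in> V"
  shows "vdvd V a b"
proof -
  note cl = subring_closed[OF V]
  obtain c where c: "c \<in> V" "a \<otimes> c = \<one>" using unitD[OF assms(2,3)] by blast
  have "a \<otimes> (c \<otimes> b) = (a \<otimes> c) \<otimes> b"
    using cl(1)[OF assms(2)] cl(1)[OF b] cl(1)[OF c(1)] by (metis m_assoc)
  hence "b = a \<otimes> (c \<otimes> b)" using c(2) cl(1)[OF b] by simp
  thus ?thesis using vdvdI[OF cl(7)[OF c(1) b]] by blast
qed

lemma unit_mult:
  assumes V: "subring V R" and "a \<in> V" "a \<notin> nonunits V" and b: "b \<in> V" "b \<notin> nonunits V"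
  shows "a \<otimes> b \<in> V" "a \<otimes> b \<notin> nonunits V"
proof -
  note cl = subring_closed[OF V]
  show "a \<otimes> b \<in> V" using cl(7)[OF assms(2) b(1)] .
  obtain c d where c: "c \<in> V" "a \<otimes> c = \<one>" "d \<in> V" "b \<otimes> d = \<one>" using unitD[OF assms(2,3)] unitD[OF b] by blast
  have ca: "a \<in> carrier R" "b \<in> carrier R" "c \<in> carrier R" "d \<in> carrier R" using assms c cl by auto
  have "(a \<otimes> b) \<otimes> (c \<otimes> d) = (a \<otimes> c) \<otimes> (b \<otimes> d)" using ca by algebra
  also have "\<dots> = \<one>" using c(2,4) by simp
  finally show "a \<otimes> b \<notin> nonunits V" using c cl(7) unfolding nonunits_def vdvd_one by blast
qed

lemma unit_pow:
  assumes V: "subring V R" and "a \<in> V" "a \<notin> nonunits V"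
  shows "a [^] (n::nat) \<in> V \<and> a [^] n \<notin> nonunits V"
proof (induct n)
  case 0
  thus ?case using subring_closed(3)[OF V] nonunits_one[OF V] by simp
next
  case (Suc n)
  thus ?case using unit_mult[OF V _ _ assms(2,3), of "a [^] n"] by simp
qed

end

section \<open>Polynomials in one element of the field\<close>

text \<open>
  The values at \<open>x\<close> of the polynomials of degree less than \<open>n\<close> with coefficients in \<open>C\<close>. The
  representation of an element is in general not unique; all that is used about an element is a bound
  for the degree of some representation.
\<close>
primrec (in ring) polys :: "'a \<Rightarrow> 'a set \<Rightarrow> nat \<Rightarrow> 'a set" where
  "polys x C 0 = {\<zero>}"
| "polys x C (Suc n) = {a \<oplus> c \<otimes> x [^] n | a c. a \<in> polys x C n \<and> c \<in> C}"

definition (in ring) monic :: "'a \<Rightarrow> 'a set \<Rightarrow> nat \<Rightarrow> 'a \<Rightarrow> bool" where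
  "monic x D n g \<longleftrightarrow> (\<exists>l\<in>polys x D n. g = x [^] n \<oplus> l)"

definition (in ring) polyring :: "'a \<Rightarrow> 'a set \<Rightarrow> 'a set" where
  "polyring x D = (\<Union>n. polys x D n)"

context cring
begin

context
  fixes D C x
  assumes D: "subring D R" and C: "subideal D C" and x: "x \<in> carrier R"
begin

lemma coeff_carrier: "c \<in> C \<Longrightarrow> c \<in> carrier R"
  using subring_closed(1)[OF D] subidealD(1)[OF C] by blast

lemma polys_carrier: "a \<in> polys x C n \<Longrightarrow> a \<in> carrier R"
proof (induct n arbitrary: a)
  case (Suc n)
  then obtain b c where "b \<in> polys x C n" "c \<in> C" "a = b \<oplus> c \<otimes> x [^] n" by auto
  thus ?case using Suc(1) coeff_carrier x by auto
qed simp

lemma polys_zero: "\<zero> \<in> polys x C n"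
proof (induct n)
  case (Suc n)
  have "\<zero> = \<zero> \<oplus> \<zero> \<otimes> x [^] n" using x by simp
  thus ?case using Suc subidealD(2)[OF C] by auto
qed simp

lemma polys_add: "a \<in> polys x C n \<Longrightarrow> b \<in> polys x C n \<Longrightarrow> a \<oplus> b \<in> polys x C n"
proof (induct n arbitrary: a b)
  case (Suc n)
  then obtain a' c b' d where *: "a' \<in> polys x C n" "c \<in> C" "a = a' \<oplus> c \<otimes> x [^] n"
    "b' \<in> polys x C n" "d \<in> C" "b = b' \<oplus> d \<otimes> x [^] n" by auto
  have cc: "a' \<in> carrier R" "b' \<in> carrier R" "c \<in> carrier R" "d \<in> carrier R" "x [^] n \<in> carrier R"
    using * polys_carrier coeff_carrier x by auto
  have "a \<oplus> b = (a' \<oplus> b') \<oplus> (c \<oplus> d) \<otimes> x [^] n" unfolding *(3,6) using cc by algebra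
  moreover have "a' \<oplus> b' \<in> polys x C n" "c \<oplus> d \<in> C" using Suc(1) * subidealD(3)[OF C] by auto
  ultimately show ?case by auto
qed simp

lemma polys_smult: "d \<in> D \<Longrightarrow> a \<in> polys x C n \<Longrightarrow> d \<otimes> a \<in> polys x C n"
proof (induct n arbitrary: a)
  case 0
  thus ?case using subring_closed(1)[OF D] by simp
next
  case (Suc n)
  then obtain a' c where *: "a' \<in> polys x C n" "c \<in> C" "a = a' \<oplus> c \<otimes> x [^] n" by auto
  have cc: "a' \<in> carrier R" "c \<in> carrier R" "x [^] n \<in> carrier R" "d \<in> carrier R"
    using * polys_carrier coeff_carrier x Suc(2) subring_closed(1)[OF D] by auto
  have "d \<otimes> a = d \<otimes> a' \<oplus> (d \<otimes> c) \<otimes> x [^] n" unfolding *(3) using cc by algebra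
  moreover have "d \<otimes> a' \<in> polys x C n" "d \<otimes> c \<in> C" using Suc * subidealD(4)[OF C] by auto
  ultimately show ?case by auto
qed

lemma polys_minus: "a \<in> polys x C n \<Longrightarrow> b \<in> polys x C n \<Longrightarrow> a \<ominus> b \<in> polys x C n"
proof -
  assume a: "a \<in> polys x C n" and b: "b \<in> polys x C n"
  have "\<ominus> \<one> \<in> D" using subring_closed[OF D] by auto
  hence "a \<oplus> (\<ominus> \<one>) \<otimes> b \<in> polys x C n" using polys_add[OF a polys_smult[OF _ b]] by blast
  moreover have "a \<oplus> (\<ominus> \<one>) \<otimes> b = a \<ominus> b" using a b polys_carrier by algebra
  ultimately show ?thesis by simp
qed

lemma polys_Suc: "a \<in> polys x C n \<Longrightarrow> a \<in> polys x C (Suc n)"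
proof -
  assume a: "a \<in> polys x C n"
  have "a = a \<oplus> \<zero> \<otimes> x [^] n" using polys_carrier[OF a] x by simp
  thus ?thesis using a subidealD(2)[OF C] by auto
qed

lemma polys_mono: "n \<le> m \<Longrightarrow> a \<in> polys x C n \<Longrightarrow> a \<in> polys x C m"
proof (induct m)
  case (Suc m)
  thus ?case using polys_Suc le_Suc_eq by metis
qed simp

lemma polys_monomial: "c \<in> C \<Longrightarrow> k < n \<Longrightarrow> c \<otimes> x [^] k \<in> polys x C n"
proof -
  assume c: "c \<in> C" and k: "k < n"
  have "c \<otimes> x [^] k = \<zero> \<oplus> c \<otimes> x [^] k" using coeff_carrier[OF c] x by simp
  hence "c \<otimes> x [^] k \<in> polys x C (Suc k)" using c polys_zero by auto
  thus ?thesis using polys_mono k by (metis Suc_leI)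
qed

lemma polys_shift: "a \<in> polys x C n \<Longrightarrow> x \<otimes> a \<in> polys x C (Suc n)"
proof (induct n arbitrary: a)
  case 0
  thus ?case using x polys_zero[of "Suc 0"] by simp
next
  case (Suc n)
  then obtain a' c where *: "a' \<in> polys x C n" "c \<in> C" "a = a' \<oplus> c \<otimes> x [^] n" by auto
  have cc: "a' \<in> carrier R" "c \<in> carrier R" "x [^] n \<in> carrier R"
    using * polys_carrier coeff_carrier x by auto
  have "x \<otimes> a = x \<otimes> a' \<oplus> c \<otimes> x [^] (Suc n)" unfolding *(3) nat_pow_Suc using cc x by algebra
  thus ?case using Suc(1)[OF *(1)] *(2) by auto
qed

lemma polys_shift_pow: "a \<in> polys x C n \<Longrightarrow> x [^] k \<otimes> a \<in> polys x C (n + k)"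
proof (induct k)
  case 0
  thus ?case using polys_carrier by simp
next
  case (Suc k)
  have "x [^] Suc k \<otimes> a = x \<otimes> (x [^] k \<otimes> a)"
    using polys_carrier[OF Suc(2)] x nat_pow_closed[OF x, of k] unfolding nat_pow_Suc by algebra
  thus ?case using polys_shift[OF Suc(1)[OF Suc(2)]] by simp
qed

end

context
  fixes D x
  assumes D: "subring D R" and x: "x \<in> carrier R"
begin

lemma polys_mult:
  assumes C: "subideal D C"
  shows "a \<in> polys x D n \<Longrightarrow> b \<in> polys x C (Suc m) \<Longrightarrow> a \<otimes> b \<in> polys x C (n + m)"
proof (induct n arbitrary: a)
  case 0
  have "b \<in> carrier R" using polys_carrier[OF D C x 0(2)] .
  thus ?case using 0 polys_zero[OF D C x] by simp
next
  case (Suc n)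
  have DD: "subideal D D" using subideal_self[OF D] .
  from Suc obtain a' c where *: "a' \<in> polys x D n" "c \<in> D" "a = a' \<oplus> c \<otimes> x [^] n" by auto
  have cc: "a' \<in> carrier R" "c \<in> carrier R" "x [^] n \<in> carrier R" "b \<in> carrier R"
    using polys_carrier[OF D DD x *(1)] polys_carrier[OF D C x Suc(3)] subring_closed(1)[OF D *(2)] x by auto
  have "a \<otimes> b = a' \<otimes> b \<oplus> c \<otimes> (x [^] n \<otimes> b)" unfolding *(3) using cc by algebra
  moreover have "a' \<otimes> b \<in> polys x C (Suc n + m)"
    using polys_Suc[OF D C x Suc(1)[OF *(1) Suc(3)]] by simp
  moreover have "c \<otimes> (x [^] n \<otimes> b) \<in> polys x C (Suc n + m)"
    using polys_smult[OF D C x *(2) polys_shift_pow[OF D C x Suc(3), of n]] by (simp add: add.commute)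
  ultimately show ?case using polys_add[OF D C x] by metis
qed

lemma polyring_subring: "subring (polyring x D) R"
proof (rule subringI)
  note DD = subideal_self[OF D]
  note pa = polys_add[OF D DD x] and pm = polys_mono[OF D DD x] and pc = polys_carrier[OF D DD x]
  have two: "\<exists>n. a \<in> polys x D n \<and> b \<in> polys x D n" if "a \<in> polyring x D" "b \<in> polyring x D" for a b
  proof -
    from that obtain n m where "a \<in> polys x D n" "b \<in> polys x D m" unfolding polyring_def by auto
    thus ?thesis using pm[of n "max n m" a] pm[of m "max n m" b] by auto
  qed
  show "polyring x D \<subseteq> carrier R" unfolding polyring_def using pc by auto
  have "\<one> \<otimes> x [^] (0::nat) \<in> polys x D 1"
    using polys_monomial[OF D DD x subring_closed(3)[OF D], of 0 1] by simp
  moreover have "\<one> \<otimes> x [^] (0::nat) = \<one>" by simp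
  ultimately show "\<one> \<in> polyring x D" unfolding polyring_def by (metis UN_I UNIV_I)
  show "\<ominus> h \<in> polyring x D" if "h \<in> polyring x D" for h
  proof -
    obtain n where h: "h \<in> polys x D n" using \<open>h \<in> polyring x D\<close> unfolding polyring_def by auto
    have "\<zero> \<ominus> h \<in> polys x D n" using polys_minus[OF D DD x polys_zero[OF D DD x] h] .
    moreover have "\<zero> \<ominus> h = \<ominus> h" using pc[OF h] by algebra
    ultimately show ?thesis unfolding polyring_def by auto
  qed
  show "a \<oplus> b \<in> polyring x D" if "a \<in> polyring x D" "b \<in> polyring x D" for a b
    using two[OF that] pa unfolding polyring_def by blast
  show "a \<otimes> b \<in> polyring x D" if "a \<in> polyring x D" "b \<in> polyring x D" for a b
    using two[OF that] polys_mult[OF DD, of a _ b] polys_Suc[OF D DD x] unfolding polyring_def by blast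
qed

lemma polys_polyring: "a \<in> polys x D n \<Longrightarrow> a \<in> polyring x D"
  unfolding polyring_def by auto

lemma polyring_const: "D \<subseteq> polyring x D"
proof
  fix d assume d: "d \<in> D"
  have "d \<otimes> x [^] (0::nat) \<in> polys x D 1"
    using polys_monomial[OF D subideal_self[OF D] x d, of 0 1] by simp
  moreover have "d \<otimes> x [^] (0::nat) = d" using subring_closed(1)[OF D d] by simp
  ultimately show "d \<in> polyring x D" using polys_polyring by metis
qed

lemma polyring_var: "x \<in> polyring x D"
proof -
  have "\<one> \<otimes> x [^] (1::nat) \<in> polys x D 2"
    using polys_monomial[OF D subideal_self[OF D] x subring_closed(3)[OF D], of 1 2] by simp
  thus ?thesis using x polys_polyring by simp
qed

lemma monicD:
  assumes "monic x D n g"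
  shows "g \<in> polys x D (Suc n)" "g \<in> polyring x D" "g \<in> carrier R"
proof -
  note DD = subideal_self[OF D]
  obtain l where l: "l \<in> polys x D n" "g = x [^] n \<oplus> l" using assms unfolding monic_def by auto
  have "g = l \<oplus> \<one> \<otimes> x [^] n" unfolding l(2) using polys_carrier[OF D DD x l(1)] x by (simp add: a_comm)
  thus *: "g \<in> polys x D (Suc n)" using l(1) subring_closed(3)[OF D] by auto
  show "g \<in> polyring x D" using polys_polyring[OF *] .
  show "g \<in> carrier R" using polys_carrier[OF D DD x *] .
qed

lemma monic_mult:
  assumes "monic x D n g" "monic x D m h" shows "monic x D (n + m) (g \<otimes> h)"
proof -
  note DD = subideal_self[OF D]
  obtain l where l: "l \<in> polys x D n" "g = x [^] n \<oplus> l" using assms unfolding monic_def by auto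
  obtain k where k: "k \<in> polys x D m" "h = x [^] m \<oplus> k" using assms unfolding monic_def by auto
  have c: "l \<in> carrier R" "k \<in> carrier R" "h \<in> carrier R" using polys_carrier[OF D DD x] l k monicD(3)[OF assms(2)] by auto
  have "g \<otimes> h = x [^] n \<otimes> h \<oplus> l \<otimes> h" unfolding l(2) using c x by (simp add: l_distr)
  also have "x [^] n \<otimes> h = x [^] (n + m) \<oplus> x [^] n \<otimes> k" unfolding k(2) using c x by (simp add: r_distr nat_pow_mult)
  finally have "g \<otimes> h = x [^] (n + m) \<oplus> (x [^] n \<otimes> k \<oplus> l \<otimes> h)" using c x by (simp add: a_assoc)
  moreover have "x [^] n \<otimes> k \<in> polys x D (n + m)" using polys_shift_pow[OF D DD x k(1), of n] by (simp add: add.commute)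
  moreover have "l \<otimes> h \<in> polys x D (n + m)" using polys_mult[OF DD l(1) monicD(1)[OF assms(2)]] .
  ultimately show ?thesis unfolding monic_def using polys_add[OF D DD x] by blast
qed

lemma monic_one: "monic x D 0 \<one>"
  unfolding monic_def by auto

lemma monic_pow: "monic x D n g \<Longrightarrow> monic x D (k * n) (g [^] k)"
proof (induct k)
  case 0 thus ?case using monic_one by simp
next
  case (Suc k)
  thus ?case using monic_mult[OF Suc(1) Suc(2)] by (simp add: add.commute)
qed

text \<open>
  Long division: subtracting a multiple of \<open>g\<close> removes the top coefficient, exactly because \<open>g\<close> is monic.
\<close>
lemma monic_division:
  assumes g: "monic x D n g" and a: "a \<in> polyring x D"
  shows "\<exists>q\<in>polyring x D. a \<ominus> q \<otimes> g \<in> polys x D n"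
proof -
  note DD = subideal_self[OF D]
  note rcl = subring_closed[OF polyring_subring]
  obtain l where l: "l \<in> polys x D n" "g = x [^] n \<oplus> l" using g unfolding monic_def by auto
  have lc: "l \<in> carrier R" "g \<in> carrier R" using polys_carrier[OF D DD x l(1)] monicD(3)[OF g] by auto
  have "\<exists>q\<in>polyring x D. a \<ominus> q \<otimes> g \<in> polys x D n" if "a \<in> polys x D N" for a N
    using that
  proof (induct N arbitrary: a)
    case 0
    have "a \<ominus> \<zero> \<otimes> g \<in> polys x D n" using 0 polys_zero[OF D DD x] lc by (simp add: a_minus_def)
    thus ?case using rcl(2) by blast
  next
    case (Suc N)
    show ?case
    proof (cases "Suc N \<le> n")
      case True
      hence "a \<in> polys x D n" using polys_mono[OF D DD x True Suc(2)] by blast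
      hence "a \<ominus> \<zero> \<otimes> g \<in> polys x D n" using lc polys_carrier[OF D DD x Suc(2)] by (simp add: a_minus_def)
      thus ?thesis using rcl(2) by blast
    next
      case False
      define k where "k = N - n"
      have N: "N = n + k" using False unfolding k_def by simp
      obtain a' c where *: "a' \<in> polys x D N" "c \<in> D" "a = a' \<oplus> c \<otimes> x [^] N" using Suc(2) by auto
      have cc: "a' \<in> carrier R" "c \<in> carrier R" "x [^] n \<in> carrier R" "x [^] k \<in> carrier R"
        using * polys_carrier[OF D DD x] subring_closed(1)[OF D] x by auto
      have "x [^] N = x [^] k \<otimes> x [^] n" using x by (simp add: nat_pow_mult N add.commute)
      hence "a \<ominus> (c \<otimes> x [^] k) \<otimes> g = a' \<ominus> c \<otimes> (x [^] k \<otimes> l)"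
        unfolding *(3) l(2) using cc lc by (simp, algebra)
      moreover have "\<dots> \<in> polys x D N"
        using polys_minus[OF D DD x *(1)[unfolded N] polys_smult[OF D DD x *(2) polys_shift_pow[OF D DD x l(1), of k]]] N by simp
      ultimately obtain q where q: "q \<in> polyring x D" "a \<ominus> (c \<otimes> x [^] k) \<otimes> g \<ominus> q \<otimes> g \<in> polys x D n"
        using Suc(1) by metis
      have qc: "q \<in> carrier R" using rcl(1)[OF q(1)] .
      have ac: "a \<in> carrier R" using polys_carrier[OF D DD x Suc(2)] .
      have "a \<ominus> (c \<otimes> x [^] k) \<otimes> g \<ominus> q \<otimes> g = a \<ominus> (c \<otimes> x [^] k \<oplus> q) \<otimes> g"
        using qc cc ac lc by algebra
      moreover have "c \<otimes> x [^] k \<oplus> q \<in> polyring x D"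
        using rcl(5)[OF polys_polyring[OF polys_monomial[OF D DD x *(2), of k "Suc k"]] q(1)] by simp
      ultimately show ?thesis using q(2) by metis
    qed
  qed
  thus ?thesis using a unfolding polyring_def by blast
qed

end

end

section \<open>Local rings with two parameters\<close>

text \<open>
  A local ring \<open>D\<close> whose maximal ideal is generated by \<open>s\<close> and \<open>t\<close>.
\<close>
locale local_pair = field R for R (structure) + fixes D :: "'a set" and s t :: 'a
  assumes sub: "subring D R" and sD: "s \<in> D" and tD: "t \<in> D"
    and proper: "\<one> \<notin> gen2 D s t"
    and loc: "a \<in> D \<Longrightarrow> a \<notin> gen2 D s t \<Longrightarrow> \<exists>b\<in>D. a \<otimes> b = \<one>"
begin

abbreviation "m \<equiv> gen2 D s t"

lemmas Dcl = subring_closed[OF sub]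

lemma st_carrier: "s \<in> carrier R" "t \<in> carrier R"
  using sD tD Dcl(1) by auto

lemma m_ideal: "subideal D m"
  by (rule gen2_subideal[OF sub sD tD])

lemma st_m: "s \<in> m" "t \<in> m"
  using gen2_in[OF sub sD tD] by auto

lemma local_pair_swap: "local_pair R D t s"
proof (intro local_pair.intro local_pair_axioms.intro field_axioms)
  note sw = gen2_comm[OF sub tD sD]
  show "\<one> \<notin> gen2 D t s" using proper sw by simp
  show "\<exists>b\<in>D. a \<otimes> b = \<one>" if "a \<in> D" "a \<notin> gen2 D t s" for a using loc that sw by simp
qed (use sub sD tD in auto)

lemma one_minus_unit:
  assumes z: "z \<in> m" shows "\<exists>b\<in>D. (\<one> \<ominus> z) \<otimes> b = \<one>"
proof -
  have zD: "z \<in> D" using subidealD(1)[OF m_ideal z] .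
  have "\<one> \<ominus> z \<notin> m"
  proof
    assume "\<one> \<ominus> z \<in> m"
    hence "(\<one> \<ominus> z) \<oplus> z \<in> m" using subidealD(3)[OF m_ideal _ z] by blast
    moreover have "(\<one> \<ominus> z) \<oplus> z = \<one>" using Dcl(1)[OF zD] by algebra
    ultimately show False using proper by simp
  qed
  thus ?thesis using loc Dcl(3,6) zD by blast
qed

lemma pow_in_ideal:
  assumes I: "subideal D I" and len: "len_le D I n"
  shows "\<exists>a. t [^] (a::nat) \<in> I"
  using len_le_power[OF sub I len tD] one_minus_unit subideal_r[OF sub m_ideal _ st_m(2)] by blast

lemma proper_ideal_m:
  assumes I: "subideal D I" and "\<one> \<notin> I" shows "I \<subseteq> m"
proof
  fix a assume a: "a \<in> I"
  show "a \<in> m"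
  proof (rule ccontr)
    assume "a \<notin> m"
    then obtain b where "b \<in> D" "a \<otimes> b = \<one>" using loc subidealD(1)[OF I a] by blast
    thus False using subideal_r[OF sub I _ a] assms(2) by metis
  qed
qed

end

text \<open>
  The properties of a two-dimensional regular local ring that are inherited by its quadratic
  transforms: the parameters form a regular sequence, and every element of the field is a fraction
  \<open>G / F\<close> with \<open>D / (F, G)\<close> of finite length. For a Noetherian ring the last property says that
  \<open>F\<close> and \<open>G\<close> have no common component; stating it with lengths makes it inductive without
  proving that the transforms are Noetherian.
\<close>
locale regular_pair = local_pair +
  assumes s_nz: "s \<noteq> \<zero>" and t_nz: "t \<noteq> \<zero>"
    and regular: "c \<in> D \<Longrightarrow> d \<in> D \<Longrightarrow> c \<otimes> s = t \<otimes> d \<Longrightarrow> \<exists>c'\<in>D. c = t \<otimes> c'"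
    and rep: "y \<in> carrier R \<Longrightarrow> y \<noteq> \<zero> \<Longrightarrow>
      \<exists>F\<in>D. \<exists>G\<in>D. \<exists>n. F \<noteq> \<zero> \<and> y \<otimes> F = G \<and> len_le D (gen2 D F G) n"
begin

lemma swap: "regular_pair R D t s"
proof (intro regular_pair.intro[OF local_pair_swap] regular_pair_axioms.intro)
  show "\<exists>c'\<in>D. c = s \<otimes> c'" if c: "c \<in> D" and d: "d \<in> D" and e: "c \<otimes> t = s \<otimes> d" for c d
  proof -
    have cc: "c \<in> carrier R" "d \<in> carrier R" using c d Dcl by auto
    have "d \<otimes> s = t \<otimes> c" using e cc st_carrier by (simp add: m_comm)
    then obtain d' where d': "d' \<in> D" "d = t \<otimes> d'" using regular d c by blast
    have "t \<otimes> c = t \<otimes> (s \<otimes> d')" using \<open>d \<otimes> s = t \<otimes> c\<close> unfolding d'(2)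
      using Dcl(1)[OF d'(1)] st_carrier cc by algebra
    hence "c = s \<otimes> d'" using m_lcancel[OF t_nz st_carrier(2)] cc st_carrier Dcl(1)[OF d'(1)] by simp
    thus ?thesis using d'(1) by blast
  qed
qed (use s_nz t_nz rep in auto)

end

section \<open>A chart of the blow-up\<close>

text \<open>
  The chart \<open>D[x]\<close>, \<open>x = s / t\<close>, of the blow-up of the closed point. Here \<open>T\<close> is the ideal \<open>t D[x]\<close>
  of the exceptional curve, \<open>P n\<close> and \<open>M n\<close> are the polynomials of degree less than \<open>n\<close> with
  coefficients in \<open>D\<close> and in the maximal ideal \<open>m\<close>. The lemmas up to \<open>lead\<close> say in these terms
  that \<open>D[x] / t D[x]\<close> is a polynomial ring over the residue field \<open>D / m\<close>.
\<close>
locale chart = regular_pair + fixes x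
  assumes x: "x \<in> carrier R" and sx: "s = t \<otimes> x"
begin

abbreviation "P \<equiv> polys x D"
abbreviation "M \<equiv> polys x m"
abbreviation "Rx \<equiv> polyring x D"
definition "T = {t \<otimes> a | a. a \<in> Rx}"

lemmas DD = subideal_self[OF sub]
lemmas Pc = polys_carrier[OF sub DD x]
lemmas Rsub = polyring_subring[OF sub x]
lemmas Rcl = subring_closed[OF Rsub]

lemma RD: "d \<in> D \<Longrightarrow> d \<in> Rx"
  using polyring_const[OF sub x] by blast

lemma T_iff: "a \<in> T \<longleftrightarrow> (\<exists>b\<in>Rx. a = t \<otimes> b)"
  unfolding T_def by auto

lemma tpow_R: "t [^] (n::nat) \<in> Rx" "t [^] (n::nat) \<in> D" "t [^] n \<in> carrier R"
  using subring_pow[OF sub tD] RD st_carrier by auto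

lemma T_ideal: "subideal Rx T"
proof -
  have "T = gen2 Rx t t"
  proof (intro equalityI subsetI)
    fix a assume "a \<in> T"
    then obtain b where b: "b \<in> Rx" "a = t \<otimes> b" unfolding T_iff by blast
    have "a = t \<otimes> b \<oplus> t \<otimes> \<zero>" using b Rcl(1) st_carrier by simp
    thus "a \<in> gen2 Rx t t" unfolding gen2_def using b Rcl(2) by blast
  next
    fix a assume "a \<in> gen2 Rx t t"
    then obtain b c where b: "b \<in> Rx" "c \<in> Rx" "a = t \<otimes> b \<oplus> t \<otimes> c" unfolding gen2_def by blast
    have "a = t \<otimes> (b \<oplus> c)" unfolding b(3) using Rcl(1)[OF b(1)] Rcl(1)[OF b(2)] st_carrier by (simp add: r_distr)
    thus "a \<in> T" unfolding T_iff using b Rcl(5) by blast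
  qed
  thus ?thesis using gen2_subideal[OF Rsub RD[OF tD] RD[OF tD]] by simp
qed

lemma M_P: "a \<in> M n \<Longrightarrow> a \<in> P n"
proof (induct n arbitrary: a)
  case (Suc n)
  thus ?case using subidealD(1)[OF m_ideal] by auto
qed simp

lemma tP_M: "a \<in> P n \<Longrightarrow> t \<otimes> a \<in> M n"
proof (induct n arbitrary: a)
  case 0 thus ?case using st_carrier by simp
next
  case (Suc n)
  then obtain a' c where *: "a' \<in> P n" "c \<in> D" "a = a' \<oplus> c \<otimes> x [^] n" by auto
  have "t \<otimes> a = t \<otimes> a' \<oplus> (t \<otimes> c) \<otimes> x [^] n" unfolding *(3)
    using Pc[OF *(1)] Dcl(1)[OF *(2)] x st_carrier nat_pow_closed[OF x, of n] by algebra
  thus ?case using Suc(1)[OF *(1)] subideal_r[OF sub m_ideal *(2) st_m(2)] by auto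
qed

text \<open>
  An element of \<open>m\<close> is \<open>t\<close> times a linear polynomial, because \<open>s = t x\<close>.
\<close>
lemma M_tP: "a \<in> M n \<Longrightarrow> \<exists>b\<in>P (Suc n). a = t \<otimes> b"
proof (induct n arbitrary: a)
  case 0
  have "a = t \<otimes> \<zero>" using 0 st_carrier by simp
  thus ?case using polys_zero[OF sub DD x] by blast
next
  case (Suc n)
  then obtain a' c where *: "a' \<in> M n" "c \<in> m" "a = a' \<oplus> c \<otimes> x [^] n" by auto
  obtain b where b: "b \<in> P (Suc n)" "a' = t \<otimes> b" using Suc(1)[OF *(1)] by blast
  obtain u v where uv: "u \<in> D" "v \<in> D" "c = s \<otimes> u \<oplus> t \<otimes> v" using *(2) unfolding gen2_def by auto
  have cc: "b \<in> carrier R" "u \<in> carrier R" "v \<in> carrier R" using Pc[OF b(1)] Dcl(1) uv by auto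
  have "a = t \<otimes> ((b \<oplus> v \<otimes> x [^] n) \<oplus> u \<otimes> x [^] (Suc n))"
    unfolding *(3) b(2) uv(3) sx nat_pow_Suc using cc x st_carrier nat_pow_closed[OF x, of n] by algebra
  moreover have "b \<oplus> v \<otimes> x [^] n \<in> P (Suc n)"
    using polys_add[OF sub DD x b(1) polys_monomial[OF sub DD x uv(2)]] by blast
  hence "(b \<oplus> v \<otimes> x [^] n) \<oplus> u \<otimes> x [^] (Suc n) \<in> P (Suc (Suc n))" using uv(1) by (subst polys.simps(2)) blast
  ultimately show ?case by blast
qed

lemma M_T: "a \<in> M n \<Longrightarrow> a \<in> T"
  using M_tP polys_polyring[OF sub x] unfolding T_iff by blast

lemma T_M: "a \<in> T \<Longrightarrow> \<exists>n. a \<in> M n"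
  using tP_M unfolding T_iff polyring_def by blast

text \<open>
  Multiplication by \<open>t ^ n\<close> turns a polynomial of degree at most \<open>n\<close> in \<open>s / t\<close> into a form of degree \<open>n\<close> in \<open>s, t\<close>.
\<close>
lemma clear_denominators: "a \<in> P (Suc n) \<Longrightarrow> t [^] n \<otimes> a \<in> D"
proof (induct n arbitrary: a)
  case 0
  then obtain c where "c \<in> D" "a = \<zero> \<oplus> c \<otimes> x [^] (0::nat)" by auto
  thus ?case using Dcl(1) by simp
next
  case (Suc n)
  obtain a' c where *: "a' \<in> P (Suc n)" "c \<in> D" "a = a' \<oplus> c \<otimes> x [^] (Suc n)"
    using Suc(2)
    unfolding polys.simps(2)[where n = "Suc n"] by blast
  have cc: "a' \<in> carrier R" "c \<in> carrier R" using Pc[OF *(1)] Dcl(1)[OF *(2)] by auto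
  have e: "s [^] Suc n = t [^] Suc n \<otimes> x [^] Suc n" unfolding sx by (rule nat_pow_distrib[OF st_carrier(2) x])
  have "t [^] Suc n \<otimes> a = t \<otimes> (t [^] n \<otimes> a') \<oplus> c \<otimes> s [^] Suc n"
    unfolding *(3) e unfolding nat_pow_Suc
    using cc x st_carrier(2) nat_pow_closed[OF x, of n] nat_pow_closed[OF st_carrier(2), of n] by algebra
  thus ?case using Suc(1)[OF *(1)] * Dcl(5,7) tD subring_pow[OF sub sD] by metis
qed

lemma regular_pow: "c \<in> D \<Longrightarrow> d \<in> D \<Longrightarrow> c \<otimes> s [^] (n::nat) = t \<otimes> d \<Longrightarrow> \<exists>c'\<in>D. c = t \<otimes> c'"
proof (induct n arbitrary: d)
  case 0 thus ?case using Dcl(1) by auto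
next
  case (Suc n)
  have sn: "s [^] n \<in> D" by (rule subring_pow[OF sub sD])
  have "(c \<otimes> s [^] n) \<otimes> s = t \<otimes> d" using Suc(4) Dcl(1)[OF Suc(2)] st_carrier by (simp add: m_assoc)
  then obtain d' where "d' \<in> D" "c \<otimes> s [^] n = t \<otimes> d'" using regular Suc(2,3) Dcl(7)[OF Suc(2) sn] by blast
  thus ?case using Suc(1,2) by blast
qed

text \<open>
  The only algebraic relations satisfied by \<open>x\<close> are the multiples of \<open>t x - s\<close>: clearing denominators
  in a relation gives \<open>c * s ^ n \<in> t D\<close>, and \<open>s, t\<close> is a regular sequence.
\<close>
lemma top_coeff:
  assumes c: "c \<in> D" and a: "c \<otimes> x [^] n \<in> P n"
  shows "\<exists>d\<in>D. c = t \<otimes> d"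
proof (cases n)
  case 0
  hence "c = t \<otimes> \<zero>" using a Dcl(1)[OF c] st_carrier by auto
  thus ?thesis using Dcl(2) by blast
next
  case (Suc k)
  have cc: "c \<in> carrier R" using c Dcl by auto
  have d: "t [^] k \<otimes> (c \<otimes> x [^] n) \<in> D" using clear_denominators a Suc by blast
  have e: "s [^] n = t [^] n \<otimes> x [^] n" unfolding sx using st_carrier x by (simp add: nat_pow_distrib)
  have "c \<otimes> s [^] n = t \<otimes> (t [^] k \<otimes> (c \<otimes> x [^] n))" unfolding e unfolding Suc nat_pow_Suc
    using cc x st_carrier(2) nat_pow_closed[OF x, of k] nat_pow_closed[OF st_carrier(2), of k] by algebra
  thus ?thesis using regular_pow c d by blast
qed

text \<open>
  If an element has one representation of small degree and another one with coefficients in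
  \<open>m\<close>, it has one with both properties: a top coefficient that is too high is \<open>t d\<close> by
  \<open>top_coeff\<close>, and \<open>t d x ^ (k + 1) = d s x ^ k\<close> has smaller degree and still a coefficient in \<open>m\<close>.
\<close>
lemma M_degree: "a \<in> P i \<Longrightarrow> a \<in> M N \<Longrightarrow> a \<in> M i"
proof (induct N)
  case 0
  thus ?case using polys_zero[OF sub m_ideal x] by simp
next
  case (Suc N)
  show ?case
  proof (cases "Suc N \<le> i")
    case True
    thus ?thesis using polys_mono[OF sub m_ideal x True] Suc by blast
  next
    case False
    obtain a' c where *: "a' \<in> M N" "c \<in> m" "a = a' \<oplus> c \<otimes> x [^] N" using Suc by auto
    have cD: "c \<in> D" using subidealD(1)[OF m_ideal *(2)] .
    have cc: "a' \<in> carrier R" "c \<in> carrier R" using polys_carrier[OF sub m_ideal x *(1)] Dcl(1)[OF cD] by auto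
    have "a \<in> P N" using polys_mono[OF sub DD x _ Suc(2), of N] False by simp
    hence "a \<ominus> a' \<in> P N" using polys_minus[OF sub DD x _ M_P[OF *(1)]] by blast
    moreover have e: "a \<ominus> a' = c \<otimes> x [^] N" unfolding *(3) using cc x nat_pow_closed[OF x, of N] by algebra
    ultimately have cP: "c \<otimes> x [^] N \<in> P N" by simp
    then obtain d where d: "d \<in> D" "c = t \<otimes> d" using top_coeff[OF cD] by blast
    have "c \<otimes> x [^] N \<in> M N"
    proof (cases N)
      case 0
      thus ?thesis using cP by simp
    next
      case N: (Suc k)
      have "c \<otimes> x [^] N = (d \<otimes> s) \<otimes> x [^] k" unfolding d(2) N nat_pow_Suc
        using Dcl(1)[OF d(1)] st_carrier(2) x nat_pow_closed[OF x, of k] unfolding sx by algebra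
      thus ?thesis using polys_monomial[OF sub m_ideal x subidealD(4)[OF m_ideal d(1) st_m(1)], of k N] N by simp
    qed
    hence "a \<in> M N" unfolding *(3) using polys_add[OF sub m_ideal x *(1)] by blast
    thus ?thesis using Suc(1,2) by blast
  qed
qed

text \<open>
  A monic polynomial does not vanish on the exceptional curve; otherwise, by \<open>M_degree\<close>, its
  leading coefficient \<open>1\<close> would be congruent to an element of \<open>m\<close> modulo \<open>t\<close>.
\<close>
lemma monic_not_T:
  assumes "monic x D n g" shows "g \<notin> T"
proof
  assume "g \<in> T"
  then obtain N where "g \<in> M N" using T_M by blast
  moreover obtain l where l: "l \<in> P n" "g = x [^] n \<oplus> l" using assms unfolding monic_def by blast
  ultimately have "g \<in> M (Suc n)" using M_degree monicD(1)[OF sub x assms] by blast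
  then obtain k c where k: "k \<in> M n" "c \<in> m" "g = k \<oplus> c \<otimes> x [^] n" by auto
  have cD: "c \<in> D" using subidealD(1)[OF m_ideal k(2)] .
  have cc: "k \<in> carrier R" "c \<in> carrier R" "l \<in> carrier R" "x [^] n \<in> carrier R"
    using polys_carrier[OF sub m_ideal x k(1)] Dcl(1)[OF cD] Pc[OF l(1)] x by auto
  have "(\<one> \<ominus> c) \<otimes> x [^] n = (x [^] n \<oplus> l) \<ominus> l \<ominus> c \<otimes> x [^] n" using cc by algebra
  also have "\<dots> = (k \<oplus> c \<otimes> x [^] n) \<ominus> l \<ominus> c \<otimes> x [^] n" using l(2) k(3) by simp
  also have "\<dots> = k \<ominus> l" using cc by algebra
  finally have "(\<one> \<ominus> c) \<otimes> x [^] n \<in> P n" using polys_minus[OF sub DD x M_P[OF k(1)] l(1)] by simp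
  then obtain d where d: "d \<in> D" "\<one> \<ominus> c = t \<otimes> d" using top_coeff Dcl(3,6) cD by blast
  have "\<one> \<ominus> c \<in> m" unfolding d(2) using subideal_r[OF sub m_ideal d(1) st_m(2)] .
  hence "(\<one> \<ominus> c) \<oplus> c \<in> m" using subidealD(3)[OF m_ideal] k(2) by blast
  moreover have "(\<one> \<ominus> c) \<oplus> c = \<one>" using cc by algebra
  ultimately show False using proper by simp
qed

lemma one_not_T: "\<one> \<notin> T"
  using monic_not_T[OF monic_one[OF sub x]] .

text \<open>
  Top coefficients in \<open>m\<close> can be dropped modulo \<open>T\<close>; the first other one is a unit.
\<close>
lemma lead:
  assumes "a \<in> P n" "a \<notin> T"
  shows "\<exists>d<n. \<exists>c\<in>D. \<exists>c'\<in>D. \<exists>g. c \<otimes> c' = \<one> \<and> monic x D d g \<and> (\<exists>b\<in>Rx. a = c \<otimes> g \<oplus> t \<otimes> b)"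
  using assms
proof (induct n arbitrary: a)
  case 0
  thus ?case using subidealD(2)[OF T_ideal] by simp
next
  case (Suc n)
  then obtain a' c where *: "a' \<in> P n" "c \<in> D" "a = a' \<oplus> c \<otimes> x [^] n" by auto
  have cc: "a' \<in> carrier R" "c \<in> carrier R" "x [^] n \<in> carrier R" using Pc[OF *(1)] Dcl(1)[OF *(2)] x by auto
  show ?case
  proof (cases "c \<in> m")
    case True
    have cT: "c \<otimes> x [^] n \<in> T" using M_T polys_monomial[OF sub m_ideal x True, of n "Suc n"] by blast
    hence "a' \<notin> T" using Suc(3) subidealD(3)[OF T_ideal] *(3) by blast
    then obtain d e e' g b where h: "d < n" "e \<in> D" "e' \<in> D" "e \<otimes> e' = \<one>" "monic x D d g" "b \<in> Rx" "a' = e \<otimes> g \<oplus> t \<otimes> b"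
      using Suc(1)[OF *(1)] by blast
    obtain b' where b': "b' \<in> Rx" "c \<otimes> x [^] n = t \<otimes> b'" using cT unfolding T_iff by blast
    have "a = e \<otimes> g \<oplus> t \<otimes> (b \<oplus> b')" unfolding *(3) b'(2) h(7)
      using Dcl(1)[OF h(2)] monicD(3)[OF sub x h(5)] Rcl(1)[OF h(6)] Rcl(1)[OF b'(1)] st_carrier by algebra
    moreover have "b \<oplus> b' \<in> Rx" using Rcl(5) h(6) b'(1) by blast
    ultimately show ?thesis using h less_SucI by metis
  next
    case False
    then obtain c' where c': "c' \<in> D" "c \<otimes> c' = \<one>" using loc *(2) by blast
    have c'c: "c' \<in> carrier R" using c' Dcl by auto
    have mon: "monic x D n (x [^] n \<oplus> c' \<otimes> a')" unfolding monic_def using polys_smult[OF sub DD x c'(1) *(1)] by blast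
    have "c \<otimes> (x [^] n \<oplus> c' \<otimes> a') \<oplus> t \<otimes> \<zero> = c \<otimes> x [^] n \<oplus> (c \<otimes> c') \<otimes> a'"
      using cc c'c st_carrier by (simp add: r_distr m_assoc)
    also have "\<dots> = a" unfolding c'(2) *(3) using cc by (simp add: a_comm)
    finally show ?thesis using mon c' *(2) Rcl(2) by (metis lessI)
  qed
qed

lemma leadR:
  assumes "a \<in> Rx" "a \<notin> T"
  shows "\<exists>d. \<exists>c\<in>D. \<exists>c'\<in>D. \<exists>g. c \<otimes> c' = \<one> \<and> monic x D d g \<and> (\<exists>b\<in>Rx. a = c \<otimes> g \<oplus> t \<otimes> b)"
  using assms lead unfolding polyring_def by blast

text \<open>
  The degree of a polynomial modulo \<open>T\<close> is well defined.
\<close>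
lemma monic_diff_T:
  assumes g: "monic x D n g" and h: "monic x D k h" and c: "c \<in> D" and d: "g \<ominus> c \<otimes> h \<in> T"
  shows "n \<le> k"
proof (rule ccontr)
  assume "\<not> n \<le> k"
  hence kn: "Suc k \<le> n" by simp
  obtain l where l: "l \<in> P n" "g = x [^] n \<oplus> l" using g unfolding monic_def by blast
  have hP: "c \<otimes> h \<in> P n" using polys_smult[OF sub DD x c polys_mono[OF sub DD x kn monicD(1)[OF sub x h]]] .
  have "g \<ominus> c \<otimes> h = x [^] n \<oplus> (l \<ominus> c \<otimes> h)" unfolding l(2) using Pc[OF l(1)] Pc[OF hP] x nat_pow_closed[OF x, of n] by algebra
  hence "monic x D n (g \<ominus> c \<otimes> h)" unfolding monic_def using polys_minus[OF sub DD x l(1) hP] by blast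
  thus False using monic_not_T d by blast
qed

text \<open>
  Modulo \<open>T\<close> both factors are units times monic polynomials, and so is their product.
\<close>
lemma T_prime:
  assumes a: "a \<in> Rx" "a \<notin> T" and b: "b \<in> Rx" "b \<notin> T" shows "a \<otimes> b \<notin> T"
proof
  assume ab: "a \<otimes> b \<in> T"
  obtain d c c' g u where 1: "c \<in> D" "c' \<in> D" "c \<otimes> c' = \<one>" "monic x D d g" "u \<in> Rx" "a = c \<otimes> g \<oplus> t \<otimes> u"
    using leadR[OF a] by blast
  obtain e k k' h v where 2: "k \<in> D" "k' \<in> D" "k \<otimes> k' = \<one>" "monic x D e h" "v \<in> Rx" "b = k \<otimes> h \<oplus> t \<otimes> v"
    using leadR[OF b] by blast
  have g: "g \<in> Rx" "h \<in> Rx" using monicD(2)[OF sub x] 1(4) 2(4) by auto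
  have cr: "c \<in> carrier R" "c' \<in> carrier R" "k \<in> carrier R" "k' \<in> carrier R" "u \<in> carrier R" "v \<in> carrier R" "g \<in> carrier R" "h \<in> carrier R"
    using 1 2 Dcl(1) Rcl(1) g by auto
  define w where "w = u \<otimes> b \<oplus> (c \<otimes> g) \<otimes> v"
  have w: "w \<in> Rx" unfolding w_def using Rcl(5,7) 1 b g 2 RD by simp
  have "a \<otimes> b = (c \<otimes> k) \<otimes> (g \<otimes> h) \<oplus> t \<otimes> w" unfolding w_def 1(6) 2(6) using cr st_carrier by algebra
  hence "(c \<otimes> k) \<otimes> (g \<otimes> h) = a \<otimes> b \<ominus> t \<otimes> w" using cr st_carrier Rcl(1)[OF w] by algebra
  hence "(c \<otimes> k) \<otimes> (g \<otimes> h) \<in> T" using subideal_minus[OF Rsub T_ideal ab] w unfolding T_iff by metis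
  hence "(c' \<otimes> k') \<otimes> ((c \<otimes> k) \<otimes> (g \<otimes> h)) \<in> T" using subidealD(4)[OF T_ideal] Rcl(7) RD 1(2) 2(2) by blast
  moreover have "(c' \<otimes> k') \<otimes> ((c \<otimes> k) \<otimes> (g \<otimes> h)) = (c \<otimes> c') \<otimes> (k \<otimes> k') \<otimes> (g \<otimes> h)" using cr by algebra
  ultimately have "g \<otimes> h \<in> T" using 1(3) 2(3) cr by simp
  thus False using monic_not_T[OF monic_mult[OF sub x 1(4) 2(4)]] by blast
qed

end

section \<open>A closed point of the exceptional curve\<close>

text \<open>
  A prime ideal \<open>Q\<close> of \<open>D[x]\<close> that strictly contains \<open>T\<close>, that is, a closed point of the
  exceptional curve. The monic element \<open>p\<close> of least degree in \<open>Q\<close> plays the role of its irreducible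
  polynomial over the residue field.
\<close>
locale chart_point = chart +
  fixes Q p and r :: nat
  assumes Q_ideal: "subideal Rx Q" and Q_one: "\<one> \<notin> Q" and T_Q: "T \<subseteq> Q"
    and Q_prime: "a \<in> Rx \<Longrightarrow> b \<in> Rx \<Longrightarrow> a \<otimes> b \<in> Q \<Longrightarrow> a \<in> Q \<or> b \<in> Q"
    and p_monic: "monic x D r p" and p_Q: "p \<in> Q"
    and p_min: "monic x D n g \<Longrightarrow> g \<in> Q \<Longrightarrow> r \<le> n"
begin

lemma p_R: "p \<in> Rx" and p_carrier: "p \<in> carrier R"
  using monicD(2,3)[OF sub x p_monic] by auto

lemma r_pos: "0 < r"
proof (rule ccontr)
  assume "\<not> 0 < r"
  then obtain l where "l \<in> P 0" "p = x [^] (0::nat) \<oplus> l" using p_monic unfolding monic_def by auto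
  thus False using p_Q Q_one by simp
qed

lemma Q_R: "a \<in> Q \<Longrightarrow> a \<in> Rx"
  using subidealD(1)[OF Q_ideal] .

lemma t_Q: "b \<in> Rx \<Longrightarrow> t \<otimes> b \<in> Q"
  using T_Q T_iff by blast

text \<open>
  Principality of the ideals of the polynomial ring \<open>D[x] / T\<close>: a remainder that is nonzero modulo \<open>T\<close> would
  give a monic element of smaller degree.
\<close>
lemma ideal_divide_by_minimal_monic:
  assumes J: "subideal Rx J" and TJ: "T \<subseteq> J" and g: "monic x D n g" "g \<in> J"
    and min: "\<And>k h. monic x D k h \<Longrightarrow> h \<in> J \<Longrightarrow> n \<le> k" and a: "a \<in> J"
  shows "\<exists>q\<in>Rx. \<exists>b\<in>Rx. a = q \<otimes> g \<oplus> t \<otimes> b"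
proof -
  have gc: "g \<in> carrier R" using monicD(3)[OF sub x g(1)] .
  have aR: "a \<in> Rx" using subidealD(1)[OF J a] .
  obtain q where q: "q \<in> Rx" "a \<ominus> q \<otimes> g \<in> P n" using monic_division[OF sub x g(1) aR] by blast
  have qg: "q \<otimes> g \<in> J" using subidealD(4)[OF J q(1) g(2)] .
  have aJ: "a \<ominus> q \<otimes> g \<in> J" using subideal_minus[OF Rsub J a qg] .
  have "a \<ominus> q \<otimes> g \<in> T"
  proof (rule ccontr)
    assume "a \<ominus> q \<otimes> g \<notin> T"
    then obtain d c c' h b where h: "d < n" "c \<in> D" "c' \<in> D" "c \<otimes> c' = \<one>" "monic x D d h" "b \<in> Rx"
      "a \<ominus> q \<otimes> g = c \<otimes> h \<oplus> t \<otimes> b" using lead[OF q(2)] by blast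
    have hc: "h \<in> carrier R" "c \<in> carrier R" "c' \<in> carrier R" "b \<in> carrier R"
      using monicD(3)[OF sub x h(5)] Dcl(1) h(2,3) Rcl(1)[OF h(6)] by auto
    have "(a \<ominus> q \<otimes> g) \<ominus> t \<otimes> b \<in> J" using subideal_minus[OF Rsub J aJ] TJ T_iff h(6) by blast
    moreover have "(a \<ominus> q \<otimes> g) \<ominus> t \<otimes> b = c \<otimes> h" unfolding h(7) using hc st_carrier by algebra
    ultimately have "c' \<otimes> (c \<otimes> h) \<in> J" using subidealD(4)[OF J RD[OF h(3)]] by simp
    moreover have "c' \<otimes> (c \<otimes> h) = (c \<otimes> c') \<otimes> h" using hc by algebra
    ultimately have "h \<in> J" using h(4) hc by simp
    thus False using min[OF h(5)] h(1) by simp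
  qed
  then obtain b where b: "b \<in> Rx" "a \<ominus> q \<otimes> g = t \<otimes> b" unfolding T_iff by blast
  have "a = q \<otimes> g \<oplus> (a \<ominus> q \<otimes> g)" using Rcl(1)[OF aR] Rcl(1)[OF q(1)] gc by algebra
  thus ?thesis unfolding b(2) using q(1) b(1) by blast
qed

lemma Q_gen: "a \<in> Q \<Longrightarrow> \<exists>q\<in>Rx. \<exists>b\<in>Rx. a = q \<otimes> p \<oplus> t \<otimes> b"
  by (rule ideal_divide_by_minimal_monic[OF Q_ideal T_Q p_monic p_Q p_min])

text \<open>
  The ideal \<open>Q\<close> is maximal. If \<open>g\<close> generates \<open>Q + b D[x]\<close> modulo \<open>T\<close>, then \<open>p = q g\<close> modulo \<open>T\<close> and
  \<open>g \<notin> Q\<close>, so \<open>q\<close> is itself a multiple of \<open>p\<close>, and cancelling \<open>p\<close> shows that \<open>g\<close> is a unit modulo \<open>T\<close>.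
\<close>
lemma bezout_one:
  assumes b: "b \<in> Rx" "b \<notin> Q"
  shows "\<exists>u\<in>Rx. \<exists>v\<in>Rx. \<exists>w\<in>Rx. \<one> = b \<otimes> u \<oplus> p \<otimes> v \<oplus> t \<otimes> w"
proof -
  define J where "J = {i \<oplus> b \<otimes> c | i c. i \<in> Q \<and> c \<in> Rx}"
  have bc: "b \<in> carrier R" using Rcl(1)[OF b(1)] .
  have J: "subideal Rx J" unfolding J_def by (rule subideal_extend[OF Rsub Q_ideal b(1)])
  have QJ: "i \<in> J" if "i \<in> Q" for i
  proof -
    have "i = i \<oplus> b \<otimes> \<zero>" using that Q_R Rcl(1) bc by simp
    thus ?thesis unfolding J_def using that Rcl(2) by blast
  qed
  have "\<zero> \<oplus> b \<otimes> \<one> \<in> J" unfolding J_def using subidealD(2)[OF Q_ideal] Rcl(3) by blast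
  hence bJ: "b \<in> J" using bc by simp
  define n where "n = (LEAST n. \<exists>g. monic x D n g \<and> g \<in> J)"
  have "\<exists>n g. monic x D n g \<and> g \<in> J" using p_monic QJ[OF p_Q] by blast
  hence "\<exists>g. monic x D n g \<and> g \<in> J" unfolding n_def by (rule LeastI_ex)
  then obtain g where g: "monic x D n g" "g \<in> J" by blast
  have min: "n \<le> k" if "monic x D k h" "h \<in> J" for k h
    unfolding n_def using that by (intro Least_le) blast
  have gc: "g \<in> carrier R" "g \<in> Rx" using monicD(2,3)[OF sub x g(1)] by auto
  have TJ: "T \<subseteq> J" using T_Q QJ by blast
  have gen: "\<exists>q\<in>Rx. \<exists>b\<in>Rx. a = q \<otimes> g \<oplus> t \<otimes> b" if "a \<in> J" for a
    using ideal_divide_by_minimal_monic[OF J TJ g _ that] min by blast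
  have gQ: "g \<notin> Q"
  proof
    assume "g \<in> Q"
    obtain q c where "q \<in> Rx" "c \<in> Rx" "b = q \<otimes> g \<oplus> t \<otimes> c" using gen[OF bJ] by blast
    hence "b \<in> Q" using subidealD(3,4)[OF Q_ideal] \<open>g \<in> Q\<close> t_Q by auto
    thus False using b(2) by blast
  qed
  obtain q c where q: "q \<in> Rx" "c \<in> Rx" "p = q \<otimes> g \<oplus> t \<otimes> c" using gen[OF QJ[OF p_Q]] by blast
  have qc: "q \<in> carrier R" "c \<in> carrier R" using q Rcl(1) by auto
  have "q \<otimes> g = p \<ominus> t \<otimes> c" unfolding q(3) using qc gc st_carrier by algebra
  hence "q \<otimes> g \<in> Q" using subideal_minus[OF Rsub Q_ideal p_Q t_Q[OF q(2)]] by simp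
  hence "q \<in> Q" using Q_prime[OF q(1) gc(2)] gQ by blast
  then obtain q' e where q': "q' \<in> Rx" "e \<in> Rx" "q = q' \<otimes> p \<oplus> t \<otimes> e" using Q_gen by blast
  have q'c: "q' \<in> carrier R" "e \<in> carrier R" using q' Rcl(1) by auto
  have "p \<otimes> (\<one> \<ominus> q' \<otimes> g) = p \<ominus> (q \<ominus> t \<otimes> e) \<otimes> g"
    unfolding q'(3) using q'c gc p_carrier st_carrier by algebra
  also have "\<dots> = (q \<otimes> g \<oplus> t \<otimes> c) \<ominus> (q \<ominus> t \<otimes> e) \<otimes> g" using q(3) by simp
  also have "\<dots> = t \<otimes> (c \<oplus> e \<otimes> g)" using q'c qc gc st_carrier by algebra
  finally have "p \<otimes> (\<one> \<ominus> q' \<otimes> g) \<in> T" unfolding T_iff using Rcl(5,7) q(2) q'(2) gc(2) by blast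
  moreover have "\<one> \<ominus> q' \<otimes> g \<in> Rx" using Rcl(3,6,7) q'(1) gc(2) by blast
  ultimately have "\<one> \<ominus> q' \<otimes> g \<in> T" using T_prime[OF p_R monic_not_T[OF p_monic]] by blast
  hence "(\<one> \<ominus> q' \<otimes> g) \<oplus> q' \<otimes> g \<in> J" using subidealD(3)[OF J] TJ subidealD(4)[OF J q'(1) g(2)] by blast
  moreover have "(\<one> \<ominus> q' \<otimes> g) \<oplus> q' \<otimes> g = \<one>" using q'c gc by algebra
  ultimately have "\<one> \<in> J" by simp
  then obtain i u where iu: "i \<in> Q" "u \<in> Rx" "\<one> = i \<oplus> b \<otimes> u" unfolding J_def by blast
  obtain v w where vw: "v \<in> Rx" "w \<in> Rx" "i = v \<otimes> p \<oplus> t \<otimes> w" using Q_gen[OF iu(1)] by blast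
  have "i \<oplus> b \<otimes> u = b \<otimes> u \<oplus> p \<otimes> v \<oplus> t \<otimes> w" unfolding vw(3)
    using Rcl(1)[OF iu(2)] Rcl(1)[OF vw(1)] Rcl(1)[OF vw(2)] bc p_carrier st_carrier by algebra
  thus ?thesis using iu vw by metis
qed

lemma bezout:
  assumes b: "b \<in> Rx" "b \<notin> Q"
  shows "\<exists>u\<in>Rx. \<exists>v\<in>Rx. \<exists>w\<in>Rx. \<one> = b \<otimes> u \<oplus> p [^] (n::nat) \<otimes> v \<oplus> t \<otimes> w"
proof (induct n)
  case 0
  have "\<one> = b \<otimes> \<zero> \<oplus> p [^] (0::nat) \<otimes> \<one> \<oplus> t \<otimes> \<zero>" using Rcl(1)[OF b(1)] st_carrier by simp
  thus ?case using Rcl(2,3) by blast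
next
  case (Suc n)
  then obtain u v w where 1: "u \<in> Rx" "v \<in> Rx" "w \<in> Rx" "\<one> = b \<otimes> u \<oplus> p [^] n \<otimes> v \<oplus> t \<otimes> w" by blast
  obtain u' v' w' where 2: "u' \<in> Rx" "v' \<in> Rx" "w' \<in> Rx" "\<one> = b \<otimes> u' \<oplus> p \<otimes> v' \<oplus> t \<otimes> w'" using bezout_one[OF b] by blast
  have pn: "p [^] n \<in> Rx" using subring_pow[OF Rsub p_R] .
  have c: "u \<in> carrier R" "v \<in> carrier R" "w \<in> carrier R" "u' \<in> carrier R" "v' \<in> carrier R" "w' \<in> carrier R"
    "b \<in> carrier R" "p [^] n \<in> carrier R" using 1 2 b Rcl(1) pn by auto
  have "b \<otimes> u \<oplus> p [^] n \<otimes> v \<otimes> \<one> \<oplus> t \<otimes> w = \<one>" using c by (simp add: 1(4)[symmetric])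
  hence "\<one> = b \<otimes> u \<oplus> p [^] n \<otimes> v \<otimes> \<one> \<oplus> t \<otimes> w" by (rule sym)
  also have "p [^] n \<otimes> v \<otimes> \<one> = p [^] n \<otimes> v \<otimes> (b \<otimes> u' \<oplus> p \<otimes> v' \<oplus> t \<otimes> w')" using 2(4) by simp
  also have "b \<otimes> u \<oplus> p [^] n \<otimes> v \<otimes> (b \<otimes> u' \<oplus> p \<otimes> v' \<oplus> t \<otimes> w') \<oplus> t \<otimes> w =
    b \<otimes> (u \<oplus> p [^] n \<otimes> v \<otimes> u') \<oplus> p [^] Suc n \<otimes> (v \<otimes> v') \<oplus> t \<otimes> (w \<oplus> p [^] n \<otimes> v \<otimes> w')"
    unfolding nat_pow_Suc using c p_carrier st_carrier by algebra
  finally show ?case using 1(1-3) 2(1-3) pn Rcl(5,7) by metis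
qed

text \<open>
  Splitting off factors \<open>p\<close> lowers the degree modulo \<open>T\<close>, so this ends with a factor outside \<open>Q\<close>.
\<close>
lemma factor_mod:
  assumes "F \<in> Rx" "F \<notin> T"
  shows "\<exists>k. \<exists>g\<in>Rx. \<exists>b\<in>Rx. g \<notin> Q \<and> F = p [^] (k::nat) \<otimes> g \<oplus> t \<otimes> b"
proof -
  have "\<exists>k. \<exists>g\<in>Rx. \<exists>b\<in>Rx. g \<notin> Q \<and> F = p [^] (k::nat) \<otimes> g \<oplus> t \<otimes> b"
    if "F \<in> Rx" "F \<notin> T" "c \<in> D" "c' \<in> D" "c \<otimes> c' = \<one>" "monic x D n h" "b \<in> Rx" "F = c \<otimes> h \<oplus> t \<otimes> b"
    for n F c c' h b
    using that
  proof (induct n arbitrary: F c c' h b rule: less_induct)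
    case (less n)
    show ?case
    proof (cases "F \<in> Q")
      case False
      have "F = p [^] (0::nat) \<otimes> F \<oplus> t \<otimes> \<zero>" using Rcl(1)[OF less(2)] st_carrier by simp
      thus ?thesis using False less(2) Rcl(2) by blast
    next
      case True
      obtain q e where q: "q \<in> Rx" "e \<in> Rx" "F = q \<otimes> p \<oplus> t \<otimes> e" using Q_gen[OF True] by blast
      have qT: "q \<notin> T"
      proof
        assume "q \<in> T"
        hence "q \<otimes> p \<in> T" using subideal_r[OF Rsub T_ideal p_R] by blast
        hence "F \<in> T" unfolding q(3) using subidealD(3)[OF T_ideal] q(2) T_iff by blast
        thus False using less(3) by blast
      qed
      obtain d k k' h' b' where h': "k \<in> D" "k' \<in> D" "k \<otimes> k' = \<one>" "monic x D d h'" "b' \<in> Rx" "q = k \<otimes> h' \<oplus> t \<otimes> b'"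
        using leadR[OF q(1) qT] by blast
      have cr: "k \<in> carrier R" "k' \<in> carrier R" "c \<in> carrier R" "c' \<in> carrier R" "h \<in> carrier R" "h' \<in> carrier R"
        "b \<in> carrier R" "b' \<in> carrier R" "e \<in> carrier R" "q \<in> carrier R"
        using h' q less Dcl(1) Rcl(1) monicD(3)[OF sub x] by auto
      have hp: "monic x D (r + d) (p \<otimes> h')" using monic_mult[OF sub x p_monic h'(4)] .
      have eq: "c \<otimes> h \<oplus> t \<otimes> b = (k \<otimes> h' \<oplus> t \<otimes> b') \<otimes> p \<oplus> t \<otimes> e" using q(3) less(9) h'(6) by simp
      have "k \<otimes> (p \<otimes> h') \<ominus> c \<otimes> h = ((k \<otimes> h' \<oplus> t \<otimes> b') \<otimes> p \<oplus> t \<otimes> e) \<ominus> (c \<otimes> h \<oplus> t \<otimes> b) \<oplus> t \<otimes> (b \<ominus> b' \<otimes> p \<ominus> e)"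
        using cr p_carrier st_carrier by algebra
      also have "\<dots> = t \<otimes> (b \<ominus> b' \<otimes> p \<ominus> e)" unfolding eq using cr p_carrier st_carrier by algebra
      finally have "k' \<otimes> (k \<otimes> (p \<otimes> h') \<ominus> c \<otimes> h) \<in> T"
        using subidealD(4)[OF T_ideal RD[OF h'(2)]] T_iff Rcl(6,7) less(8) h'(5) p_R q(2) by metis
      moreover have "k' \<otimes> (k \<otimes> (p \<otimes> h') \<ominus> c \<otimes> h) = (k \<otimes> k') \<otimes> (p \<otimes> h') \<ominus> (k' \<otimes> c) \<otimes> h"
        using cr p_carrier by algebra
      ultimately have "p \<otimes> h' \<ominus> (k' \<otimes> c) \<otimes> h \<in> T" using h'(3) cr p_carrier by simp
      hence "r + d \<le> n" using monic_diff_T[OF hp less(7)] Dcl(7) h'(2) less(4) by blast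
      hence "d < n" using r_pos by simp
      then obtain j g b'' where g: "g \<in> Rx" "b'' \<in> Rx" "g \<notin> Q" "q = p [^] (j::nat) \<otimes> g \<oplus> t \<otimes> b''"
        using less(1)[OF _ q(1) qT h'(1-6)] by blast
      have pj: "p [^] j \<in> carrier R" using p_carrier by simp
      have "F = p [^] Suc j \<otimes> g \<oplus> t \<otimes> (b'' \<otimes> p \<oplus> e)" unfolding q(3) g(4) nat_pow_Suc
        using pj p_carrier st_carrier Rcl(1)[OF g(1)] Rcl(1)[OF g(2)] cr by algebra
      moreover have "b'' \<otimes> p \<oplus> e \<in> Rx" using Rcl(5,7) g(2) p_R q(2) by blast
      ultimately show ?thesis using g(1,3) by blast
    qed
  qed
  thus ?thesis using leadR[OF assms] assms by metis
qed

text \<open>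
  The congruence \<open>F = p ^ k * g\<close> modulo \<open>t\<close> lifts to \<open>F = F' * g'\<close> modulo \<open>t ^ (K + 1)\<close> because \<open>p ^ k\<close> and
  \<open>g\<close> are comaximal modulo \<open>t\<close>. The correction of \<open>F'\<close> is reduced modulo the monic polynomial \<open>p ^ k\<close>, and
  its coefficients lie in \<open>D\<close>, so \<open>F'\<close> stays monic of the same degree.
\<close>
lemma hensel:
  assumes F: "F \<in> Rx" and g: "g \<in> Rx" "g \<notin> Q" and b: "b \<in> Rx" and eq: "F = p [^] (k::nat) \<otimes> g \<oplus> t \<otimes> b"
  shows "\<exists>F'. \<exists>g'\<in>Rx. \<exists>h\<in>Rx. \<exists>e\<in>Rx. monic x D (k * r) F' \<and> F' = p [^] k \<oplus> t \<otimes> e \<and> g' \<notin> Q \<and>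
    F = F' \<otimes> g' \<oplus> t [^] Suc K \<otimes> h"
proof -
  obtain u v w where uvw: "u \<in> Rx" "v \<in> Rx" "w \<in> Rx" "\<one> = g \<otimes> u \<oplus> p [^] k \<otimes> v \<oplus> t \<otimes> w" using bezout[OF g] by blast
  have pk: "p [^] k \<in> Rx" using subring_pow[OF Rsub p_R] .
  have pkm: "monic x D (k * r) (p [^] k)" using monic_pow[OF sub x p_monic] .
  have c0: "u \<in> carrier R" "v \<in> carrier R" "w \<in> carrier R" "g \<in> carrier R" "b \<in> carrier R" "p [^] k \<in> carrier R"
    using uvw(1-3) g b pk Rcl(1) by auto
  have "\<exists>F' g' h e d. g' \<in> Rx \<and> h \<in> Rx \<and> e \<in> Rx \<and> d \<in> Rx \<and> monic x D (k * r) F' \<and> F' = p [^] k \<oplus> t \<otimes> e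
    \<and> g' = g \<oplus> t \<otimes> d \<and> F = F' \<otimes> g' \<oplus> t [^] Suc K \<otimes> h"
  proof (induct K)
    case 0
    have "F = p [^] k \<otimes> g \<oplus> t [^] Suc 0 \<otimes> b" using eq st_carrier by simp
    moreover have "g = g \<oplus> t \<otimes> \<zero>" "p [^] k = p [^] k \<oplus> t \<otimes> \<zero>" using c0 st_carrier by auto
    ultimately show ?case using pkm g(1) b Rcl(2) by blast
  next
    case (Suc K)
    then obtain F' g' h e d where 1: "g' \<in> Rx" "h \<in> Rx" "e \<in> Rx" "d \<in> Rx" "monic x D (k * r) F'"
      "F' = p [^] k \<oplus> t \<otimes> e" "g' = g \<oplus> t \<otimes> d" "F = F' \<otimes> g' \<oplus> t [^] Suc K \<otimes> h" by blast
    obtain q where q: "q \<in> Rx" "h \<otimes> u \<ominus> q \<otimes> p [^] k \<in> P (k * r)"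
      using monic_division[OF sub x pkm] Rcl(7) 1(2) uvw(1) by blast
    define \<delta> where "\<delta> = h \<otimes> u \<ominus> q \<otimes> p [^] k"
    define \<epsilon> where "\<epsilon> = g \<otimes> q \<oplus> h \<otimes> v"
    define h' where "h' = h \<otimes> w \<ominus> e \<otimes> \<epsilon> \<ominus> d \<otimes> \<delta> \<ominus> t [^] K \<otimes> \<delta> \<otimes> \<epsilon>"
    have dR: "\<delta> \<in> Rx" "\<epsilon> \<in> Rx" unfolding \<delta>_def \<epsilon>_def using Rcl(5,6,7) 1 uvw q g pk by auto
    have h'R: "h' \<in> Rx" unfolding h'_def using Rcl(5,6,7) 1 uvw q g pk dR tpow_R by simp
    have c1: "g' \<in> carrier R" "h \<in> carrier R" "e \<in> carrier R" "d \<in> carrier R" "q \<in> carrier R" "\<delta> \<in> carrier R" "\<epsilon> \<in> carrier R" "F' \<in> carrier R"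
      using 1(1-4) q(1) dR Rcl(1) monicD(3)[OF sub x 1(5)] by auto
    have tK: "t [^] K \<in> carrier R" using st_carrier by simp
    have key: "h = g \<otimes> \<delta> \<oplus> p [^] k \<otimes> \<epsilon> \<oplus> t \<otimes> (h \<otimes> w)"
    proof -
      have "h = h \<otimes> (g \<otimes> u \<oplus> p [^] k \<otimes> v \<oplus> t \<otimes> w)" using c1 by (simp add: uvw(4)[symmetric])
      also have "\<dots> = g \<otimes> \<delta> \<oplus> p [^] k \<otimes> \<epsilon> \<oplus> t \<otimes> (h \<otimes> w)" unfolding \<delta>_def \<epsilon>_def using c0 c1(1-5) st_carrier by algebra
      finally show ?thesis .
    qed
    have lin: "F' \<otimes> \<epsilon> \<oplus> g' \<otimes> \<delta> = g \<otimes> \<delta> \<oplus> p [^] k \<otimes> \<epsilon> \<oplus> t \<otimes> (e \<otimes> \<epsilon> \<oplus> d \<otimes> \<delta>)"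
      unfolding 1(6,7) using c0 c1(1-7) st_carrier by algebra
    have "(F' \<oplus> t [^] Suc K \<otimes> \<delta>) \<otimes> (g' \<oplus> t [^] Suc K \<otimes> \<epsilon>) \<oplus> t [^] Suc (Suc K) \<otimes> h'
      = F' \<otimes> g' \<oplus> t [^] Suc K \<otimes> ((F' \<otimes> \<epsilon> \<oplus> g' \<otimes> \<delta>) \<oplus> t \<otimes> (h' \<oplus> t [^] K \<otimes> \<delta> \<otimes> \<epsilon>))"
      unfolding nat_pow_Suc using c1 tK Rcl(1)[OF h'R] st_carrier by algebra
    also have "h' \<oplus> t [^] K \<otimes> \<delta> \<otimes> \<epsilon> = h \<otimes> w \<ominus> e \<otimes> \<epsilon> \<ominus> d \<otimes> \<delta>" unfolding h'_def using c0 c1 tK by algebra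
    also have "(F' \<otimes> \<epsilon> \<oplus> g' \<otimes> \<delta>) \<oplus> t \<otimes> (h \<otimes> w \<ominus> e \<otimes> \<epsilon> \<ominus> d \<otimes> \<delta>) = g \<otimes> \<delta> \<oplus> p [^] k \<otimes> \<epsilon> \<oplus> t \<otimes> (h \<otimes> w)"
      unfolding lin using c0 c1 st_carrier by algebra
    also have "\<dots> = h" using key by simp
    finally have F2: "F = (F' \<oplus> t [^] Suc K \<otimes> \<delta>) \<otimes> (g' \<oplus> t [^] Suc K \<otimes> \<epsilon>) \<oplus> t [^] Suc (Suc K) \<otimes> h'" using 1(8) by simp
    have F1: "F' \<oplus> t [^] Suc K \<otimes> \<delta> = p [^] k \<oplus> t \<otimes> (e \<oplus> t [^] K \<otimes> \<delta>)" unfolding 1(6) nat_pow_Suc using c0 c1(1-7) tK st_carrier by algebra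
    have g1: "g' \<oplus> t [^] Suc K \<otimes> \<epsilon> = g \<oplus> t \<otimes> (d \<oplus> t [^] K \<otimes> \<epsilon>)" unfolding 1(7) nat_pow_Suc using c0 c1(2-7) tK st_carrier by algebra
    obtain l where l: "l \<in> P (k * r)" "F' = x [^] (k * r) \<oplus> l" using 1(5) unfolding monic_def by blast
    have tdP: "t [^] Suc K \<otimes> \<delta> \<in> P (k * r)" using polys_smult[OF sub DD x tpow_R(2) q(2)] unfolding \<delta>_def .
    have "F' \<oplus> t [^] Suc K \<otimes> \<delta> = x [^] (k * r) \<oplus> (l \<oplus> t [^] Suc K \<otimes> \<delta>)" unfolding l(2)
      using Pc[OF l(1)] Pc[OF tdP] nat_pow_closed[OF x] by (simp add: a_assoc del: nat_pow_Suc)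
    hence mon: "monic x D (k * r) (F' \<oplus> t [^] Suc K \<otimes> \<delta>)" unfolding monic_def using polys_add[OF sub DD x l(1) tdP] by blast
    have "e \<oplus> t [^] K \<otimes> \<delta> \<in> Rx" "d \<oplus> t [^] K \<otimes> \<epsilon> \<in> Rx" "g' \<oplus> t [^] Suc K \<otimes> \<epsilon> \<in> Rx"
      using Rcl(5)[OF 1(3) Rcl(7)[OF tpow_R(1) dR(1)]] Rcl(5)[OF 1(4) Rcl(7)[OF tpow_R(1) dR(2)]]
        Rcl(5)[OF 1(1) Rcl(7)[OF tpow_R(1) dR(2)]] by blast+
    thus ?case using mon F1 g1 F2 h'R by blast
  qed
  then obtain F' g' h e d where 1: "g' \<in> Rx" "h \<in> Rx" "e \<in> Rx" "d \<in> Rx" "monic x D (k * r) F'"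
      "F' = p [^] k \<oplus> t \<otimes> e" "g' = g \<oplus> t \<otimes> d" "F = F' \<otimes> g' \<oplus> t [^] Suc K \<otimes> h" by blast
  have "g' \<notin> Q"
  proof
    assume "g' \<in> Q"
    moreover have "g = g' \<ominus> t \<otimes> d" unfolding 1(7) using c0 Rcl(1)[OF 1(4)] st_carrier by algebra
    ultimately have "g \<in> Q" using subideal_minus[OF Rsub Q_ideal _ t_Q[OF 1(4)]] by simp
    thus False using g(2) by blast
  qed
  thus ?thesis using 1 by blast
qed

end

section \<open>The transform of an ideal and the local ring at a closed point\<close>

declare (in ring) polys.simps(2) [simp del]

context chart
begin

text \<open>
  The total transform of the ideal \<open>(F, G)\<close> is \<open>t ^ r\<close> times its transform \<open>(F1, G1)\<close>, where \<open>r\<close> is the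
  order of the ideal. The largest possible \<open>r\<close> is taken; it is bounded by \<open>a\<close>, and if \<open>F1\<close> and \<open>G1\<close> were
  both in \<open>T\<close>, then \<open>M_degree\<close> and \<open>M_tP\<close> would allow a further factor \<open>t\<close> without violating the degree bounds.
\<close>
lemma decompose:
  assumes F: "F \<in> D" and G: "G \<in> D" and a: "t [^] (a::nat) \<in> gen2 D F G"
  obtains r F1 G1 k where "F1 \<in> P (Suc r)" "G1 \<in> P (Suc r)" "F = t [^] (r::nat) \<otimes> F1" "G = t [^] r \<otimes> G1"
    "F1 \<notin> T \<or> G1 \<notin> T" "t [^] (k::nat) \<in> gen2 Rx F1 G1" "\<one> \<notin> gen2 D F G \<Longrightarrow> 0 < r"
proof -
  let ?A = "\<lambda>r. \<exists>F1\<in>P (Suc r). \<exists>G1\<in>P (Suc r). F = t [^] (r::nat) \<otimes> F1 \<and> G = t [^] r \<otimes> G1"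
  have tp: "t [^] (n::nat) \<in> carrier R" "t [^] n \<noteq> \<zero>" for n
    using st_carrier t_nz by (auto simp: pow_nz)
  have key: "r \<le> a \<and> t [^] (a - r) \<in> gen2 Rx F1 G1"
    if F1: "F1 \<in> P (Suc r)" and G1: "G1 \<in> P (Suc r)" and e: "F = t [^] (r::nat) \<otimes> F1" "G = t [^] r \<otimes> G1" for r F1 G1
  proof -
    obtain u v where uv: "u \<in> D" "v \<in> D" "t [^] a = F \<otimes> u \<oplus> G \<otimes> v" using a unfolding gen2_def by blast
    have c: "F1 \<in> carrier R" "G1 \<in> carrier R" "u \<in> carrier R" "v \<in> carrier R" using Pc F1 G1 uv Dcl(1) by auto
    have R: "F1 \<in> Rx" "G1 \<in> Rx" using polys_polyring[OF sub x] F1 G1 by auto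
    define z where "z = F1 \<otimes> u \<oplus> G1 \<otimes> v"
    have zg: "z \<in> gen2 Rx F1 G1" unfolding z_def gen2_def using uv RD by blast
    have zR: "z \<in> Rx" unfolding z_def using Rcl(5,7) R uv RD by simp
    have e2: "t [^] a = t [^] r \<otimes> z" unfolding uv(3) e z_def using c tp(1)[of r] by algebra
    have ra: "r \<le> a"
    proof (rule ccontr)
      assume "\<not> r \<le> a"
      hence "a < r" by simp
      then obtain j where "r = Suc (a + j)" using less_imp_Suc_add by blast
      hence j: "r = a + Suc j" by simp
      have "t [^] a \<otimes> \<one> = t [^] a \<otimes> (t [^] Suc j \<otimes> z)" 
        using e2 tp Rcl(1)[OF zR] st_carrier unfolding j by (simp add: nat_pow_mult[symmetric] m_assoc del: nat_pow_Suc)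
      hence "\<one> = t [^] Suc j \<otimes> z"
        using m_lcancel[OF tp(2)[of a] tp(1)[of a] one_closed m_closed[OF tp(1)[of "Suc j"] Rcl(1)[OF zR]]] by blast
      also have "\<dots> = t \<otimes> (t [^] j \<otimes> z)" unfolding nat_pow_Suc using tp(1)[of j] Rcl(1)[OF zR] st_carrier by algebra
      finally have "\<one> \<in> T" unfolding T_iff using Rcl(7)[OF RD[OF subring_pow[OF sub tD]] zR] by blast
      thus False using one_not_T by blast
    qed
    have "t [^] a = t [^] r \<otimes> t [^] (a - r)" using ra st_carrier by (simp add: nat_pow_mult)
    hence "t [^] (a - r) = z" using e2 m_lcancel[OF tp(2,1)] tp(1) Rcl(1)[OF zR] by simp
    thus ?thesis using ra zg by simp
  qed
  define r where "r = (GREATEST r. ?A r)"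
  have FGc: "F \<in> carrier R" "G \<in> carrier R" using F G Dcl by auto
  have P1: "d \<in> P (Suc 0)" if "d \<in> D" for d
    using polys_monomial[OF sub DD x that, of 0 1] Dcl(1)[OF that] by (simp del: polys.simps)
  have A0: "?A 0" using P1[OF F] P1[OF G] FGc by (metis l_one nat_pow_0)
  have bnd: "\<And>r. ?A r \<Longrightarrow> r \<le> a" using key by blast
  have "?A r" unfolding r_def using GreatestI_nat[of ?A, OF A0 bnd] .
  then obtain F1 G1 where 1: "F1 \<in> P (Suc r)" "G1 \<in> P (Suc r)" "F = t [^] r \<otimes> F1" "G = t [^] r \<otimes> G1" by blast
  have max: "j \<le> r" if "?A j" for j unfolding r_def using Greatest_le_nat[of ?A, OF that bnd] .
  have lift: "\<exists>E'\<in>P (Suc (Suc r)). E = t \<otimes> E'" if "E \<in> P (Suc r)" "E \<in> T" for E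
    using M_degree[OF that(1)] T_M[OF that(2)] M_tP by blast
  have nT: "F1 \<notin> T \<or> G1 \<notin> T"
  proof (rule ccontr)
    assume "\<not> ?thesis"
    then obtain F2 G2 where 2: "F2 \<in> P (Suc (Suc r))" "F1 = t \<otimes> F2" "G2 \<in> P (Suc (Suc r))" "G1 = t \<otimes> G2"
      using lift 1(1,2) by blast
    have "F = t [^] Suc r \<otimes> F2" "G = t [^] Suc r \<otimes> G2" unfolding 1(3,4) 2(2,4) nat_pow_Suc
      using Pc[OF 2(1)] Pc[OF 2(3)] st_carrier tp(1)[of r] by algebra+
    hence "?A (Suc r)" using 2 by blast
    thus False using max by fastforce
  qed
  have pos: "0 < r" if "\<one> \<notin> gen2 D F G"
  proof -
    have "gen2 D F G \<subseteq> m" using proper_ideal_m[OF gen2_subideal[OF sub F G] that] .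
    hence Fm: "F \<in> m" "G \<in> m" using gen2_in[OF sub F G] by auto
    have "\<exists>E'\<in>P (Suc (Suc 0)). E = t [^] Suc 0 \<otimes> E'" if "E \<in> m" for E
    proof -
      have "E = \<zero> \<oplus> E \<otimes> x [^] (0::nat)" using subidealD(1)[OF m_ideal that] Dcl(1) by simp
      hence "E \<in> M (Suc 0)" using that unfolding polys.simps by blast
      thus ?thesis using M_tP[of E "Suc 0"] st_carrier by simp
    qed
    hence "?A (Suc 0)" using Fm by blast
    thus ?thesis using max by fastforce
  qed
  show thesis using that[OF 1 nT] key[OF 1] pos by blast
qed

lemma fraction:
  assumes F: "F \<in> D" "F \<noteq> \<zero>" and G: "G \<in> D" and len: "len_le D (gen2 D F G) n"
    and y: "y \<in> carrier R" "y \<otimes> F = G"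
  obtains k F1 G1 b where "F1 \<in> P (Suc k)" "G1 \<in> P (Suc k)" "F = t [^] (k::nat) \<otimes> F1" "G = t [^] k \<otimes> G1"
    "F1 \<notin> T \<or> G1 \<notin> T" "t [^] (b::nat) \<in> gen2 Rx F1 G1" "\<one> \<notin> gen2 D F G \<Longrightarrow> 0 < k" "F1 \<noteq> \<zero>" "y \<otimes> F1 = G1"
proof -
  obtain a where a: "t [^] (a::nat) \<in> gen2 D F G" using pow_in_ideal[OF gen2_subideal[OF sub F(1) G] len] by blast
  show thesis
  proof (rule decompose[OF F(1) G a])
    fix k F1 G1 and b :: nat
    assume 1: "F1 \<in> P (Suc k)" "G1 \<in> P (Suc k)" "F = t [^] k \<otimes> F1" "G = t [^] k \<otimes> G1"
      "F1 \<notin> T \<or> G1 \<notin> T" "t [^] b \<in> gen2 Rx F1 G1" "\<one> \<notin> gen2 D F G \<Longrightarrow> 0 < k"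
    have c: "F1 \<in> carrier R" "G1 \<in> carrier R" using Pc 1 by auto
    have F10: "F1 \<noteq> \<zero>" using F(2) 1(3) tpow_R(3) by auto
    have "t [^] k \<otimes> (y \<otimes> F1) = t [^] k \<otimes> G1"
      using y(2) unfolding 1(3,4)[symmetric] unfolding 1(3) using c y(1) tpow_R(3)[of k] by (metis m_lcomm)
    hence "y \<otimes> F1 = G1" using m_lcancel[of "t [^] k"] c y(1) tpow_R(3) t_nz st_carrier by (simp add: pow_nz)
    thus thesis using that[OF 1 F10] by blast
  qed
qed

end

context chart_point
begin

text \<open>
  The localization of \<open>D[x]\<close> at \<open>Q\<close>, as a subset of the field.
\<close>
definition "D1 = {y \<in> carrier R. \<exists>b\<in>Rx. b \<notin> Q \<and> b \<otimes> y \<in> Rx}"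

lemma D1I: "b \<in> Rx \<Longrightarrow> b \<notin> Q \<Longrightarrow> b \<otimes> y \<in> Rx \<Longrightarrow> y \<in> carrier R \<Longrightarrow> y \<in> D1"
  unfolding D1_def by blast

lemma nonQ_mult: "a \<in> Rx \<Longrightarrow> b \<in> Rx \<Longrightarrow> a \<notin> Q \<Longrightarrow> b \<notin> Q \<Longrightarrow> a \<otimes> b \<in> Rx \<and> a \<otimes> b \<notin> Q"
  using Q_prime Rcl(7) by blast

lemma common_denominator:
  assumes "y \<in> D1" "z \<in> D1"
  shows "\<exists>b\<in>Rx. b \<notin> Q \<and> b \<otimes> y \<in> Rx \<and> b \<otimes> z \<in> Rx"
proof -
  obtain a b where 1: "a \<in> Rx" "a \<notin> Q" "a \<otimes> y \<in> Rx" "b \<in> Rx" "b \<notin> Q" "b \<otimes> z \<in> Rx" using assms unfolding D1_def by blast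
  have c: "y \<in> carrier R" "z \<in> carrier R" "a \<in> carrier R" "b \<in> carrier R" using assms 1 Rcl(1) unfolding D1_def by auto
  have "(a \<otimes> b) \<otimes> y = b \<otimes> (a \<otimes> y)" "(a \<otimes> b) \<otimes> z = a \<otimes> (b \<otimes> z)" using c by algebra+
  thus ?thesis using nonQ_mult[OF 1(1,4,2,5)] Rcl(7) 1 by metis
qed

lemma D1_carrier: "y \<in> D1 \<Longrightarrow> y \<in> carrier R"
  unfolding D1_def by blast

lemma R_D1: "a \<in> Rx \<Longrightarrow> a \<in> D1"
  using D1I[OF Rcl(3) Q_one] Rcl(1) by simp

lemma D1_subring: "subring D1 R"
proof (rule subringI)
  show "D1 \<subseteq> carrier R" using D1_carrier by blast
  show "\<one> \<in> D1" using R_D1 Rcl(3) by blast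
  show "\<ominus> h \<in> D1" if h: "h \<in> D1" for h
  proof -
    obtain b where b: "b \<in> Rx" "b \<notin> Q" "b \<otimes> h \<in> Rx" using h unfolding D1_def by blast
    have "b \<otimes> (\<ominus> h) = \<ominus> (b \<otimes> h)" using Rcl(1)[OF b(1)] D1_carrier[OF h] by algebra
    thus ?thesis using D1I[OF b(1,2)] Rcl(4)[OF b(3)] D1_carrier[OF h] by simp
  qed
  show "y \<oplus> z \<in> D1" if y: "y \<in> D1" and z: "z \<in> D1" for y z
  proof -
    obtain b where b: "b \<in> Rx" "b \<notin> Q" "b \<otimes> y \<in> Rx" "b \<otimes> z \<in> Rx" using common_denominator[OF y z] by blast
    have "b \<otimes> (y \<oplus> z) = b \<otimes> y \<oplus> b \<otimes> z" using Rcl(1)[OF b(1)] D1_carrier y z by algebra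
    thus ?thesis using D1I[OF b(1,2)] Rcl(5)[OF b(3,4)] D1_carrier y z by simp
  qed
  show "y \<otimes> z \<in> D1" if y: "y \<in> D1" and z: "z \<in> D1" for y z
  proof -
    obtain b where b: "b \<in> Rx" "b \<notin> Q" "b \<otimes> y \<in> Rx" "b \<otimes> z \<in> Rx" using common_denominator[OF y z] by blast
    have "(b \<otimes> b) \<otimes> (y \<otimes> z) = (b \<otimes> y) \<otimes> (b \<otimes> z)" using Rcl(1)[OF b(1)] D1_carrier y z by algebra
    thus ?thesis using D1I[of "b \<otimes> b" "y \<otimes> z"] nonQ_mult[OF b(1,1,2,2)] Rcl(7)[OF b(3,4)]
        D1_carrier[OF y] D1_carrier[OF z] by simp
  qed
qed

lemmas D1cl = subring_closed[OF D1_subring]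

lemma nonQ_unit:
  assumes a: "a \<in> Rx" "a \<notin> Q" shows "\<exists>y\<in>D1. a \<otimes> y = \<one>"
proof -
  have "a \<noteq> \<zero>" using a subidealD(2)[OF Q_ideal] by blast
  hence i: "inv a \<in> carrier R" "a \<otimes> inv a = \<one>" using inv_facts[OF Rcl(1)[OF a(1)]] by auto
  hence "inv a \<in> D1" using D1I[OF a] Rcl(3) by simp
  thus ?thesis using i(2) by blast
qed

lemma D1_frac:
  assumes y: "y \<in> D1" shows "\<exists>a\<in>Rx. \<exists>b\<in>Rx. \<exists>b'\<in>D1. b \<notin> Q \<and> b \<otimes> b' = \<one> \<and> y = a \<otimes> b' \<and> b \<otimes> y = a"
proof -
  obtain b where b: "b \<in> Rx" "b \<notin> Q" "b \<otimes> y \<in> Rx" using y unfolding D1_def by blast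
  obtain b' where b': "b' \<in> D1" "b \<otimes> b' = \<one>" using nonQ_unit b by blast
  have "(b \<otimes> y) \<otimes> b' = (b \<otimes> b') \<otimes> y" using Rcl(1)[OF b(1)] D1_carrier y b'(1) by algebra
  hence "(b \<otimes> y) \<otimes> b' = y" using b'(2) D1_carrier[OF y] by simp
  thus ?thesis using b b' by metis
qed

lemma Q_contraction: "a \<in> Rx \<Longrightarrow> a \<in> gen2 D1 p t \<Longrightarrow> a \<in> Q"
proof -
  assume a: "a \<in> Rx" and "a \<in> gen2 D1 p t"
  then obtain y z where yz: "y \<in> D1" "z \<in> D1" "a = p \<otimes> y \<oplus> t \<otimes> z" unfolding gen2_def by blast
  obtain b where b: "b \<in> Rx" "b \<notin> Q" "b \<otimes> y \<in> Rx" "b \<otimes> z \<in> Rx" using common_denominator[OF yz(1,2)] by blast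
  have "b \<otimes> a = (b \<otimes> y) \<otimes> p \<oplus> t \<otimes> (b \<otimes> z)" unfolding yz(3)
    using Rcl(1)[OF b(1)] D1_carrier yz(1,2) p_carrier st_carrier by algebra
  hence "b \<otimes> a \<in> Q" using subidealD(3,4)[OF Q_ideal] b(3,4) p_Q t_Q by simp
  thus "a \<in> Q" using Q_prime[OF b(1) a] b(2) by blast
qed

lemma pt_D1: "p \<in> D1" "t \<in> D1" using R_D1 p_R RD tD by auto

lemma Q_gen2: "a \<in> Q \<Longrightarrow> a \<in> gen2 D1 p t"
proof -
  assume "a \<in> Q"
  then obtain q b where q: "q \<in> Rx" "b \<in> Rx" "a = q \<otimes> p \<oplus> t \<otimes> b" using Q_gen by blast
  have "a = p \<otimes> q \<oplus> t \<otimes> b" unfolding q(3) using m_comm[OF p_carrier Rcl(1)[OF q(1)]] by simp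
  thus "a \<in> gen2 D1 p t" unfolding gen2_def using q R_D1 by blast
qed

lemma D1_loc:
  assumes y: "y \<in> D1" "y \<notin> gen2 D1 p t" shows "\<exists>b\<in>D1. y \<otimes> b = \<one>"
proof -
  obtain a b b' where 1: "a \<in> Rx" "b \<in> Rx" "b' \<in> D1" "b \<notin> Q" "b \<otimes> b' = \<one>" "y = a \<otimes> b'" "b \<otimes> y = a"
    using D1_frac[OF y(1)] by blast
  have "a \<notin> Q"
  proof
    assume "a \<in> Q"
    hence "y \<in> gen2 D1 p t" unfolding 1(6)
      using subideal_r[OF D1_subring gen2_subideal[OF D1_subring pt_D1] 1(3) Q_gen2] by blast
    thus False using y(2) by blast
  qed
  then obtain a' where a': "a' \<in> D1" "a \<otimes> a' = \<one>" using nonQ_unit 1(1) by blast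
  have "y \<otimes> (b \<otimes> a') = (b \<otimes> y) \<otimes> a'" using D1_carrier y(1) a'(1) Rcl(1)[OF 1(2)] by algebra
  hence "y \<otimes> (b \<otimes> a') = \<one>" unfolding 1(7) a'(2) .
  thus ?thesis using D1cl(7)[OF R_D1[OF 1(2)] a'(1)] by blast
qed

lemma D1_regular:
  assumes c: "c \<in> D1" and d: "d \<in> D1" and e: "c \<otimes> p = t \<otimes> d" shows "\<exists>c'\<in>D1. c = t \<otimes> c'"
proof -
  obtain b where b: "b \<in> Rx" "b \<notin> Q" "b \<otimes> c \<in> Rx" "b \<otimes> d \<in> Rx" using common_denominator[OF c d] by blast
  have cc: "b \<in> carrier R" "c \<in> carrier R" "d \<in> carrier R" using Rcl(1)[OF b(1)] D1_carrier c d by auto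
  have "(b \<otimes> c) \<otimes> p = b \<otimes> (c \<otimes> p)" using cc p_carrier by (simp add: m_assoc)
  also have "\<dots> = t \<otimes> (b \<otimes> d)" unfolding e using cc st_carrier by algebra
  finally have "(b \<otimes> c) \<otimes> p \<in> T" unfolding T_iff using b(4) by blast
  hence "b \<otimes> c \<in> T" using T_prime[OF b(3) _ p_R monic_not_T[OF p_monic]] by blast
  then obtain f where f: "f \<in> Rx" "b \<otimes> c = t \<otimes> f" unfolding T_iff by blast
  obtain b' where b': "b' \<in> D1" "b \<otimes> b' = \<one>" using nonQ_unit b by blast
  have "c = (b \<otimes> b') \<otimes> c" using b'(2) cc by simp
  also have "\<dots> = b' \<otimes> (b \<otimes> c)" using cc D1_carrier[OF b'(1)] by algebra
  also have "\<dots> = t \<otimes> (b' \<otimes> f)" unfolding f(2) using D1_carrier[OF b'(1)] Rcl(1)[OF f(1)] st_carrier by algebra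
  finally show ?thesis using D1cl(7)[OF b'(1) R_D1[OF f(1)]] by blast
qed

text \<open>
  Modulo \<open>E\<close> and \<open>t\<close>, a power of \<open>p\<close> vanishes, so every denominator \<open>b \<notin> Q\<close> can be replaced by a
  polynomial; then long division by the monic part of \<open>E\<close> bounds the degree.
\<close>
lemma cover_step:
  assumes I: "subideal D1 I" and E: "E \<in> I" "E \<in> P (Suc k)" "E \<notin> T" and y: "y \<in> D1"
  shows "\<exists>a\<in>P (Suc k). \<exists>i\<in>I. \<exists>z\<in>D1. y = a \<oplus> i \<oplus> t \<otimes> z"
proof -
  have ER: "E \<in> Rx" using polys_polyring[OF sub x E(2)] .
  obtain a b b' where 1: "a \<in> Rx" "b \<in> Rx" "b' \<in> D1" "b \<notin> Q" "b \<otimes> b' = \<one>" "y = a \<otimes> b'" using D1_frac[OF y] by blast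
  obtain d c c' g e where 2: "d < Suc k" "c \<in> D" "c' \<in> D" "c \<otimes> c' = \<one>" "monic x D d g" "e \<in> Rx" "E = c \<otimes> g \<oplus> t \<otimes> e"
    using lead[OF E(2,3)] by blast
  obtain j h f where 3: "h \<in> Rx" "f \<in> Rx" "h \<notin> Q" "E = p [^] (j::nat) \<otimes> h \<oplus> t \<otimes> f" using factor_mod[OF ER E(3)] by blast
  obtain h' where h': "h' \<in> D1" "h \<otimes> h' = \<one>" using nonQ_unit 3(1,3) by blast
  obtain u v w where 4: "u \<in> Rx" "v \<in> Rx" "w \<in> Rx" "\<one> = b \<otimes> u \<oplus> p [^] j \<otimes> v \<oplus> t \<otimes> w" using bezout[OF 1(2,4)] by blast
  obtain q where q: "q \<in> Rx" "a \<otimes> u \<ominus> q \<otimes> g \<in> P d" using monic_division[OF sub x 2(5) Rcl(7)[OF 1(1) 4(1)]] by blast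
  define \<rho> where "\<rho> = a \<otimes> u \<ominus> q \<otimes> g"
  have rP: "\<rho> \<in> P (Suc k)" using polys_mono[OF sub DD x _ q(2), of "Suc k"] 2(1) unfolding \<rho>_def by simp
  have cr: "a \<in> carrier R" "b \<in> carrier R" "b' \<in> carrier R" "c \<in> carrier R" "c' \<in> carrier R" "g \<in> carrier R" "e \<in> carrier R"
    "h \<in> carrier R" "f \<in> carrier R" "h' \<in> carrier R" "u \<in> carrier R" "v \<in> carrier R" "w \<in> carrier R" "q \<in> carrier R" "E \<in> carrier R"
    "p [^] j \<in> carrier R" "t \<in> carrier R" "\<rho> \<in> carrier R"
    using 1 2 3 4 h' q Rcl(1) D1_carrier Dcl(1) monicD(3)[OF sub x 2(5)] ER p_carrier st_carrier Pc[OF rP] by auto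
  have g: "g = c' \<otimes> E \<ominus> t \<otimes> (c' \<otimes> e)"
  proof -
    have "c' \<otimes> E \<ominus> t \<otimes> (c' \<otimes> e) = (c \<otimes> c') \<otimes> g" unfolding 2(7) using cr by algebra
    thus ?thesis using 2(4) cr by simp
  qed
  have pj: "p [^] j = h' \<otimes> E \<ominus> t \<otimes> (h' \<otimes> f)"
  proof -
    have "h' \<otimes> E \<ominus> t \<otimes> (h' \<otimes> f) = (h \<otimes> h') \<otimes> p [^] j" unfolding 3(4) using cr by algebra
    thus ?thesis using h'(2) cr by simp
  qed
  have b': "b' = u \<oplus> p [^] j \<otimes> (v \<otimes> b') \<oplus> t \<otimes> (w \<otimes> b')"
  proof -
    have "b' = \<one> \<otimes> b'" using cr by simp
    also have "\<dots> = (b \<otimes> u \<oplus> p [^] j \<otimes> v \<oplus> t \<otimes> w) \<otimes> b'" using 4(4) by simp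
    also have "\<dots> = (b \<otimes> b') \<otimes> u \<oplus> p [^] j \<otimes> (v \<otimes> b') \<oplus> t \<otimes> (w \<otimes> b')" using cr by algebra
    finally show ?thesis using 1(5) cr by simp
  qed
  have au: "a \<otimes> u = \<rho> \<oplus> q \<otimes> g" unfolding \<rho>_def using cr by algebra
  define i where "i = E \<otimes> (q \<otimes> c' \<oplus> h' \<otimes> (a \<otimes> (v \<otimes> b')))"
  define z where "z = a \<otimes> (w \<otimes> b') \<ominus> q \<otimes> (c' \<otimes> e) \<ominus> (h' \<otimes> f) \<otimes> (a \<otimes> (v \<otimes> b'))"
  have RD1: "a \<in> D1" "q \<in> D1" "c' \<in> D1" "v \<in> D1" "w \<in> D1" "e \<in> D1" "f \<in> D1" using R_D1 1 2 3 4 q RD by auto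
  have i: "i \<in> I" unfolding i_def
    by (intro subideal_r[OF D1_subring I _ E(1)] D1cl(5,7) RD1 h'(1) 1(3))
  have z: "z \<in> D1" unfolding z_def by (intro D1cl(5,6,7) RD1 h'(1) 1(3))
  have "y = a \<otimes> (u \<oplus> p [^] j \<otimes> (v \<otimes> b') \<oplus> t \<otimes> (w \<otimes> b'))" using 1(6) b' by simp
  also have "\<dots> = a \<otimes> u \<oplus> p [^] j \<otimes> (a \<otimes> (v \<otimes> b')) \<oplus> t \<otimes> (a \<otimes> (w \<otimes> b'))" using cr by algebra
  also have "\<dots> = (\<rho> \<oplus> q \<otimes> (c' \<otimes> E \<ominus> t \<otimes> (c' \<otimes> e))) \<oplus> (h' \<otimes> E \<ominus> t \<otimes> (h' \<otimes> f)) \<otimes> (a \<otimes> (v \<otimes> b')) \<oplus> t \<otimes> (a \<otimes> (w \<otimes> b'))"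
    using au g pj by simp
  also have "\<dots> = \<rho> \<oplus> i \<oplus> t \<otimes> z" unfolding i_def z_def using cr by algebra
  finally show ?thesis using rP i z by blast
qed

lemma cover:
  assumes I: "subideal D1 I" and E: "E \<in> I" "E \<in> P (Suc k)" "E \<notin> T" and n: "t [^] (n::nat) \<in> I" and y: "y \<in> D1"
  shows "\<exists>a\<in>P (Suc k). \<exists>i\<in>I. y = a \<oplus> i"
proof -
  have "\<exists>a\<in>P (Suc k). \<exists>i\<in>I. \<exists>z\<in>D1. y = a \<oplus> i \<oplus> t [^] n \<otimes> z" for n :: nat
  proof (induct n)
    case 0
    have "y = \<zero> \<oplus> \<zero> \<oplus> t [^] (0::nat) \<otimes> y" using D1_carrier[OF y] by simp
    thus ?case using polys_zero[OF sub DD x] subidealD(2)[OF I] y by blast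
  next
    case (Suc n)
    then obtain a i z where 1: "a \<in> P (Suc k)" "i \<in> I" "z \<in> D1" "y = a \<oplus> i \<oplus> t [^] n \<otimes> z" by blast
    obtain a' i' z' where 2: "a' \<in> P (Suc k)" "i' \<in> I" "z' \<in> D1" "z = a' \<oplus> i' \<oplus> t \<otimes> z'"
      using cover_step[OF I E 1(3)] by blast
    have tn: "t [^] n \<in> D" "t [^] n \<in> D1" using tpow_R R_D1 by auto
    have cr: "a \<in> carrier R" "i \<in> carrier R" "a' \<in> carrier R" "i' \<in> carrier R" "z' \<in> carrier R"
      using Pc 1 2 subidealD(1)[OF I] D1_carrier by auto
    have "y = (a \<oplus> t [^] n \<otimes> a') \<oplus> (i \<oplus> t [^] n \<otimes> i') \<oplus> t [^] Suc n \<otimes> z'"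
      unfolding 1(4) 2(4) nat_pow_Suc using cr st_carrier tpow_R(3)[of n] by algebra
    moreover have "a \<oplus> t [^] n \<otimes> a' \<in> P (Suc k)" using polys_add[OF sub DD x 1(1) polys_smult[OF sub DD x tn(1) 2(1)]] .
    moreover have "i \<oplus> t [^] n \<otimes> i' \<in> I" using subidealD(3)[OF I 1(2) subidealD(4)[OF I tn(2) 2(2)]] .
    ultimately show ?case using 2(3) by blast
  qed
  then obtain a i z where 1: "a \<in> P (Suc k)" "i \<in> I" "z \<in> D1" "y = a \<oplus> i \<oplus> t [^] n \<otimes> z" by blast
  have "y = a \<oplus> (i \<oplus> t [^] n \<otimes> z)" unfolding 1(4)
    using Pc[OF 1(1)] subidealD(1)[OF I 1(2)] D1_carrier 1(3) tpow_R(3)[of n] by (simp add: a_assoc)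
  moreover have "i \<oplus> t [^] n \<otimes> z \<in> I" using subidealD(3)[OF I 1(2) subideal_r[OF D1_subring I 1(3) n]] .
  ultimately show ?thesis using 1(1) by blast
qed

text \<open>
  The residue classes of \<open>D1\<close> modulo the transform \<open>(F1, G1)\<close> are represented by polynomials of degree at most
  \<open>k\<close> (\<open>cover\<close>), and \<open>t ^ k\<close> times such a polynomial lies in \<open>D\<close>. Therefore contracting \<open>t ^ k Q'\<close> to \<open>D\<close> maps a
  strict chain of ideals \<open>Q'\<close> above \<open>(F1, G1)\<close> to a strict chain above \<open>(F, G)\<close>. For \<open>0 < k\<close> all
  contracted ideals are proper, and the chain can be prolonged by \<open>D\<close>.
\<close>
lemma length_transform:
  assumes F: "F \<in> D" and G: "G \<in> D" and len: "len_le D (gen2 D F G) n"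
    and F1: "F1 \<in> P (Suc k)" and G1: "G1 \<in> P (Suc k)" and eq: "F = t [^] k \<otimes> F1" "G = t [^] k \<otimes> G1"
    and nT: "F1 \<notin> T \<or> G1 \<notin> T" and tn: "t [^] (a::nat) \<in> gen2 Rx F1 G1" and pos: "\<one> \<notin> gen2 D F G \<Longrightarrow> 0 < k"
  shows "len_le D1 (gen2 D1 F1 G1) (n - (if \<one> \<in> gen2 D F G then 0 else 1))"
proof -
  let ?I = "gen2 D1 F1 G1"
  have FR: "F1 \<in> Rx" "G1 \<in> Rx" using polys_polyring[OF sub x] F1 G1 by auto
  have FD: "F1 \<in> D1" "G1 \<in> D1" using FR R_D1 by auto
  have I: "subideal D1 ?I" using gen2_subideal[OF D1_subring FD] .
  have FI: "F1 \<in> ?I" "G1 \<in> ?I" using gen2_in[OF D1_subring FD] by auto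
  have tI: "t [^] a \<in> ?I" using tn R_D1 unfolding gen2_def by blast
  have tk: "t [^] k \<in> carrier R" "t [^] k \<noteq> \<zero>" using st_carrier t_nz by (auto simp: pow_nz)
  have cov: "\<exists>b\<in>P (Suc k). \<exists>i\<in>?I. y = b \<oplus> i" if "y \<in> D1" for y
    using cover[OF I FI(1) F1 _ tI that] cover[OF I FI(2) G1 _ tI that] nT by blast
  show ?thesis unfolding len_le_def
  proof (intro allI impI, elim conjE)
    fix l Q' assume 1: "\<forall>i\<le>l. subideal D1 (Q' i) \<and> ?I \<subseteq> Q' i" and 2: "\<forall>i<l. Q' i \<subset> Q' (Suc i)"
    \<comment> \<open>the contraction of \<open>t ^ k Q' i\<close> to \<open>D\<close>\<close>
    define C where "C = (\<lambda>i. {d \<in> D. \<exists>y\<in>Q' i. d = t [^] k \<otimes> y})"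
    have Cideal: "subideal D (C i)" if i: "i \<le> l" for i
    proof -
      have J: "subideal D1 (Q' i)" using 1 i by blast
      have Jc: "y \<in> Q' i \<Longrightarrow> y \<in> carrier R" for y using subidealD(1)[OF J] D1_carrier by blast
      show ?thesis unfolding subideal_def
      proof (intro conjI ballI)
        show "C i \<subseteq> D" unfolding C_def by blast
        have "\<zero> = t [^] k \<otimes> \<zero>" using tk by simp
        thus "\<zero> \<in> C i" unfolding C_def using Dcl(2) subidealD(2)[OF J] by blast
      next
        fix a b assume "a \<in> C i" "b \<in> C i"
        then obtain y z where yz: "a \<in> D" "b \<in> D" "y \<in> Q' i" "z \<in> Q' i" "a = t [^] k \<otimes> y" "b = t [^] k \<otimes> z" unfolding C_def by blast
        have "a \<oplus> b = t [^] k \<otimes> (y \<oplus> z)" unfolding yz(5,6) using tk Jc yz(3,4) by (simp add: r_distr)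
        thus "a \<oplus> b \<in> C i" unfolding C_def using Dcl(5)[OF yz(1,2)] subidealD(3)[OF J yz(3,4)] by blast
      next
        fix c b assume c: "c \<in> D" and "b \<in> C i"
        then obtain z where z: "b \<in> D" "z \<in> Q' i" "b = t [^] k \<otimes> z" unfolding C_def by blast
        have "c \<otimes> b = t [^] k \<otimes> (c \<otimes> z)" unfolding z(3) using tk Jc z(2) Dcl(1)[OF c] by algebra
        thus "c \<otimes> b \<in> C i" unfolding C_def
          using Dcl(7)[OF c z(1)] subidealD(4)[OF J R_D1[OF RD[OF c]] z(2)] by blast
      qed
    qed
    have CI: "gen2 D F G \<subseteq> C i" if i: "i \<le> l" for i
    proof (rule gen2_least[OF Cideal[OF i] sub])
      show "F \<in> C i" "G \<in> C i" unfolding C_def using F G eq FI 1 i by blast+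
    qed
    have Cstrict: "C i \<subset> C (Suc i)" if i: "i < l" for i
    proof -
      have J: "subideal D1 (Q' i)" "subideal D1 (Q' (Suc i))" and IJ: "?I \<subseteq> Q' i" and s: "Q' i \<subset> Q' (Suc i)" using 1 2 i by auto
      obtain y where y: "y \<in> Q' (Suc i)" "y \<notin> Q' i" using s by blast
      obtain b j where b: "b \<in> P (Suc k)" "j \<in> ?I" "y = b \<oplus> j" using cov subidealD(1)[OF J(2) y(1)] by blast
      have cr: "b \<in> carrier R" "j \<in> carrier R" using Pc[OF b(1)] subidealD(1)[OF I b(2)] D1_carrier by auto
      have bi: "b \<notin> Q' i" using subidealD(3)[OF J(1)] b(2,3) IJ y(2) by blast
      have "b = y \<ominus> j" unfolding b(3) using cr by algebra
      hence bS: "b \<in> Q' (Suc i)" using subideal_minus[OF D1_subring J(2) y(1)] b(2) IJ s by blast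
      have "t [^] k \<otimes> b \<in> C (Suc i)" unfolding C_def using clear_denominators[OF b(1)] bS by blast
      moreover have "t [^] k \<otimes> b \<notin> C i"
      proof
        assume "t [^] k \<otimes> b \<in> C i"
        then obtain z where z: "z \<in> Q' i" "t [^] k \<otimes> b = t [^] k \<otimes> z" unfolding C_def by blast
        have "z \<in> carrier R" using subidealD(1)[OF J(1) z(1)] D1_carrier by blast
        hence "b = z" using m_lcancel[OF tk(2,1) cr(1)] z(2) by blast
        thus False using bi z(1) by blast
      qed
      moreover have "C i \<subseteq> C (Suc i)" unfolding C_def using s by blast
      ultimately show ?thesis by blast
    qed
    show "l \<le> n - (if \<one> \<in> gen2 D F G then 0 else 1)"
    proof (cases "\<one> \<in> gen2 D F G")
      case True
      thus ?thesis using len_leD[OF len, of l C] Cideal CI Cstrict by simp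
    next
      case False
      have "\<one> \<notin> C l"
      proof
        assume "\<one> \<in> C l"
        then obtain y where y: "y \<in> Q' l" "\<one> = t [^] k \<otimes> y" unfolding C_def by blast
        have yD: "y \<in> D1" using y(1) subidealD(1) 1 by blast
        obtain k' where k': "k = Suc k'" using pos[OF False] gr0_conv_Suc by auto
        have "\<one> = p \<otimes> \<zero> \<oplus> t \<otimes> (t [^] k' \<otimes> y)" unfolding y(2) k' nat_pow_Suc
          using tpow_R(3)[of k'] st_carrier D1_carrier[OF yD] p_carrier by algebra
        hence "\<one> \<in> gen2 D1 p t" unfolding gen2_def using D1cl(2) D1cl(7)[OF R_D1[OF tpow_R(1)] yD] by blast
        thus False using Q_contraction[OF Rcl(3)] Q_one by blast
      qed
      define C' where "C' = (\<lambda>i. if i \<le> l then C i else D)"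
      have "Suc l \<le> n"
      proof (rule len_leD[OF len, of "Suc l" C'])
        show "subideal D (C' i)" for i unfolding C'_def using Cideal DD by simp
        show "gen2 D F G \<subseteq> C' i" for i unfolding C'_def
          using CI gen2_subideal[OF sub F G] unfolding subideal_def by simp
        show "C' i \<subset> C' (Suc i)" if "i < Suc l" for i
        proof (cases "i = l")
          case True
          have "C l \<subseteq> D" unfolding C_def by blast
          thus ?thesis unfolding C'_def True using \<open>\<one> \<notin> C l\<close> Dcl(3) by auto
        next
          case False
          thus ?thesis unfolding C'_def using Cstrict that by simp
        qed
      qed
      thus ?thesis using False by simp
    qed
  qed
qed

lemma rep_transform:
  assumes F: "F \<in> D" "F \<noteq> \<zero>" and G: "G \<in> D" and len: "len_le D (gen2 D F G) n" and y: "y \<in> carrier R" "y \<otimes> F = G"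
  shows "\<exists>F1\<in>D1. \<exists>G1\<in>D1. F1 \<noteq> \<zero> \<and> y \<otimes> F1 = G1 \<and> len_le D1 (gen2 D1 F1 G1) (n - (if \<one> \<in> gen2 D F G then 0 else 1))"
proof (rule fraction[OF F G len y])
  fix k F1 G1 and b :: nat
  assume 1: "F1 \<in> P (Suc k)" "G1 \<in> P (Suc k)" "F = t [^] k \<otimes> F1" "G = t [^] k \<otimes> G1"
    "F1 \<notin> T \<or> G1 \<notin> T" "t [^] b \<in> gen2 Rx F1 G1" "\<one> \<notin> gen2 D F G \<Longrightarrow> 0 < k"
    and 2: "F1 \<noteq> \<zero>" "y \<otimes> F1 = G1"
  have "F1 \<in> D1" "G1 \<in> D1" using 1 polys_polyring[OF sub x] R_D1 by auto
  thus ?thesis using length_transform[OF F(1) G len 1] 2 by blast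
qed

lemma D1_regular_pair: "regular_pair R D1 p t"
proof (intro regular_pair.intro local_pair.intro local_pair_axioms.intro regular_pair_axioms.intro field_axioms)
  show "subring D1 R" by (rule D1_subring)
  show "p \<in> D1" "t \<in> D1" using pt_D1 by auto
  show "p \<noteq> \<zero>" using monic_not_T[OF p_monic] subidealD(2)[OF T_ideal] by auto
  show "t \<noteq> \<zero>" by (rule t_nz)
  show "\<one> \<notin> gen2 D1 p t" using Q_contraction[OF Rcl(3)] Q_one by blast
  show "\<exists>b\<in>D1. a \<otimes> b = \<one>" if "a \<in> D1" "a \<notin> gen2 D1 p t" for a using D1_loc[OF that] .
  show "\<exists>c'\<in>D1. c = t \<otimes> c'" if "c \<in> D1" "d \<in> D1" "c \<otimes> p = t \<otimes> d" for c d using D1_regular[OF that] .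
  show "\<exists>F\<in>D1. \<exists>G\<in>D1. \<exists>n. F \<noteq> \<zero> \<and> y \<otimes> F = G \<and> len_le D1 (gen2 D1 F G) n" if y: "y \<in> carrier R" "y \<noteq> \<zero>" for y
  proof -
    obtain F G n where 1: "F \<in> D" "G \<in> D" "F \<noteq> \<zero>" "y \<otimes> F = G" "len_le D (gen2 D F G) n" using rep[OF y] by blast
    show ?thesis using rep_transform[OF 1(1,3,2,5) y(1) 1(4)] by blast
  qed
qed

end

section \<open>Carrying a pole through one blow-up\<close>

definition (in ring) dominates :: "'a set \<Rightarrow> 'a set \<Rightarrow> 'a set \<Rightarrow> bool" where
  "dominates V D I \<longleftrightarrow> valuation_ring R V \<and> D \<subseteq> V \<and> I \<subseteq> nonunits V"

context field
begin

lemma vdvd_frac: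
  assumes V: "subring V R" and "F \<in> carrier R" "F \<noteq> \<zero>" "y \<in> carrier R"
  shows "vdvd V F (y \<otimes> F) \<longleftrightarrow> y \<in> V"
proof
  assume "y \<in> V"
  thus "vdvd V F (y \<otimes> F)" using m_comm assms vdvdI by blast
next
  assume "vdvd V F (y \<otimes> F)"
  then obtain c where c: "c \<in> V" "y \<otimes> F = F \<otimes> c" unfolding vdvd_def by blast
  have cc: "c \<in> carrier R" using c(1) subring_closed(1)[OF V] by blast
  have "F \<otimes> y = F \<otimes> c" using c(2) m_comm assms by simp
  hence "y = c" using m_lcancel[OF assms(3,2,4) cc] by blast
  thus "y \<in> V" using c(1) by simp
qed

lemma unit_mult_vdvd:
  assumes V: "subring V R" and "u \<in> V" "u \<notin> nonunits V" "a \<in> carrier R" shows "vdvd V (a \<otimes> u) a"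
proof -
  obtain e where e: "e \<in> V" "u \<otimes> e = \<one>" using unitD assms by blast
  have c: "u \<in> carrier R" "e \<in> carrier R" using e assms(2) subring_closed(1)[OF V] by auto
  have "a \<otimes> u \<otimes> e = a \<otimes> (u \<otimes> e)" using c assms(4) by (simp add: m_assoc)
  hence "a = a \<otimes> u \<otimes> e" using e(2) assms(4) by simp
  thus ?thesis using e(1) vdvdI by blast
qed

lemma dominatesD:
  assumes "dominates V D I"
  shows "valuation_ring R V" "subring V R" "a \<in> D \<Longrightarrow> a \<in> V" "a \<in> I \<Longrightarrow> a \<in> nonunits V"
  using assms unfolding dominates_def valuation_ring_def by auto

lemma one_plus_unit:
  assumes "valuation_ring R V" "b \<in> nonunits V"
  shows "\<one> \<oplus> b \<in> V" "\<one> \<oplus> b \<notin> nonunits V" "\<one> \<ominus> b \<in> V" "\<one> \<ominus> b \<notin> nonunits V"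
proof -
  have sV: "subring V R" using assms valuation_ring_def by blast
  have b: "b \<in> carrier R" using nonunitsD(1)[OF assms(2)] subring_closed(1)[OF sV] by blast
  show "\<one> \<oplus> b \<in> V" "\<one> \<oplus> b \<notin> nonunits V"
    using unit_add_nonunit[OF assms(1) subring_closed(3)[OF sV] nonunits_one[OF sV] assms(2)] by auto
  have "\<zero> \<ominus> b \<in> nonunits V"
    using subideal_minus[OF sV nonunits_subideal[OF assms(1)] subidealD(2)[OF nonunits_subideal[OF assms(1)]] assms(2)] .
  moreover have "\<one> \<oplus> (\<zero> \<ominus> b) = \<one> \<ominus> b" using b by algebra
  ultimately show "\<one> \<ominus> b \<in> V" "\<one> \<ominus> b \<notin> nonunits V"
    using unit_add_nonunit[OF assms(1) subring_closed(3)[OF sV] nonunits_one[OF sV]] by metis+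
qed

end

context chart
begin

context
  fixes V assumes V: "dominates V D m"
begin

lemmas Vval = dominatesD(1)[OF V]
lemmas Vsub = dominatesD(2)[OF V]
lemmas Vcl = subring_closed[OF Vsub]

lemma t_nonunit: "t \<in> nonunits V" "s \<in> nonunits V" using dominatesD(4)[OF V] st_m by auto

lemma polyring_in_V:
  assumes "x \<in> V" "a \<in> Rx" shows "a \<in> V"
proof -
  have "a \<in> V" if "a \<in> P n" for n a
    using that
  proof (induct n arbitrary: a)
    case 0 thus ?case using Vcl(2) by simp
  next
    case (Suc n)
    obtain b c where "b \<in> P n" "c \<in> D" "a = b \<oplus> c \<otimes> x [^] n" using Suc(2) unfolding polys.simps by blast
    thus ?case using Suc(1) dominatesD(3)[OF V] Vcl(5,7) subring_pow[OF Vsub assms(1)] by simp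
  qed
  thus ?thesis using assms(2) unfolding polyring_def by blast
qed

lemma t_mult_nonunit: "a \<in> V \<Longrightarrow> t \<otimes> a \<in> nonunits V"
  using nonunits_mult(1)[OF Vsub t_nonunit(1)] .

text \<open>
  The point at infinity of the exceptional curve: if \<open>x \<notin> V\<close>, then \<open>1 / x\<close> is a nonunit of \<open>V\<close>, so the
  lower terms of a polynomial have larger values than the power of \<open>x\<close> that bounds its degree.
\<close>
lemma poles_at_infinity:
  assumes "x \<notin> V"
  shows "a \<in> P n \<Longrightarrow> \<exists>c\<in>nonunits V. a = x [^] n \<otimes> c"
    and "a \<in> P (Suc n) \<Longrightarrow> \<exists>c\<in>V. a = x [^] n \<otimes> c"
    and "monic x D n a \<Longrightarrow> \<exists>c\<in>V. c \<notin> nonunits V \<and> a = x [^] n \<otimes> c"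
proof -
  have x0: "x \<noteq> \<zero>" using assms Vcl(2) by blast
  define u where "u = inv x"
  have u: "u \<in> carrier R" "x \<otimes> u = \<one>" "u \<in> V" 
    using inv_facts[OF x x0] Vval assms x x0 unfolding u_def valuation_ring_def by auto
  have "\<not> vdvd V u \<one>"
  proof
    assume "vdvd V u \<one>"
    then obtain c where c: "c \<in> V" "u \<otimes> c = \<one>" unfolding vdvd_one by blast
    have "x = x \<otimes> (u \<otimes> c)" using c(2) x by simp
    also have "\<dots> = (x \<otimes> u) \<otimes> c" using x u(1) Vcl(1)[OF c(1)] by (simp add: m_assoc)
    also have "\<dots> = c" using u(2) Vcl(1)[OF c(1)] by simp
    finally show False using c(1) assms by simp
  qed
  hence un: "u \<in> nonunits V" using u(3) unfolding nonunits_def by blast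
  have xn: "x [^] n \<in> carrier R" for n :: nat using x by simp
  have step: "\<exists>c\<in>V. a = x [^] n \<otimes> c" if a: "a \<in> P (Suc n)" and h: "\<And>b. b \<in> P n \<Longrightarrow> \<exists>c\<in>nonunits V. b = x [^] n \<otimes> c" for n a
  proof -
    obtain b d where 1: "b \<in> P n" "d \<in> D" "a = b \<oplus> d \<otimes> x [^] n" using a unfolding polys.simps by blast
    obtain c where c: "c \<in> nonunits V" "b = x [^] n \<otimes> c" using h[OF 1(1)] by blast
    have "a = x [^] n \<otimes> (c \<oplus> d)" unfolding 1(3) c(2)
      using xn[of n] Vcl(1)[OF nonunitsD(1)[OF c(1)]] Dcl(1)[OF 1(2)] by algebra
    thus ?thesis using Vcl(5)[OF nonunitsD(1)[OF c(1)] dominatesD(3)[OF V 1(2)]] by blast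
  qed
  have main: "\<exists>c\<in>nonunits V. a = x [^] n \<otimes> c" if "a \<in> P n" for n a
    using that
  proof (induct n arbitrary: a)
    case 0
    have "a = x [^] (0::nat) \<otimes> \<zero>" using 0 by simp
    thus ?case using subidealD(2)[OF nonunits_subideal[OF Vval]] by blast
  next
    case (Suc n)
    obtain c where c: "c \<in> V" "a = x [^] n \<otimes> c" using step[OF Suc(2,1)] by blast
    have "x [^] Suc n \<otimes> (u \<otimes> c) = x [^] n \<otimes> (x \<otimes> u) \<otimes> c" unfolding nat_pow_Suc using xn[of n] x u(1) Vcl(1)[OF c(1)] by algebra
    hence "a = x [^] Suc n \<otimes> (u \<otimes> c)" unfolding u(2) c(2) using xn[of n] by simp
    thus ?case using nonunits_mult(1)[OF Vsub un c(1)] by blast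
  qed
  show "a \<in> P n \<Longrightarrow> \<exists>c\<in>nonunits V. a = x [^] n \<otimes> c" by (rule main)
  show "a \<in> P (Suc n) \<Longrightarrow> \<exists>c\<in>V. a = x [^] n \<otimes> c" using step main by blast
  assume "monic x D n a"
  then obtain l where l: "l \<in> P n" "a = x [^] n \<oplus> l" unfolding monic_def by blast
  obtain c where c: "c \<in> nonunits V" "l = x [^] n \<otimes> c" using main[OF l(1)] by blast
  have "a = x [^] n \<otimes> (\<one> \<oplus> c)" unfolding l(2) c(2) using xn[of n] Vcl(1)[OF nonunitsD(1)[OF c(1)]] by algebra
  thus "\<exists>c\<in>V. c \<notin> nonunits V \<and> a = x [^] n \<otimes> c" using one_plus_unit(1,2)[OF Vval c(1)] by blast
qed

end

end

context chart_point
begin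

lemma dominates_blowup:
  assumes V: "dominates V D m" and xV: "x \<in> V" and pV: "p \<in> nonunits V"
  shows "dominates V D1 (gen2 D1 p t)"
proof -
  note Vval = dominatesD(1)[OF V] and Vsub = dominatesD(2)[OF V]
  note Vcl = subring_closed[OF Vsub]
  have nonQ: "b \<notin> nonunits V" if b: "b \<in> Rx" "b \<notin> Q" for b
  proof
    assume bn: "b \<in> nonunits V"
    obtain u v w where 1: "u \<in> Rx" "v \<in> Rx" "w \<in> Rx" "\<one> = b \<otimes> u \<oplus> p \<otimes> v \<oplus> t \<otimes> w" using bezout_one[OF b] by blast
    have "b \<otimes> u \<oplus> p \<otimes> v \<oplus> t \<otimes> w \<in> nonunits V"
      by (intro nonunits_add[OF Vval] nonunits_mult(1)[OF Vsub] bn pV t_nonunit[OF V] polyring_in_V[OF V xV] 1(1-3))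
    thus False using 1(4) nonunits_one[OF Vsub] by simp
  qed
  have sub: "D1 \<subseteq> V"
  proof
    fix y assume "y \<in> D1"
    then obtain a b b' where 1: "a \<in> Rx" "b \<in> Rx" "b' \<in> D1" "b \<notin> Q" "b \<otimes> b' = \<one>" "y = a \<otimes> b'" using D1_frac by blast
    have bV: "b \<in> V" using polyring_in_V[OF V xV 1(2)] .
    obtain c where c: "c \<in> V" "b \<otimes> c = \<one>" using unitD[OF bV nonQ[OF 1(2,4)]] by blast
    have "b \<noteq> \<zero>" using 1(4) subidealD(2)[OF Q_ideal] by blast
    hence "b' = c" using m_lcancel[of b b' c] 1(5) c Vcl(1) bV D1_carrier[OF 1(3)] by simp
    thus "y \<in> V" unfolding 1(6) using Vcl(7)[OF polyring_in_V[OF V xV 1(1)] c(1)] by simp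
  qed
  have "gen2 D1 p t \<subseteq> nonunits V" unfolding gen2_def
    using nonunits_add[OF Vval] nonunits_mult(1)[OF Vsub] pV t_nonunit[OF V] sub by blast
  thus ?thesis unfolding dominates_def using Vval sub by blast
qed

text \<open>
  If \<open>y\<close> serves for the valuation rings that dominate \<open>D1\<close>, then \<open>w\<close> serves for all those that
  dominate \<open>D\<close>: it lies in every one that does not dominate \<open>D1\<close>, and in every one that contains \<open>y\<close>.
  The construction \<open>w = \<rho> / F'\<close> is explained at the beginning.
\<close>
lemma blowup_step:
  assumes V: "dominates V D m" and xV: "x \<in> V" and QV: "Q = Rx \<inter> nonunits V"
    and y: "y \<in> carrier R" "y \<notin> V"
  shows "\<exists>w\<in>carrier R. w \<notin> V \<and> (\<forall>V'. dominates V' D m \<longrightarrow> (\<not> dominates V' D1 (gen2 D1 p t) \<or> y \<in> V') \<longrightarrow> w \<in> V')"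
proof -
  note Vval = dominatesD(1)[OF V] and Vsub = dominatesD(2)[OF V]
  note Vcl = subring_closed[OF Vsub]
  have y0: "y \<noteq> \<zero>" using y Vcl(2) by blast
  obtain F G n where FG: "F \<in> D" "G \<in> D" "F \<noteq> \<zero>" "y \<otimes> F = G" "len_le D (gen2 D F G) n" using rep[OF y(1) y0] by blast
  obtain k F1 G1 and b :: nat where d: "F1 \<in> P (Suc k)" "G1 \<in> P (Suc k)" "F1 \<notin> T \<or> G1 \<notin> T"
    "t [^] b \<in> gen2 Rx F1 G1" and F10: "F1 \<noteq> \<zero>" and yF1: "y \<otimes> F1 = G1"
    by (rule fraction[OF FG(1,3,2,5) y(1) FG(4)]) blast
  have F1R: "F1 \<in> Rx" and G1R: "G1 \<in> Rx" using polys_polyring[OF sub x] d by auto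
  have F1c: "F1 \<in> carrier R" and G1c: "G1 \<in> carrier R" using Rcl(1) F1R G1R by auto
  have G10: "G1 \<noteq> \<zero>" using yF1 y0 F10 integral[of y F1] y(1) F1c by auto
  \<comment> \<open>Adding \<open>p\<close> to \<open>F1 / G1\<close> does not change where it is a nonunit among the valuation rings
    dominating \<open>D1\<close>, and makes the denominator nonzero modulo \<open>t\<close>.\<close>
  obtain q where q: "q \<in> Rx" "q = \<zero> \<or> q = p" "F1 \<oplus> q \<otimes> G1 \<notin> T"
  proof (cases "F1 \<in> T")
    case False
    hence "F1 \<oplus> \<zero> \<otimes> G1 \<notin> T" using F1c G1c by simp
    thus ?thesis using that Rcl(2) by blast
  next
    case True
    hence "p \<otimes> G1 \<notin> T" using T_prime[OF p_R monic_not_T[OF p_monic] G1R] d(3) by blast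
    moreover have "p \<otimes> G1 = (F1 \<oplus> p \<otimes> G1) \<ominus> F1" using F1c G1c p_carrier by algebra
    ultimately have "F1 \<oplus> p \<otimes> G1 \<notin> T" using subideal_minus[OF Rsub T_ideal _ True] by metis
    thus ?thesis using that p_R by blast
  qed
  define F2 where "F2 = F1 \<oplus> q \<otimes> G1"
  have qc: "q \<in> carrier R" using Rcl(1)[OF q(1)] .
  have F2R: "F2 \<in> Rx" unfolding F2_def using Rcl(5,7) F1R G1R q(1) by blast
  have F2c: "F2 \<in> carrier R" using Rcl(1)[OF F2R] .
  obtain u v where uv: "u \<in> Rx" "v \<in> Rx" "t [^] b = F2 \<otimes> u \<oplus> G1 \<otimes> v"
  proof -
    obtain u v where 1: "u \<in> Rx" "v \<in> Rx" "t [^] b = F1 \<otimes> u \<oplus> G1 \<otimes> v" using d(4) unfolding gen2_def by blast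
    have "t [^] b = F2 \<otimes> u \<oplus> G1 \<otimes> (v \<ominus> q \<otimes> u)" unfolding 1(3) F2_def
      using F1c G1c qc Rcl(1)[OF 1(1)] Rcl(1)[OF 1(2)] by algebra
    thus ?thesis using that[OF 1(1)] Rcl(6,7) q(1) 1 by blast
  qed
  obtain j g e where f: "g \<in> Rx" "e \<in> Rx" "g \<notin> Q" "F2 = p [^] (j::nat) \<otimes> g \<oplus> t \<otimes> e"
    using factor_mod[OF F2R] q(3) F2_def by blast
  obtain F' g' h e' where H: "g' \<in> Rx" "h \<in> Rx" "e' \<in> Rx" "monic x D (j * r) F'" "F' = p [^] j \<oplus> t \<otimes> e'" "g' \<notin> Q"
    "F2 = F' \<otimes> g' \<oplus> t [^] Suc b \<otimes> h"
    using hensel[OF F2R f(1,3,2,4), of b] by blast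
  obtain q' where q': "q' \<in> Rx" "G1 \<ominus> q' \<otimes> F' \<in> P (j * r)" using monic_division[OF sub x H(4) G1R] by blast
  define \<rho> where "\<rho> = G1 \<ominus> q' \<otimes> F'"
  have rR: "\<rho> \<in> Rx" using polys_polyring[OF sub x q'(2)] unfolding \<rho>_def .
  have F'0: "F' \<noteq> \<zero>" using monic_not_T[OF H(4)] subidealD(2)[OF T_ideal] by blast
  have c: "F' \<in> carrier R" "g' \<in> carrier R" "h \<in> carrier R" "q' \<in> carrier R" "\<rho> \<in> carrier R" "u \<in> carrier R" "v \<in> carrier R"
    "t [^] b \<in> carrier R" "t \<in> carrier R"
    using monicD(3)[OF sub x H(4)] Rcl(1)[OF H(1)] Rcl(1)[OF H(2)] Rcl(1)[OF q'(1)] Rcl(1)[OF rR]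
      Rcl(1)[OF uv(1)] Rcl(1)[OF uv(2)] tpow_R(3)[of b] st_carrier by blast+
  define w where "w = \<rho> \<otimes> inv F'"
  have iF: "inv F' \<in> carrier R" "inv F' \<otimes> F' = \<one>" using inv_facts[OF c(1) F'0] by auto
  have w: "w \<in> carrier R" "w \<otimes> F' = \<rho>" unfolding w_def using c iF by (auto simp: m_assoc)
  have wV: "w \<in> V' \<longleftrightarrow> vdvd V' F' \<rho>" if "subring V' R" for V' using vdvd_frac[OF that c(1) F'0 w(1)] w(2) by simp
  have RV: "z \<in> V" if "z \<in> Rx" for z using polyring_in_V[OF V xV that] .
  \<comment> \<open>With \<open>v G1 < v F2\<close>, membership of \<open>t ^ b\<close> in \<open>(F2, G1)\<close> gives \<open>v G1 \<le> b * v t\<close>,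
    so the error term \<open>t ^ (b + 1) * h\<close> is too small to matter.\<close>
  have "\<not> vdvd V F' \<rho>"
  proof
    assume "vdvd V F' \<rho>"
    then obtain c0 where c0: "c0 \<in> V" "\<rho> = F' \<otimes> c0" unfolding vdvd_def by blast
    have "G1 = \<rho> \<oplus> q' \<otimes> F'" unfolding \<rho>_def using c G1c by algebra
    also have "\<dots> = F' \<otimes> (c0 \<oplus> q')" unfolding c0(2) using c Vcl(1)[OF c0(1)] by algebra
    finally have "vdvd V F' G1" using vdvdI Vcl(5)[OF c0(1) RV[OF q'(1)]] by blast
    moreover have g'V: "g' \<in> V" "g' \<notin> nonunits V" using RV[OF H(1)] H(1,6) QV by auto
    ultimately have v1: "vdvd V (F' \<otimes> g') G1" using vdvd_trans[OF Vsub unit_mult_vdvd[OF Vsub g'V c(1)]] c by simp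
    have "\<not> vdvd V F1 G1" using vdvd_frac[OF Vsub F1c F10 y(1)] yF1 y(2) by simp
    then obtain c1 where c1: "c1 \<in> nonunits V" "F1 = G1 \<otimes> c1" using not_vdvd[OF Vval F1c G1c] by blast
    have qn: "q \<in> nonunits V" using q(2) p_Q QV subidealD(2)[OF nonunits_subideal[OF Vval]] by auto
    have c1c: "c1 \<in> carrier R" using Vcl(1)[OF nonunitsD(1)[OF c1(1)]] .
    have F2G: "F2 = G1 \<otimes> (c1 \<oplus> q)" unfolding F2_def c1(2) using G1c c1c qc by algebra
    have c2: "c1 \<oplus> q \<in> nonunits V" using nonunits_add[OF Vval c1(1) qn] .
    define d0 where "d0 = (c1 \<oplus> q) \<otimes> u \<oplus> v"
    have d0: "d0 \<in> V" unfolding d0_def using Vcl(5,7) nonunitsD(1)[OF c2] RV uv by simp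
    have tb: "t [^] b = G1 \<otimes> d0" unfolding uv(3) F2G d0_def using G1c c1c qc c by algebra
    define c3 where "c3 = (c1 \<oplus> q) \<ominus> t \<otimes> (d0 \<otimes> h)"
    have c3: "c3 \<in> nonunits V" unfolding c3_def
      using subideal_minus[OF Vsub nonunits_subideal[OF Vval] c2 t_mult_nonunit[OF V Vcl(7)[OF d0 RV[OF H(2)]]]] .
    have "F' \<otimes> g' = F2 \<ominus> t [^] Suc b \<otimes> h" unfolding H(7) using c tpow_R(3)[of "Suc b"] by algebra
    also have "\<dots> = G1 \<otimes> c3" unfolding nat_pow_Suc F2G tb c3_def using G1c c1c qc c Vcl(1)[OF d0] by algebra
    finally show False using v1 not_vdvd_mult_nonunit[OF Vsub c3 G1c G10] by simp
  qed
  hence "w \<notin> V" using wV[OF Vsub] by blast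
  moreover have "w \<in> V'" if V': "dominates V' D m" and yV': "\<not> dominates V' D1 (gen2 D1 p t) \<or> y \<in> V'" for V'
  proof -
    note V'val = dominatesD(1)[OF V'] and V'sub = dominatesD(2)[OF V']
    note V'cl = subring_closed[OF V'sub]
    have "vdvd V' F' \<rho>"
    proof (cases "x \<in> V'")
      case False
      \<comment> \<open>at infinity the degrees decide\<close>
      obtain c0 where c0: "c0 \<in> nonunits V'" "\<rho> = x [^] (j * r) \<otimes> c0"
        using poles_at_infinity(1)[OF V' False q'(2)] unfolding \<rho>_def by blast
      obtain c1 where c1: "c1 \<in> V'" "c1 \<notin> nonunits V'" "F' = x [^] (j * r) \<otimes> c1"
        using poles_at_infinity(3)[OF V' False H(4)] by blast
      have "vdvd V' c1 c0" using unit_vdvd[OF V'sub c1(1,2) nonunitsD(1)[OF c0(1)]] .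
      hence "vdvd V' (c1 \<otimes> x [^] (j * r)) (c0 \<otimes> x [^] (j * r))"
        using vdvd_mult[OF V'sub _ V'cl(1)[OF c1(1)]] x by simp
      thus ?thesis unfolding c0(2) c1(3)
        using m_comm x V'cl(1)[OF c1(1)] V'cl(1)[OF nonunitsD(1)[OF c0(1)]] by simp
    next
      case xV': True
      have RV': "z \<in> V'" if "z \<in> Rx" for z using polyring_in_V[OF V' xV' that] .
      show ?thesis
      proof (cases "p \<in> nonunits V'")
        case False
        \<comment> \<open>at another point of the curve \<open>F'\<close> is a unit\<close>
        have "p [^] j \<in> V' \<and> p [^] j \<notin> nonunits V'" using unit_pow[OF V'sub RV'[OF p_R] False] .
        hence "F' \<in> V'" "F' \<notin> nonunits V'" unfolding H(5)
          using unit_add_nonunit[OF V'val _ _ t_mult_nonunit[OF V' RV'[OF H(3)]]] by blast+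
        thus ?thesis using unit_vdvd[OF V'sub] RV'[OF rR] by blast
      next
        case pn: True
        \<comment> \<open>at the given point \<open>v F2 \<le> v G1\<close>, hence \<open>v F2 \<le> b * v t\<close>, and \<open>F'\<close> is \<open>F2\<close> up to a unit\<close>
        hence "dominates V' D1 (gen2 D1 p t)" using dominates_blowup[OF V' xV'] by blast
        hence "vdvd V' F1 G1" using yV' vdvd_frac[OF V'sub F1c F10 y(1)] yF1 by simp
        then obtain c1 where c1: "c1 \<in> V'" "G1 = F1 \<otimes> c1" unfolding vdvd_def by blast
        have qn: "q \<in> nonunits V'" using q(2) pn subidealD(2)[OF nonunits_subideal[OF V'val]] by auto
        have c1c: "c1 \<in> carrier R" using V'cl(1)[OF c1(1)] .
        have "F2 = F1 \<otimes> (\<one> \<oplus> q \<otimes> c1)" unfolding F2_def c1(2) using F1c c1c qc by (simp add: r_distr m_ac)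
        hence "vdvd V' F2 F1"
          using unit_mult_vdvd[OF V'sub one_plus_unit(1,2)[OF V'val nonunits_mult(1)[OF V'sub qn c1(1)]] F1c] by simp
        hence v2: "vdvd V' F2 G1" using vdvd_trans[OF V'sub _ _ F2c] \<open>vdvd V' F1 G1\<close> by blast
        then obtain c2 where c2: "c2 \<in> V'" "G1 = F2 \<otimes> c2" unfolding vdvd_def by blast
        define d0 where "d0 = u \<oplus> c2 \<otimes> v"
        have d0: "d0 \<in> V'" unfolding d0_def using V'cl(5,7) c2(1) RV' uv by simp
        have tb: "t [^] b = F2 \<otimes> d0" unfolding uv(3) d0_def c2(2) using F2c V'cl(1)[OF c2(1)] c by algebra
        have n: "t \<otimes> (d0 \<otimes> h) \<in> nonunits V'" using t_mult_nonunit[OF V' V'cl(7)[OF d0 RV'[OF H(2)]]] .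
        have "F' \<otimes> g' = F2 \<ominus> t [^] Suc b \<otimes> h" using H(7) c tpow_R(3)[of "Suc b"] by algebra
        also have "\<dots> = F2 \<otimes> (\<one> \<ominus> t \<otimes> (d0 \<otimes> h))" unfolding nat_pow_Suc tb
          using F2c c V'cl(1)[OF d0] by (simp add: a_minus_def r_distr r_minus m_ac)
        finally have "vdvd V' (F' \<otimes> g') F2" using unit_mult_vdvd[OF V'sub one_plus_unit(3,4)[OF V'val n] F2c] by simp
        moreover have "vdvd V' F' (F' \<otimes> g')" using vdvdI RV'[OF H(1)] by blast
        ultimately have "vdvd V' F' G1" using vdvd_trans[OF V'sub] v2 c by blast
        moreover have "vdvd V' F' (q' \<otimes> F')" using vdvdI[OF RV'[OF q'(1)]] m_comm c by simp
        ultimately show ?thesis unfolding \<rho>_def using vdvd_add(2)[OF V'sub] c by blast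
      qed
    qed
    thus ?thesis using wV[OF V'sub] by blast
  qed
  ultimately show ?thesis using w(1) by blast
qed

end

section \<open>The generic point of the exceptional curve\<close>

context chart
begin

text \<open>
  Let \<open>y = G1 / F1\<close> in lowest terms with respect to \<open>t\<close>. If \<open>V\<close> is centred on the generic point of the
  exceptional curve, then \<open>y \<notin> V\<close> says that \<open>y\<close> has a pole along the curve, that is, \<open>F1 \<in> T\<close>. So a
  valuation ring containing \<open>y\<close> must have \<open>v t \<le> v F1 \<le> v G1\<close>, and at the point at infinity the
  same holds with \<open>s\<close> in place of \<open>t\<close> after division by the powers of \<open>x\<close>.
\<close>
lemma generic_witness:
  assumes V: "dominates V D m" and xV: "x \<in> V" and QV: "Rx \<inter> nonunits V \<subseteq> T"
    and y: "y \<in> carrier R" "y \<notin> V"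
  shows "\<exists>j. \<exists>G\<in>P (Suc j). G \<notin> T \<and> (\<forall>V'. dominates V' D m \<longrightarrow> y \<in> V' \<longrightarrow>
    (x \<in> V' \<longrightarrow> vdvd V' t G) \<and> (x \<notin> V' \<longrightarrow> (\<exists>c\<in>V'. G = x [^] j \<otimes> c \<and> vdvd V' s c)))"
proof -
  note Vval = dominatesD(1)[OF V] and Vsub = dominatesD(2)[OF V]
  note Vcl = subring_closed[OF Vsub]
  have y0: "y \<noteq> \<zero>" using y Vcl(2) by blast
  obtain F G n where FG: "F \<in> D" "G \<in> D" "F \<noteq> \<zero>" "y \<otimes> F = G" "len_le D (gen2 D F G) n" using rep[OF y(1) y0] by blast
  obtain k F1 G1 and b :: nat where d: "F1 \<in> P (Suc k)" "G1 \<in> P (Suc k)" "F1 \<notin> T \<or> G1 \<notin> T"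
    "t [^] b \<in> gen2 Rx F1 G1" and F10: "F1 \<noteq> \<zero>" and yF1: "y \<otimes> F1 = G1"
    by (rule fraction[OF FG(1,3,2,5) y(1) FG(4)]) blast
  have F1R: "F1 \<in> Rx" and G1R: "G1 \<in> Rx" using polys_polyring[OF sub x d(1)] polys_polyring[OF sub x d(2)] by auto
  have F1c: "F1 \<in> carrier R" and G1c: "G1 \<in> carrier R" using Rcl(1) F1R G1R by auto
  have yV: "y \<in> V' \<longleftrightarrow> vdvd V' F1 G1" if "subring V' R" for V' using vdvd_frac[OF that F1c F10 y(1)] yF1 by simp
  have F1T: "F1 \<in> T"
  proof (rule ccontr)
    assume "F1 \<notin> T"
    hence "F1 \<in> V" "F1 \<notin> nonunits V" "G1 \<in> V" using QV F1R G1R polyring_in_V[OF V xV] by auto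
    thus False using unit_vdvd[OF Vsub] yV[OF Vsub] y(2) by blast
  qed
  obtain N where "F1 \<in> M N" using T_M[OF F1T] by blast
  then obtain F2 where F2: "F2 \<in> P (Suc (Suc k))" "F1 = t \<otimes> F2" using M_tP M_degree[OF d(1)] by blast
  have F2c: "F2 \<in> carrier R" using Pc[OF F2(1)] .
  have "(x \<in> V' \<longrightarrow> vdvd V' t G1) \<and> (x \<notin> V' \<longrightarrow> (\<exists>c\<in>V'. G1 = x [^] k \<otimes> c \<and> vdvd V' s c))"
    if V': "dominates V' D m" and yV': "y \<in> V'" for V'
  proof (intro conjI impI)
    note V'sub = dominatesD(2)[OF V']
    note V'cl = subring_closed[OF V'sub]
    have v: "vdvd V' F1 G1" using yV'[unfolded yV[OF V'sub]] .
    show "vdvd V' t G1" if "x \<in> V'"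
    proof -
      have "F2 \<in> V'" using polyring_in_V[OF V' that polys_polyring[OF sub x F2(1)]] .
      hence "vdvd V' t F1" using F2(2) vdvdI by blast
      thus ?thesis using vdvd_trans[OF V'sub _ v] st_carrier by blast
    qed
    show "\<exists>c\<in>V'. G1 = x [^] k \<otimes> c \<and> vdvd V' s c" if xV': "x \<notin> V'"
    proof -
      have x0: "x \<noteq> \<zero>" using xV' V'cl(2) by blast
      have xk: "x [^] k \<in> carrier R" "x [^] k \<noteq> \<zero>" using x x0 by (auto simp: pow_nz)
      obtain c' where c': "c' \<in> V'" "F2 = x [^] Suc k \<otimes> c'" using poles_at_infinity(2)[OF V' xV' F2(1)] by blast
      obtain c where c: "c \<in> V'" "G1 = x [^] k \<otimes> c" using poles_at_infinity(2)[OF V' xV' d(2)] by blast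
      have cc: "c \<in> carrier R" "c' \<in> carrier R" using V'cl(1) c c' by auto
      have "F1 = (s \<otimes> c') \<otimes> x [^] k" unfolding F2(2) c'(2) sx nat_pow_Suc using cc x xk(1) st_carrier(2) by algebra
      moreover have "G1 = c \<otimes> x [^] k" unfolding c(2) using cc xk(1) by (simp add: m_comm)
      ultimately have "vdvd V' (s \<otimes> c') c" using vdvd_cancel[OF V'sub _ _ _ xk] v cc st_carrier by simp
      moreover have "vdvd V' s (s \<otimes> c')" using vdvdI c'(1) by blast
      ultimately have "vdvd V' s c" using vdvd_trans[OF V'sub] st_carrier by blast
      thus ?thesis using c by blast
    qed
  qed
  thus ?thesis using d(2,3) F1T by blast
qed

text \<open>
  With \<open>\<Gamma> = G1 * G2\<close> of degree at most \<open>d = j + k\<close>, the function \<open>w = \<Gamma> / (t L)\<close> has a pole along the exceptional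
  curve, and where \<open>G1\<close> or \<open>G2\<close> vanishes to the order of \<open>t\<close>, so does \<open>\<Gamma>\<close>, and the factor \<open>t\<close> is
  compensated. The monic polynomial \<open>L\<close> is prime to \<open>\<Gamma>\<close> modulo \<open>t\<close>, hence a unit at these points, and
  its degree \<open>d + 1\<close> makes \<open>t L\<close> a form \<open>s l x ^ d\<close> with a unit \<open>l\<close> at infinity.
\<close>
lemma generic_step:
  assumes V: "dominates V D m" and xV: "x \<in> V" and QV: "Rx \<inter> nonunits V \<subseteq> T"
    and y: "y \<in> carrier R" "y \<notin> V" and z: "z \<in> carrier R" "z \<notin> V"
  shows "\<exists>w\<in>carrier R. w \<notin> V \<and> (\<forall>V'. dominates V' D m \<longrightarrow> y \<in> V' \<or> z \<in> V' \<longrightarrow> w \<in> V')"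
proof -
  note Vval = dominatesD(1)[OF V] and Vsub = dominatesD(2)[OF V]
  note Vcl = subring_closed[OF Vsub]
  obtain j G1 where 1: "G1 \<in> P (Suc j)" "G1 \<notin> T" "\<And>V'. dominates V' D m \<Longrightarrow> y \<in> V' \<Longrightarrow>
    (x \<in> V' \<longrightarrow> vdvd V' t G1) \<and> (x \<notin> V' \<longrightarrow> (\<exists>c\<in>V'. G1 = x [^] j \<otimes> c \<and> vdvd V' s c))"
    using generic_witness[OF V xV QV y] by blast
  obtain k G2 where 2: "G2 \<in> P (Suc k)" "G2 \<notin> T" "\<And>V'. dominates V' D m \<Longrightarrow> z \<in> V' \<Longrightarrow>
    (x \<in> V' \<longrightarrow> vdvd V' t G2) \<and> (x \<notin> V' \<longrightarrow> (\<exists>c\<in>V'. G2 = x [^] k \<otimes> c \<and> vdvd V' s c))"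
    using generic_witness[OF V xV QV z] by blast
  define \<Gamma> where "\<Gamma> = G1 \<otimes> G2"
  have GR: "G1 \<in> Rx" "G2 \<in> Rx" using polys_polyring[OF sub x] 1(1) 2(1) by blast+
  have Gc: "G1 \<in> carrier R" "G2 \<in> carrier R" using Rcl(1) GR by auto
  have \<Gamma>R: "\<Gamma> \<in> Rx" unfolding \<Gamma>_def using Rcl(7) GR by blast
  have \<Gamma>T: "\<Gamma> \<notin> T" unfolding \<Gamma>_def using T_prime GR 1(2) 2(2) by blast
  have "\<Gamma> \<in> P (Suc (j + k))" unfolding \<Gamma>_def using polys_mult[OF sub x DD 1(1) 2(1)] by simp
  then obtain d c c' g b where l: "d < Suc (j + k)" "c \<in> D" "c' \<in> D" "c \<otimes> c' = \<one>" "monic x D d g" "b \<in> Rx" "\<Gamma> = c \<otimes> g \<oplus> t \<otimes> b"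
    using lead \<Gamma>T by blast
  define e where "e = Suc (j + k) - d"
  \<comment> \<open>a monic polynomial of degree \<open>j + k + 1\<close> that is \<open>1\<close> wherever \<open>g\<close> vanishes\<close>
  define L where "L = g \<otimes> x [^] e \<oplus> \<one>"
  have xeR: "x [^] e \<in> Rx" using subring_pow[OF Rsub polyring_var[OF sub x]] .
  have Lmon: "monic x D (Suc (j + k)) L"
  proof -
    have "x [^] e = x [^] e \<oplus> \<zero>" using x by simp
    hence "monic x D e (x [^] e)" unfolding monic_def using polys_zero[OF sub DD x] by blast
    hence "monic x D (Suc (j + k)) (g \<otimes> x [^] e)" using monic_mult[OF sub x l(5)] l(1) unfolding e_def by fastforce
    then obtain l where l': "l \<in> P (Suc (j + k))" "g \<otimes> x [^] e = x [^] Suc (j + k) \<oplus> l" unfolding monic_def by blast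
    have "\<one> \<otimes> x [^] (0::nat) \<in> P (Suc (j + k))" using polys_monomial[OF sub DD x Dcl(3), of 0] by blast
    hence "l \<oplus> \<one> \<in> P (Suc (j + k))" using polys_add[OF sub DD x l'(1)] by simp
    moreover have "L = x [^] Suc (j + k) \<oplus> (l \<oplus> \<one>)" unfolding L_def l'(2)
      using Pc[OF l'(1)] nat_pow_closed[OF x, of "Suc (j + k)"] by (simp add: a_assoc del: nat_pow_Suc)
    ultimately show ?thesis unfolding monic_def by blast
  qed
  have LR: "L \<in> Rx" and Lc: "L \<in> carrier R" using monicD(2,3)[OF sub x Lmon] by auto
  have L0: "L \<noteq> \<zero>" using monic_not_T[OF Lmon] subidealD(2)[OF T_ideal] by auto
  have \<Gamma>c: "\<Gamma> \<in> carrier R" using Rcl(1)[OF \<Gamma>R] .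
  have tL: "t \<otimes> L \<in> carrier R" "t \<otimes> L \<noteq> \<zero>" using Lc L0 t_nz st_carrier by (auto simp: integral_iff)
  define w where "w = \<Gamma> \<otimes> inv (t \<otimes> L)"
  have w: "w \<in> carrier R" "w \<otimes> (t \<otimes> L) = \<Gamma>" unfolding w_def using inv_facts[OF tL] \<Gamma>c tL by (auto simp: m_assoc simp del: m_assoc[symmetric])
  have wV: "w \<in> V' \<longleftrightarrow> vdvd V' (t \<otimes> L) \<Gamma>" if "subring V' R" for V' using vdvd_frac[OF that tL w(1)] w(2) by simp
  have "\<not> vdvd V (t \<otimes> L) \<Gamma>"
  proof
    assume "vdvd V (t \<otimes> L) \<Gamma>"
    then obtain h where h: "h \<in> V" "\<Gamma> = t \<otimes> L \<otimes> h" unfolding vdvd_def by blast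
    have "\<Gamma> = t \<otimes> (L \<otimes> h)" unfolding h(2) using Lc Vcl(1)[OF h(1)] st_carrier by (simp add: m_assoc)
    moreover have "L \<otimes> h \<in> V" using Vcl(7)[OF polyring_in_V[OF V xV LR] h(1)] .
    ultimately have "\<Gamma> \<in> nonunits V" using t_mult_nonunit[OF V] by simp
    thus False using QV \<Gamma>R \<Gamma>T by blast
  qed
  hence "w \<notin> V" using wV[OF Vsub] by blast
  moreover have "w \<in> V'" if V': "dominates V' D m" and yz: "y \<in> V' \<or> z \<in> V'" for V'
  proof -
    note V'val = dominatesD(1)[OF V'] and V'sub = dominatesD(2)[OF V']
    note V'cl = subring_closed[OF V'sub]
    have "vdvd V' (t \<otimes> L) \<Gamma>"
    proof (cases "x \<in> V'")
      case True
      have RV': "z \<in> V'" if "z \<in> Rx" for z using polyring_in_V[OF V' True that] .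
      have mult: "vdvd V' t (a \<otimes> b)" if "vdvd V' t a" "b \<in> V'" "a \<in> carrier R" for a b
      proof -
        have "vdvd V' a (a \<otimes> b)" using that(2) vdvdI by blast
        thus ?thesis using vdvd_trans[OF V'sub that(1)] st_carrier by blast
      qed
      have "vdvd V' t (G1 \<otimes> G2)"
      proof (cases "y \<in> V'")
        case y': True
        show ?thesis using mult[OF _ RV'[OF GR(2)] Gc(1)] 1(3)[OF V' y'] True by blast
      next
        case False
        hence "vdvd V' t G2" using 2(3)[OF V'] yz True by blast
        hence "vdvd V' t (G2 \<otimes> G1)" using mult[OF _ RV'[OF GR(1)] Gc(2)] by blast
        thus ?thesis using m_comm Gc by simp
      qed
      then obtain f where f: "f \<in> V'" "\<Gamma> = t \<otimes> f" unfolding \<Gamma>_def vdvd_def by blast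
      have "L \<notin> nonunits V'"
      proof
        assume Ln: "L \<in> nonunits V'"
        have "\<Gamma> \<in> nonunits V'" unfolding f(2) using t_mult_nonunit[OF V' f(1)] .
        hence "\<Gamma> \<ominus> t \<otimes> b \<in> nonunits V'"
          using subideal_minus[OF V'sub nonunits_subideal[OF V'val] _ t_mult_nonunit[OF V' RV'[OF l(6)]]] by blast
        hence "(c' \<otimes> x [^] e) \<otimes> (\<Gamma> \<ominus> t \<otimes> b) \<in> nonunits V'"
          using nonunits_mult(2)[OF V'sub] V'cl(7) RV' RD[OF l(3)] xeR by blast
        moreover have "(c' \<otimes> x [^] e) \<otimes> (\<Gamma> \<ominus> t \<otimes> b) = (c \<otimes> c') \<otimes> (g \<otimes> x [^] e)" unfolding l(7)
          using Dcl(1)[OF l(2)] Dcl(1)[OF l(3)] Rcl(1)[OF l(6)] monicD(3)[OF sub x l(5)] st_carrier Rcl(1)[OF xeR] by algebra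
        ultimately have gn: "g \<otimes> x [^] e \<in> nonunits V'" using l(4) monicD(3)[OF sub x l(5)] x by simp
        have "L \<ominus> g \<otimes> x [^] e = \<one>" unfolding L_def using monicD(3)[OF sub x l(5)] Rcl(1)[OF xeR] by algebra
        hence "\<one> \<in> nonunits V'" using subideal_minus[OF V'sub nonunits_subideal[OF V'val] Ln gn] by simp
        thus False using nonunits_one[OF V'sub] by blast
      qed
      then obtain h where h: "h \<in> V'" "f = L \<otimes> h" using unit_vdvd[OF V'sub RV'[OF LR] _ f(1)] unfolding vdvd_def by blast
      have "\<Gamma> = t \<otimes> L \<otimes> h" unfolding f(2) h(2) using Lc V'cl(1)[OF h(1)] st_carrier by (simp add: m_assoc)
      thus ?thesis using h(1) vdvdI by blast
    next
      case False
      obtain f1 where f1: "f1 \<in> V'" "G1 = x [^] j \<otimes> f1" "y \<in> V' \<longrightarrow> vdvd V' s f1"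
        using poles_at_infinity(2)[OF V' False 1(1)] 1(3)[OF V'] False by blast
      obtain f2 where f2: "f2 \<in> V'" "G2 = x [^] k \<otimes> f2" "z \<in> V' \<longrightarrow> vdvd V' s f2"
        using poles_at_infinity(2)[OF V' False 2(1)] 2(3)[OF V'] False by blast
      obtain l' where l': "l' \<in> V'" "l' \<notin> nonunits V'" "L = x [^] Suc (j + k) \<otimes> l'" using poles_at_infinity(3)[OF V' False Lmon] by blast
      have fc: "f1 \<in> carrier R" "f2 \<in> carrier R" "l' \<in> carrier R" using V'cl(1) f1 f2 l' by auto
      obtain f where f: "f \<in> V'" "f1 \<otimes> f2 = s \<otimes> f"
      proof (cases "y \<in> V'")
        case True
        then obtain h where h: "h \<in> V'" "f1 = s \<otimes> h" using f1(3) unfolding vdvd_def by blast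
        have "f1 \<otimes> f2 = s \<otimes> (h \<otimes> f2)" unfolding h(2) using V'cl(1)[OF h(1)] fc st_carrier by (simp add: m_assoc)
        thus ?thesis using that V'cl(7)[OF h(1) f2(1)] by blast
      next
        case False
        then obtain h where h: "h \<in> V'" "f2 = s \<otimes> h" using f2(3) yz unfolding vdvd_def by blast
        have "f1 \<otimes> f2 = s \<otimes> (h \<otimes> f1)" unfolding h(2) using V'cl(1)[OF h(1)] fc st_carrier by algebra
        thus ?thesis using that V'cl(7)[OF h(1) f1(1)] by blast
      qed
      obtain h where h: "h \<in> V'" "f = l' \<otimes> h" using unit_vdvd[OF V'sub l'(1,2) f(1)] unfolding vdvd_def by blast
      have hc: "h \<in> carrier R" using V'cl(1)[OF h(1)] .
      have xx: "x [^] j \<in> carrier R" "x [^] k \<in> carrier R" "x [^] (j + k) = x [^] j \<otimes> x [^] k" using x by (auto simp: nat_pow_mult)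
      have "\<Gamma> = (x [^] j \<otimes> x [^] k) \<otimes> (f1 \<otimes> f2)" unfolding \<Gamma>_def f1(2) f2(2) using xx(1,2) fc by algebra
      also have "\<dots> = t \<otimes> L \<otimes> h" unfolding f(2) h(2) l'(3) nat_pow_Suc xx(3) sx
        using xx(1,2) fc hc x st_carrier(2) by algebra
      finally show ?thesis using h(1) vdvdI by blast
    qed
    thus ?thesis using wV[OF V'sub] by blast
  qed
  ultimately show ?thesis using w(1) by blast
qed

text \<open>
  If \<open>V\<close> is not centred on the generic point of the exceptional curve, the monic part of an element of the
  centre outside \<open>T\<close> is again in the centre, and there is one of least degree.
\<close>
lemma center_cases:
  assumes V: "dominates V D m" and xV: "x \<in> V"
  shows "Rx \<inter> nonunits V \<subseteq> T \<or> (\<exists>p r. chart_point R D s t x (Rx \<inter> nonunits V) p r)"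
proof (cases "Rx \<inter> nonunits V \<subseteq> T")
  case False
  let ?Q = "Rx \<inter> nonunits V"
  note Vval = dominatesD(1)[OF V] and Vsub = dominatesD(2)[OF V]
  note nid = nonunits_subideal[OF Vval]
  have RV: "z \<in> V" if "z \<in> Rx" for z using polyring_in_V[OF V xV that] .
  have ideal: "subideal Rx ?Q" unfolding subideal_def
  proof (intro conjI ballI)
    show "\<zero> \<in> ?Q" using Rcl(2) subidealD(2)[OF nid] by blast
    show "a \<oplus> b \<in> ?Q" if "a \<in> ?Q" "b \<in> ?Q" for a b using that Rcl(5) subidealD(3)[OF nid] by blast
    show "c \<otimes> a \<in> ?Q" if "c \<in> Rx" "a \<in> ?Q" for a c
      using Rcl(7)[OF that(1), of a] subidealD(4)[OF nid RV[OF that(1)], of a] that(2) by simp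
  qed blast
  have TQ: "T \<subseteq> ?Q"
  proof
    fix a assume a: "a \<in> T"
    then obtain b where "b \<in> Rx" "a = t \<otimes> b" unfolding T_iff by blast
    thus "a \<in> ?Q" using t_mult_nonunit[OF V RV] subidealD(1)[OF T_ideal a] by simp
  qed
  obtain a where a: "a \<in> ?Q" "a \<notin> T" using False by blast
  obtain d c c' g b where l: "c \<in> D" "c' \<in> D" "c \<otimes> c' = \<one>" "monic x D d g" "b \<in> Rx" "a = c \<otimes> g \<oplus> t \<otimes> b"
    using leadR a by blast
  have "a \<ominus> t \<otimes> b \<in> ?Q" using subideal_minus[OF Rsub ideal a(1)] TQ l(5) T_iff by blast
  moreover have "a \<ominus> t \<otimes> b = c \<otimes> g" unfolding l(6)
    using Dcl(1)[OF l(1)] monicD(3)[OF sub x l(4)] Rcl(1)[OF l(5)] st_carrier by algebra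
  ultimately have "c' \<otimes> (c \<otimes> g) \<in> ?Q" using subidealD(4)[OF ideal RD[OF l(2)]] by metis
  moreover have "c' \<otimes> (c \<otimes> g) = (c \<otimes> c') \<otimes> g"
    using Dcl(1)[OF l(1)] Dcl(1)[OF l(2)] monicD(3)[OF sub x l(4)] by algebra
  ultimately have gQ: "g \<in> ?Q" using l(3) monicD(3)[OF sub x l(4)] by simp
  define r where "r = (LEAST n. \<exists>g. monic x D n g \<and> g \<in> ?Q)"
  have "\<exists>n g. monic x D n g \<and> g \<in> ?Q" using gQ l(4) by blast
  hence "\<exists>g. monic x D r g \<and> g \<in> ?Q" unfolding r_def by (rule LeastI_ex)
  then obtain p where p: "monic x D r p" "p \<in> ?Q" by blast
  have "chart_point R D s t x ?Q p r"
  proof (intro chart_point.intro chart_axioms chart_point_axioms.intro)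
    show "subideal Rx ?Q" by (rule ideal)
    show "\<one> \<notin> ?Q" using nonunits_one[OF Vsub] by blast
    show "T \<subseteq> ?Q" by (rule TQ)
    show "a \<in> ?Q \<or> b \<in> ?Q" if "a \<in> Rx" "b \<in> Rx" "a \<otimes> b \<in> ?Q" for a b
      using that unit_mult(2)[OF Vsub RV[OF that(1)] _ RV[OF that(2)]] by blast
    show "monic x D r p" "p \<in> ?Q" using p by auto
    show "r \<le> n" if "monic x D n g" "g \<in> ?Q" for n g
      unfolding r_def using that by (intro Least_le) blast
  qed
  thus ?thesis by blast
qed blast

end

section \<open>One pole for finitely many poles\<close>

context field
begin

text \<open>
  In terms of poles: \<open>w\<close> has one at \<open>V\<close>, and only where \<open>y\<close> and \<open>z\<close> both have one.
\<close>
definition common_pole :: "'a set \<Rightarrow> 'a set \<Rightarrow> 'a set \<Rightarrow> 'a \<Rightarrow> 'a \<Rightarrow> bool" where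
  "common_pole V D I y z \<longleftrightarrow> (\<exists>w\<in>carrier R. w \<notin> V \<and> (\<forall>V'. dominates V' D I \<longrightarrow> y \<in> V' \<or> z \<in> V' \<longrightarrow> w \<in> V'))"

text \<open>
  The induction measure: the length of \<open>D / (F, G)\<close> for some representation \<open>y = G / F\<close>.
\<close>
definition frac_len :: "'a set \<Rightarrow> 'a \<Rightarrow> nat \<Rightarrow> bool" where
  "frac_len D y n \<longleftrightarrow> (\<exists>F\<in>D. \<exists>G\<in>D. F \<noteq> \<zero> \<and> y \<otimes> F = G \<and> len_le D (gen2 D F G) n)"

end

context regular_pair
begin

text \<open>
  Length \<open>0\<close> means that \<open>F\<close> or \<open>G\<close> is a unit of \<open>D\<close>. As \<open>y \<notin> V\<close>, it is \<open>G\<close>, and \<open>1 / y\<close> lies in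
  the maximal ideal of \<open>D\<close>.
\<close>
lemma frac_len_zero:
  assumes len: "frac_len D y 0" and y: "y \<in> carrier R" and V: "dominates V D m" "y \<notin> V" and V': "dominates V' D m"
  shows "y \<notin> V'"
proof -
  obtain F G where 1: "F \<in> D" "G \<in> D" "F \<noteq> \<zero>" "y \<otimes> F = G" "len_le D (gen2 D F G) 0" using len unfolding frac_len_def by blast
  note Vsub = dominatesD(2)[OF V(1)] and V'sub = dominatesD(2)[OF V']
  note cl = Dcl(1)[OF 1(1)] Dcl(1)[OF 1(2)]
  have top: "gen2 D F G = D" using len_le_zero[OF sub gen2_subideal[OF sub 1(1,2)] 1(5)] .
  have Fm: "F \<in> m"
  proof (rule ccontr)
    assume "F \<notin> m"
    then obtain f where f: "f \<in> D" "F \<otimes> f = \<one>" using loc 1(1) by blast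
    have "y = y \<otimes> (F \<otimes> f)" using f(2) y by simp
    also have "\<dots> = G \<otimes> f" unfolding 1(4)[symmetric] using y cl Dcl(1)[OF f(1)] by (simp add: m_assoc)
    finally have "y \<in> D" using Dcl(7)[OF 1(2) f(1)] by simp
    thus False using V dominatesD(3) by blast
  qed
  have "G \<notin> m"
  proof
    assume "G \<in> m"
    hence "D \<subseteq> m" using gen2_least[OF m_ideal sub Fm] top by metis
    thus False using proper Dcl(3) by blast
  qed
  then obtain g where g: "g \<in> D" "G \<otimes> g = \<one>" using loc 1(2) by blast
  have "(F \<otimes> g) \<otimes> y = (y \<otimes> F) \<otimes> g" using y cl Dcl(1)[OF g(1)] by algebra
  hence e: "(F \<otimes> g) \<otimes> y = \<one>" unfolding 1(4) g(2) .
  have "F \<otimes> g \<in> nonunits V'" using dominatesD(4)[OF V' subideal_r[OF sub m_ideal g(1) Fm]] .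
  thus ?thesis using nonunitsD(2) e unfolding vdvd_one by blast
qed

end

text \<open>
  Induction on the sum of the two lengths. Interchanging \<open>s\<close> and \<open>t\<close> if necessary, \<open>s / t\<close> lies in \<open>V\<close>.
\<close>
lemma (in field) common_pole_induct:
  assumes "regular_pair R D s t" "dominates V D (gen2 D s t)"
    "frac_len D y k" "frac_len D z l" "k + l = n" "y \<in> carrier R" "z \<in> carrier R" "y \<notin> V" "z \<notin> V"
  shows "common_pole V D (gen2 D s t) y z"
  using assms
proof (induct n arbitrary: D s t k l rule: less_induct)
  case (less n D s t k l)
  have step: "common_pole V D (gen2 D s t) y z"
    if ch: "chart R D s t x" and xV: "x \<in> V" and V: "dominates V D (gen2 D s t)" and n: "0 < k + l" for s t x
  proof -
    interpret chart R D s t x by (rule ch)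
    show ?thesis
    proof (cases "Rx \<inter> nonunits V \<subseteq> T")
      case True
      show ?thesis unfolding common_pole_def
        using generic_step[OF V xV True less(7,9,8,10)] .
    next
      case False
      then obtain p r where cp: "chart_point R D s t x (Rx \<inter> nonunits V) p r" using center_cases[OF V xV] by blast
      interpret cp: chart_point R D s t x "Rx \<inter> nonunits V" p r by (rule cp)
      have V1: "dominates V cp.D1 (gen2 cp.D1 p t)" using cp.dominates_blowup[OF V xV] cp.p_Q by blast
      have len: "\<exists>k'\<le>k. frac_len cp.D1 y k' \<and> (k' < k \<or> k' = 0)" if "frac_len D y k" "y \<in> carrier R" for y k
      proof -
        obtain F G where 1: "F \<in> D" "G \<in> D" "F \<noteq> \<zero>" "y \<otimes> F = G" "len_le D (gen2 D F G) k"
          using \<open>frac_len D y k\<close> unfolding frac_len_def by blast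
        have "frac_len cp.D1 y (k - (if \<one> \<in> gen2 D F G then 0 else 1))"
          using cp.rep_transform[OF 1(1,3,2,5) that(2) 1(4)] unfolding frac_len_def by blast
        moreover have "frac_len cp.D1 y 0" if "\<one> \<in> gen2 D F G"
        proof -
          have "gen2 D F G = D" using subideal_one[OF sub gen2_subideal[OF sub 1(1,2)] that] .
          hence "len_le D (gen2 D F G) 0" using len_le_top[OF sub] by simp
          thus ?thesis using cp.rep_transform[OF 1(1,3,2) _ \<open>y \<in> carrier R\<close> 1(4)] that unfolding frac_len_def by fastforce
        qed
        ultimately show ?thesis by (cases "\<one> \<in> gen2 D F G"; cases k) (auto intro: exI[of _ 0] exI[of _ "k - 1"])
      qed
      obtain k' where k': "k' \<le> k" "frac_len cp.D1 y k'" "k' < k \<or> k' = 0" using len[OF less(4,7)] by blast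
      obtain l' where l': "l' \<le> l" "frac_len cp.D1 z l'" "l' < l \<or> l' = 0" using len[OF less(5,8)] by blast
      have "k' + l' < n" using k' l' n less(6) by auto
      hence "common_pole V cp.D1 (gen2 cp.D1 p t) y z"
        using less(1)[OF _ cp.D1_regular_pair V1 k'(2) l'(2) refl less(7-10)] by blast
      then obtain w1 where w1: "w1 \<in> carrier R" "w1 \<notin> V" "\<And>V'. dominates V' cp.D1 (gen2 cp.D1 p t) \<Longrightarrow> y \<in> V' \<or> z \<in> V' \<Longrightarrow> w1 \<in> V'"
        unfolding common_pole_def by blast
      obtain w where "w \<in> carrier R" "w \<notin> V"
        "\<And>V'. dominates V' D m \<Longrightarrow> \<not> dominates V' cp.D1 (gen2 cp.D1 p t) \<or> w1 \<in> V' \<Longrightarrow> w \<in> V'"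
        using cp.blowup_step[OF V xV refl w1(1,2)] by blast
      thus ?thesis unfolding common_pole_def using w1(3) by blast
    qed
  qed
  interpret regular_pair R D s t by (rule less(2))
  show ?case
  proof (cases "k + l = 0")
    case True
    hence "frac_len D y 0" "frac_len D z 0" using less(4,5) by auto
    hence "\<not> (y \<in> V' \<or> z \<in> V')" if "dominates V' D m" for V'
      using frac_len_zero[OF _ less(7,3,9) that] frac_len_zero[OF _ less(8,3,10) that] by blast
    thus ?thesis unfolding common_pole_def using less(7,9) by blast
  next
    case False
    have "vdvd V t s \<or> vdvd V s t" using vdvd_total[OF dominatesD(1)[OF less(3)]] st_carrier by blast
    thus ?thesis
    proof
      assume "vdvd V t s"
      then obtain x where "x \<in> V" "s = t \<otimes> x" unfolding vdvd_def by blast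
      moreover have "x \<in> carrier R" using \<open>x \<in> V\<close> subring_closed(1)[OF dominatesD(2)[OF less(3)]] by blast
      ultimately have "chart R D s t x" "x \<in> V"
        using chart.intro[OF regular_pair_axioms chart_axioms.intro] by blast+
      thus ?thesis using step less(3) False by blast
    next
      assume "vdvd V s t"
      then obtain x where "x \<in> V" "t = s \<otimes> x" unfolding vdvd_def by blast
      moreover have "x \<in> carrier R" using \<open>x \<in> V\<close> subring_closed(1)[OF dominatesD(2)[OF less(3)]] by blast
      ultimately have "chart R D t s x" "x \<in> V"
        using chart.intro[OF swap chart_axioms.intro] by blast+
      hence "common_pole V D (gen2 D t s) y z" using step less(3) False gen2_comm[OF sub sD tD] by simp
      thus ?thesis using gen2_comm[OF sub sD tD] by simp
    qed
  qed
qed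

context regular_pair
begin

lemma common_pole_finite:
  assumes V: "dominates V D m" and S: "finite S" "S \<subseteq> carrier R" "S \<inter> V = {}"
  shows "\<exists>w\<in>carrier R. w \<notin> V \<and> (\<forall>V'. dominates V' D m \<longrightarrow> V' \<inter> S \<noteq> {} \<longrightarrow> w \<in> V')"
  using S
proof (induct S)
  case empty
  have "inv s \<notin> V"
  proof
    assume "inv s \<in> V"
    hence "vdvd V s \<one>" using inv_facts[OF st_carrier(1) s_nz] vdvd_one by blast
    thus False using dominatesD(4)[OF V st_m(1)] nonunitsD(2) by blast
  qed
  thus ?case using inv_facts[OF st_carrier(1) s_nz] by blast
next
  case (insert y S)
  then obtain z where z: "z \<in> carrier R" "z \<notin> V" "\<And>V'. dominates V' D m \<Longrightarrow> V' \<inter> S \<noteq> {} \<Longrightarrow> z \<in> V'" by blast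
  have y: "y \<in> carrier R" "y \<notin> V" using insert by auto
  have fl: "\<exists>n. frac_len D y n" if y: "y \<in> carrier R" "y \<notin> V" for y
  proof -
    have "y \<noteq> \<zero>" using y subring_closed(2)[OF dominatesD(2)[OF V]] by blast
    then obtain F G n where "F \<in> D" "G \<in> D" "F \<noteq> \<zero>" "y \<otimes> F = G" "len_le D (gen2 D F G) n"
      using rep[OF y(1)] by blast
    hence "frac_len D y n" unfolding frac_len_def by blast
    thus ?thesis by blast
  qed
  obtain k l where "frac_len D y k" "frac_len D z l" using fl[OF y] fl[OF z(1,2)] by blast
  hence "common_pole V D m y z" using common_pole_induct[OF regular_pair_axioms V _ _ refl y(1) z(1) y(2) z(2)] by simp
  thus ?case unfolding common_pole_def using z(3) by blast
qed

end

section \<open>Parameters of a two-dimensional regular local ring\<close>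

text \<open>
  The ascending chain condition for a local ring with two parameters. Dimension two enters below
  through a prime ideal between \<open>0\<close> and the maximal ideal; it makes \<open>s, t\<close> a regular sequence.
\<close>
locale noetherian_pair = local_pair +
  assumes acc: "(\<And>n::nat. subideal D (I n)) \<Longrightarrow> (\<And>n. I n \<subseteq> I (Suc n)) \<Longrightarrow> \<exists>n. I (Suc n) = I n"
begin

lemma swap: "noetherian_pair R D t s"
  by (intro noetherian_pair.intro[OF local_pair_swap] noetherian_pair_axioms.intro acc)

lemma acc_induct:
  assumes step: "\<And>I. subideal D I \<Longrightarrow> (\<And>J. subideal D J \<Longrightarrow> I \<subset> J \<Longrightarrow> Pr J) \<Longrightarrow> Pr I" and I: "subideal D I"
  shows "Pr I"
proof (rule ccontr)
  assume nI: "\<not> Pr I"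
  have ex: "\<exists>J'. (subideal D J' \<and> \<not> Pr J') \<and> J \<subset> J'" if "subideal D J \<and> \<not> Pr J" for J
    using step that by blast
  obtain f where f: "\<And>n. subideal D (f n) \<and> \<not> Pr (f n)" "\<And>n. f n \<subset> f (Suc n)"
    using dependent_nat_choice[of "\<lambda>_ J. subideal D J \<and> \<not> Pr J" "\<lambda>_ J J'. J \<subset> J'"] I nI ex by metis
  have "\<exists>n. f (Suc n) = f n" using f by (intro acc) auto
  thus False using f(2) by (metis less_irrefl)
qed

text \<open>
  A substitute for both Nakayama's lemma and Krull's intersection theorem. Writing
  \<open>b = k + \<tau> b1\<close>, \<open>b1 = k' + \<tau> b2\<close> and so on gives ascending ideals \<open>K + b D \<subseteq> K + b1 D \<subseteq> \<dots>\<close>. When two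
  agree, \<open>(1 - \<tau> c) * b' \<in> K\<close> for the last \<open>b'\<close>, so \<open>b'\<close> and all earlier elements are in \<open>K\<close>. In
  \<open>expansion_cases\<close> the set \<open>J\<close> is not an ideal.
\<close>
lemma krull_trick:
  assumes K: "subideal D K" and J: "J \<subseteq> D" and \<tau>: "\<tau> \<in> m"
    and step: "\<And>b. b \<in> J \<Longrightarrow> \<exists>k\<in>K. \<exists>b'\<in>J. b = k \<oplus> \<tau> \<otimes> b'"
  shows "J \<subseteq> K"
proof
  fix b assume b: "b \<in> J"
  have Kc: "k \<in> carrier R" if "k \<in> K" for k using subidealD(1)[OF K that] Dcl(1) by blast
  have \<tau>D: "\<tau> \<in> D" using subidealD(1)[OF m_ideal \<tau>] .
  have ex: "\<exists>c'. c' \<in> J \<and> (\<exists>k\<in>K. c = k \<oplus> \<tau> \<otimes> c')" if "c \<in> J" for c using step[OF that] by blast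
  have start: "\<exists>c. c \<in> J \<and> (0 = (0::nat) \<longrightarrow> c = b)" using b by blast
  have "\<exists>f. \<forall>n. (f n \<in> J \<and> (n = (0::nat) \<longrightarrow> f n = b)) \<and> (\<exists>k\<in>K. f n = k \<oplus> \<tau> \<otimes> f (Suc n))"
    by (rule dependent_nat_choice) (use b ex in auto)
  then obtain f where f: "\<And>n. f n \<in> J" "f 0 = b" "\<And>n. \<exists>k\<in>K. f n = k \<oplus> \<tau> \<otimes> f (Suc n)" by blast
  have fD: "f n \<in> D" for n using f(1) J by blast
  define I where "I n = {k \<oplus> f n \<otimes> c | k c. k \<in> K \<and> c \<in> D}" for n
  have Iid: "subideal D (I n)" for n unfolding I_def by (rule subideal_extend[OF sub K fD])
  have IK: "K \<subseteq> I n" for n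
  proof
    fix k assume k: "k \<in> K"
    have "k = k \<oplus> f n \<otimes> \<zero>" using Kc[OF k] Dcl(1)[OF fD] by simp
    thus "k \<in> I n" unfolding I_def using k Dcl(2) by blast
  qed
  have fI: "f n \<in> I n" for n
  proof -
    have "f n = \<zero> \<oplus> f n \<otimes> \<one>" using Dcl(1)[OF fD] by simp
    thus ?thesis unfolding I_def using subidealD(2)[OF K] Dcl(3) by blast
  qed
  have sI: "f n \<in> I (Suc n)" for n
  proof -
    obtain k where k: "k \<in> K" "f n = k \<oplus> \<tau> \<otimes> f (Suc n)" using f(3) by blast
    have "\<tau> \<otimes> f (Suc n) \<in> I (Suc n)" using subidealD(4)[OF Iid \<tau>D fI] .
    thus ?thesis using k subidealD(3)[OF Iid] IK by (metis subsetD)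
  qed
  have "I n \<subseteq> I (Suc n)" for n
  proof
    fix z assume "z \<in> I n"
    then obtain k c where z: "k \<in> K" "c \<in> D" "z = k \<oplus> f n \<otimes> c" unfolding I_def by blast
    show "z \<in> I (Suc n)" unfolding z(3)
      using subidealD(3)[OF Iid subsetD[OF IK z(1)] subideal_r[OF sub Iid z(2) sI]] .
  qed
  then obtain n where n: "I (Suc n) = I n" using acc[of I] Iid by blast
  then obtain k c where kc: "k \<in> K" "c \<in> D" "f (Suc n) = k \<oplus> f n \<otimes> c" using fI[of "Suc n"] unfolding I_def by blast
  obtain k' where k': "k' \<in> K" "f n = k' \<oplus> \<tau> \<otimes> f (Suc n)" using f(3) by blast
  have cr: "k \<in> carrier R" "k' \<in> carrier R" "c \<in> carrier R" "\<tau> \<in> carrier R" "f n \<in> carrier R" "f (Suc n) \<in> carrier R"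
    using Kc kc k' Dcl(1) \<tau>D fD by auto
  have e: "k \<oplus> k' \<otimes> c \<in> K" using subidealD(3)[OF K kc(1) subideal_r[OF sub K kc(2) k'(1)]] .
  obtain v where v: "v \<in> D" "(\<one> \<ominus> \<tau> \<otimes> c) \<otimes> v = \<one>" using one_minus_unit[OF subideal_r[OF sub m_ideal kc(2) \<tau>]] by blast
  have "f (Suc n) \<otimes> (\<one> \<ominus> \<tau> \<otimes> c) = f (Suc n) \<ominus> (\<tau> \<otimes> f (Suc n)) \<otimes> c" using cr by (simp add: a_minus_def r_distr r_minus m_ac)
  also have "\<dots> = (k \<oplus> f n \<otimes> c) \<ominus> (\<tau> \<otimes> f (Suc n)) \<otimes> c" using kc(3) by simp
  also have "\<dots> = (k \<oplus> (k' \<oplus> \<tau> \<otimes> f (Suc n)) \<otimes> c) \<ominus> (\<tau> \<otimes> f (Suc n)) \<otimes> c" using k'(2) by simp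
  also have "\<dots> = k \<oplus> k' \<otimes> c" using cr by algebra
  finally have e2: "f (Suc n) \<otimes> (\<one> \<ominus> \<tau> \<otimes> c) = k \<oplus> k' \<otimes> c" .
  have "f (Suc n) = f (Suc n) \<otimes> ((\<one> \<ominus> \<tau> \<otimes> c) \<otimes> v)" unfolding v(2) using cr by simp
  also have "\<dots> = (k \<oplus> k' \<otimes> c) \<otimes> v" unfolding e2[symmetric] using cr Dcl(1)[OF v(1)] by (simp add: m_assoc)
  also have "\<dots> \<in> K" using subideal_r[OF sub K v(1) e] .
  finally have last: "f (Suc n) \<in> K" .
  have "f j \<in> K \<Longrightarrow> f 0 \<in> K" for j
  proof (induct j)
    case (Suc j)
    obtain k where "k \<in> K" "f j = k \<oplus> \<tau> \<otimes> f (Suc j)" using f(3) by blast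
    hence "f j \<in> K" using subidealD(3,4)[OF K] \<tau>D Suc(2) by simp
    thus ?case using Suc(1) by blast
  qed
  thus "b \<in> K" using last f(2) by blast
qed

lemma principal_ideal: 
  assumes "b \<in> D" shows "subideal D {b \<otimes> c | c. c \<in> D}"
proof -
  have "subideal D {i \<oplus> b \<otimes> c | i c. i \<in> {\<zero>} \<and> c \<in> D}"
  proof (rule subideal_extend[OF sub _ assms])
    show "subideal D {\<zero>}" unfolding subideal_def using Dcl(1,2) by auto
  qed
  moreover have "\<zero> \<oplus> b \<otimes> c = b \<otimes> c" if "c \<in> D" for c using Dcl(1)[OF that] Dcl(1)[OF assms] by simp
  hence "{i \<oplus> b \<otimes> c | i c. i \<in> {\<zero>} \<and> c \<in> D} = {b \<otimes> c | c. c \<in> D}" by force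
  ultimately show ?thesis by simp
qed

lemma zero_ideal: "subideal D {\<zero>}"
  unfolding subideal_def using Dcl(1,2) by auto

text \<open>
  Modulo \<open>t\<close> the element \<open>b\<close> is a unit times \<open>s ^ j\<close>. If \<open>D / t D\<close> is a discrete valuation ring, \<open>j\<close> is the
  value of \<open>b\<close> there.
\<close>
definition expansion :: "'a \<Rightarrow> nat \<Rightarrow> bool" where
  "expansion b j \<longleftrightarrow> (\<exists>u\<in>D. \<exists>v\<in>D. \<exists>c\<in>D. u \<otimes> v = \<one> \<and> b = s [^] j \<otimes> u \<oplus> t \<otimes> c)"

text \<open>
  The maximal ideal of \<open>D / t D\<close> is generated by \<open>s\<close>, so an element without expansion is divisible by \<open>s\<close> arbitrarily
  often modulo \<open>t\<close>; by \<open>krull_trick\<close> it is \<open>0\<close> there.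
\<close>
lemma expansion_cases:
  assumes b: "b \<in> D" shows "(\<exists>c\<in>D. b = t \<otimes> c) \<or> (\<exists>j. expansion b j)"
proof -
  define J where "J = {b \<in> D. \<not> (\<exists>j. expansion b j)}"
  have "J \<subseteq> {t \<otimes> c | c. c \<in> D}"
  proof (rule krull_trick[OF principal_ideal[OF tD] _ st_m(1)])
    show "J \<subseteq> D" unfolding J_def by blast
    fix b assume "b \<in> J"
    hence bD: "b \<in> D" and nb: "\<And>j. \<not> expansion b j" unfolding J_def by auto
    have "b \<in> m"
    proof (rule ccontr)
      assume "b \<notin> m"
      then obtain v where "v \<in> D" "b \<otimes> v = \<one>" using loc bD by blast
      moreover have "b = s [^] (0::nat) \<otimes> b \<oplus> t \<otimes> \<zero>" using Dcl(1)[OF bD] st_carrier by simp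
      ultimately have "expansion b 0" unfolding expansion_def using bD Dcl(2) by blast
      thus False using nb by blast
    qed
    then obtain b' c where 1: "b' \<in> D" "c \<in> D" "b = s \<otimes> b' \<oplus> t \<otimes> c" unfolding gen2_def by blast
    have "b' \<in> J"
    proof (rule ccontr)
      assume "b' \<notin> J"
      then obtain j u v c' where 2: "u \<in> D" "v \<in> D" "c' \<in> D" "u \<otimes> v = \<one>" "b' = s [^] (j::nat) \<otimes> u \<oplus> t \<otimes> c'"
        unfolding J_def expansion_def using 1(1) by blast
      have "b = s [^] Suc j \<otimes> u \<oplus> t \<otimes> (s \<otimes> c' \<oplus> c)" unfolding 1(3) 2(5) nat_pow_Suc
        using Dcl(1)[OF 1(2)] Dcl(1)[OF 2(1)] Dcl(1)[OF 2(3)] st_carrier nat_pow_closed[OF st_carrier(1), of j] by algebra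
      moreover have "s \<otimes> c' \<oplus> c \<in> D" using Dcl(5,7) sD 2(3) 1(2) by blast
      ultimately have "expansion b (Suc j)" unfolding expansion_def using 2(1,2,4) by blast
      thus False using nb by blast
    qed
    moreover have "b = t \<otimes> c \<oplus> s \<otimes> b'" unfolding 1(3) using Dcl(1)[OF 1(1)] Dcl(1)[OF 1(2)] st_carrier by algebra
    ultimately show "\<exists>k\<in>{t \<otimes> c | c. c \<in> D}. \<exists>b'\<in>J. b = k \<oplus> s \<otimes> b'" using 1(2) by blast
  qed
  thus ?thesis using b unfolding J_def by blast
qed

text \<open>
  An ideal \<open>J\<close> with \<open>J \<inter> t D = t J\<close> is generated modulo \<open>t J\<close> by an element \<open>b\<close> with the least exponent in
  its expansion, hence generated by \<open>b\<close>. This applies to prime ideals not containing \<open>t\<close>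
  and to the saturations \<open>I : t ^ \<infinity>\<close>; it is the part of unique factorization that the proof uses.
\<close>
lemma saturated_principal:
  assumes J: "subideal D J" and nz: "\<exists>b\<in>J. b \<noteq> \<zero>" and sat: "\<And>b. b \<in> D \<Longrightarrow> t \<otimes> b \<in> J \<Longrightarrow> b \<in> J"
  shows "\<exists>b\<in>J. J = {b \<otimes> c | c. c \<in> D}"
proof -
  have JD: "b \<in> D" if "b \<in> J" for b using subidealD(1)[OF J that] .
  have "\<exists>j. \<exists>b\<in>J. expansion b j"
  proof (rule ccontr)
    assume none: "\<not> ?thesis"
    have "J \<subseteq> {\<zero>}"
    proof (rule krull_trick[OF zero_ideal _ st_m(2)])
      show "J \<subseteq> D" using JD by blast
      fix b assume b: "b \<in> J"
      then obtain c where c: "c \<in> D" "b = t \<otimes> c" using expansion_cases[OF JD] none by blast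
      have "c \<in> J" using sat c b by blast
      moreover have "b = \<zero> \<oplus> t \<otimes> c" using c Dcl(1) st_carrier by simp
      ultimately show "\<exists>k\<in>{\<zero>}. \<exists>b'\<in>J. b = k \<oplus> t \<otimes> b'" by blast
    qed
    thus False using nz by blast
  qed
  define j where "j = (LEAST j. \<exists>b\<in>J. expansion b j)"
  have "\<exists>b\<in>J. expansion b j" unfolding j_def using \<open>\<exists>j. \<exists>b\<in>J. expansion b j\<close> by (rule LeastI_ex)
  then obtain b where b: "b \<in> J" "expansion b j" by blast
  have min: "j \<le> i" if "a \<in> J" "expansion a i" for a i unfolding j_def using that by (intro Least_le) blast
  obtain u v c where e: "u \<in> D" "v \<in> D" "c \<in> D" "u \<otimes> v = \<one>" "b = s [^] j \<otimes> u \<oplus> t \<otimes> c" using b(2) unfolding expansion_def by blast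
  have "J \<subseteq> {b \<otimes> c | c. c \<in> D}"
  proof (rule krull_trick[OF principal_ideal[OF JD[OF b(1)]] _ st_m(2)])
    show "J \<subseteq> D" using JD by blast
    fix a assume a: "a \<in> J"
    show "\<exists>k\<in>{b \<otimes> c | c. c \<in> D}. \<exists>a'\<in>J. a = k \<oplus> t \<otimes> a'"
    proof (cases "\<exists>i. expansion a i")
      case False
      then obtain c where c: "c \<in> D" "a = t \<otimes> c" using expansion_cases[OF JD[OF a]] by blast
      have "c \<in> J" using sat c a by blast
      moreover have "a = b \<otimes> \<zero> \<oplus> t \<otimes> c" using c Dcl(1)[OF JD[OF b(1)]] Dcl(1)[OF c(1)] st_carrier by simp
      ultimately show ?thesis using Dcl(2) by blast
    next
      case True
      then obtain i where i: "expansion a i" by blast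
      then obtain u' v' c' where f: "u' \<in> D" "v' \<in> D" "c' \<in> D" "u' \<otimes> v' = \<one>" "a = s [^] i \<otimes> u' \<oplus> t \<otimes> c'" unfolding expansion_def by blast
      define k where "k = i - j"
      have ik: "i = j + k" using min[OF a i] unfolding k_def by simp
      have sk: "s [^] k \<in> D" "s [^] k \<in> carrier R" "s [^] j \<in> carrier R" using subring_pow[OF sub sD] st_carrier by auto
      define d where "d = v \<otimes> u' \<otimes> s [^] k"
      have dD: "d \<in> D" unfolding d_def using Dcl(7) e f sk by blast
      define a' where "a' = c' \<ominus> c \<otimes> d"
      have a'D: "a' \<in> D" unfolding a'_def using Dcl(6,7) f(3) e(3) dD by blast
      have cr: "u \<in> carrier R" "v \<in> carrier R" "c \<in> carrier R" "u' \<in> carrier R" "c' \<in> carrier R" "b \<in> carrier R" "a' \<in> carrier R" "d \<in> carrier R"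
        using e f Dcl(1) JD[OF b(1)] a'D dD by auto
      have "b \<otimes> d \<oplus> t \<otimes> a' = (u \<otimes> v) \<otimes> (s [^] j \<otimes> s [^] k \<otimes> u') \<oplus> t \<otimes> c'"
        unfolding e(5) a'_def d_def using cr(1-5) sk(2,3) st_carrier by algebra
      also have "\<dots> = a" unfolding e(4) f(5) ik using cr sk st_carrier by (simp add: nat_pow_mult)
      finally have ea: "a = b \<otimes> d \<oplus> t \<otimes> a'" by simp
      have "t \<otimes> a' = a \<ominus> b \<otimes> d" unfolding ea using cr st_carrier by algebra
      hence "t \<otimes> a' \<in> J" using subideal_minus[OF sub J a subideal_r[OF sub J dD b(1)]] by simp
      hence "a' \<in> J" using sat a'D by blast
      thus ?thesis using ea dD by blast
    qed
  qed
  moreover have "{b \<otimes> c | c. c \<in> D} \<subseteq> J" using subideal_r[OF sub J _ b(1)] by blast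
  ultimately show ?thesis using b(1) by blast
qed

text \<open>
  The saturation of \<open>(F, G)\<close> with respect to \<open>t\<close> is generated by a common factor \<open>b\<close> of \<open>F\<close> and \<open>G\<close>; after
  division by \<open>b\<close> the ideal contains a power of \<open>t\<close>.
\<close>
lemma common_factor:
  assumes F: "F \<in> D" "F \<noteq> \<zero>" and G: "G \<in> D" and t0: "t \<noteq> \<zero>"
  shows "\<exists>b\<in>D. \<exists>F'\<in>D. \<exists>G'\<in>D. \<exists>n. F = b \<otimes> F' \<and> G = b \<otimes> G' \<and> t [^] (n::nat) \<in> gen2 D F' G'"
proof -
  let ?I = "gen2 D F G"
  have I: "subideal D ?I" by (rule gen2_subideal[OF sub F(1) G])
  have tn: "t [^] (n::nat) \<in> D" "t [^] n \<in> carrier R" for n using subring_pow[OF sub tD] st_carrier by auto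
  define J where "J = {b \<in> D. \<exists>n::nat. t [^] n \<otimes> b \<in> ?I}"
  have IJ: "i \<in> J" if "i \<in> ?I" for i
  proof -
    have "t [^] (0::nat) \<otimes> i = i" using subidealD(1)[OF I that] Dcl(1) by simp
    thus ?thesis unfolding J_def using that subidealD(1)[OF I that] by (metis (mono_tags, lifting) mem_Collect_eq)
  qed
  have J: "subideal D J" unfolding subideal_def
  proof (intro conjI ballI)
    show "J \<subseteq> D" unfolding J_def by blast
    show "\<zero> \<in> J" using IJ subidealD(2)[OF I] .
    fix a assume "a \<in> J"
    then obtain n where a: "a \<in> D" "t [^] (n::nat) \<otimes> a \<in> ?I" unfolding J_def by blast
    show "a \<oplus> b \<in> J" if bJ: "b \<in> J" for b
    proof -
      obtain k where b: "b \<in> D" "t [^] (k::nat) \<otimes> b \<in> ?I" using bJ unfolding J_def by blast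
      have "t [^] (n + k) \<otimes> (a \<oplus> b) = t [^] k \<otimes> (t [^] n \<otimes> a) \<oplus> t [^] n \<otimes> (t [^] k \<otimes> b)"
        using tn(2)[of n] tn(2)[of k] Dcl(1)[OF a(1)] Dcl(1)[OF b(1)]
        by (simp add: nat_pow_mult[OF st_carrier(2), symmetric] r_distr m_ac)
      also have "\<dots> \<in> ?I" using subidealD(3)[OF I subidealD(4)[OF I tn(1) a(2)] subidealD(4)[OF I tn(1) b(2)]] .
      finally show ?thesis unfolding J_def using Dcl(5)[OF a(1) b(1)] by blast
    qed
    show "c \<otimes> a \<in> J" if c: "c \<in> D" for c
    proof -
      have "t [^] n \<otimes> (c \<otimes> a) = c \<otimes> (t [^] n \<otimes> a)" using tn(2)[of n] Dcl(1)[OF a(1)] Dcl(1)[OF c] by algebra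
      hence "t [^] n \<otimes> (c \<otimes> a) \<in> ?I" using subidealD(4)[OF I c a(2)] by simp
      thus ?thesis unfolding J_def using Dcl(7)[OF c a(1)] by blast
    qed
  qed
  have FJ: "F \<in> J" "G \<in> J" using IJ gen2_in[OF sub F(1) G] by auto
  have "\<exists>b\<in>J. J = {b \<otimes> c | c. c \<in> D}"
  proof (rule saturated_principal[OF J])
    show "\<exists>b\<in>J. b \<noteq> \<zero>" using FJ F by blast
    show "b \<in> J" if b: "b \<in> D" "t \<otimes> b \<in> J" for b
    proof -
      obtain n where n: "t [^] (n::nat) \<otimes> (t \<otimes> b) \<in> ?I" using b(2) unfolding J_def by blast
      have "t [^] Suc n \<otimes> b = t [^] n \<otimes> (t \<otimes> b)" using tn(2)[of n] st_carrier Dcl(1)[OF b(1)] by (simp add: m_assoc)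
      thus ?thesis unfolding J_def using n b(1) by (metis (mono_tags, lifting) mem_Collect_eq)
    qed
  qed
  then obtain b where b: "b \<in> J" "J = {b \<otimes> c | c. c \<in> D}" by blast
  obtain F' G' where FG: "F' \<in> D" "G' \<in> D" "F = b \<otimes> F'" "G = b \<otimes> G'" using FJ b(2) by blast
  have bD: "b \<in> D" using subidealD(1)[OF J b(1)] .
  obtain n where "t [^] (n::nat) \<otimes> b \<in> ?I" using b(1) unfolding J_def by blast
  then obtain u v where uv: "u \<in> D" "v \<in> D" "t [^] n \<otimes> b = F \<otimes> u \<oplus> G \<otimes> v" unfolding gen2_def by blast
  have cr: "b \<in> carrier R" "F' \<in> carrier R" "G' \<in> carrier R" "u \<in> carrier R" "v \<in> carrier R" using Dcl(1) bD FG(1,2) uv(1,2) by auto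
  have b0: "b \<noteq> \<zero>" using F(2) FG(3) cr by auto
  have "b \<otimes> t [^] n = b \<otimes> (F' \<otimes> u \<oplus> G' \<otimes> v)" using uv(3) unfolding FG(3,4) using cr tn(2)[of n] by (simp add: r_distr m_ac)
  hence "t [^] n = F' \<otimes> u \<oplus> G' \<otimes> v" using m_lcancel[OF b0 cr(1)] tn(2) cr by simp
  hence "t [^] n \<in> gen2 D F' G'" unfolding gen2_def using uv(1,2) by blast
  thus ?thesis using bD FG by blast
qed

text \<open>
  By Noetherian induction: if \<open>I \<noteq> D\<close>, some \<open>u \<notin> I\<close> of the form \<open>s ^ i * t ^ j\<close> is killed by the maximal ideal
  modulo \<open>I\<close>, and passing from \<open>I\<close> to \<open>I + u D\<close> shortens a chain by at most one step.
\<close>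
lemma finite_length:
  assumes "subideal D I" and "s [^] (a::nat) \<in> I" "t [^] (b::nat) \<in> I"
  shows "\<exists>n. len_le D I n"
proof -
  have "s [^] (a::nat) \<in> I \<longrightarrow> t [^] (b::nat) \<in> I \<longrightarrow> (\<exists>n. len_le D I n)" for a b
  proof (rule acc_induct[OF _ assms(1)], intro impI)
    fix I assume I: "subideal D I" and IH: "\<And>J. subideal D J \<Longrightarrow> I \<subset> J \<Longrightarrow> s [^] a \<in> J \<longrightarrow> t [^] b \<in> J \<longrightarrow> (\<exists>n. len_le D J n)"
      and sI: "s [^] a \<in> I" and tI: "t [^] b \<in> I"
    show "\<exists>n. len_le D I n"
    proof (cases "I = D")
      case True
      thus ?thesis using len_le_top[OF sub] by blast
    next
      case False
      hence one: "\<one> \<notin> I" using subideal_one[OF sub I] by blast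
      have pw: "s [^] (i::nat) \<in> D" "t [^] (i::nat) \<in> D" "s [^] i \<in> carrier R" "t [^] i \<in> carrier R" for i
        using subring_pow[OF sub] sD tD st_carrier by auto
      \<comment> \<open>exponents for an element \<open>s ^ i * t ^ j\<close> of the socle of \<open>D / I\<close>\<close>
      define i where "i = (LEAST i. s [^] Suc i \<in> I)"
      have "s [^] Suc a \<in> I" using subideal_r[OF sub I sD sI] by simp
      hence i: "s [^] Suc i \<in> I" unfolding i_def by (rule LeastI)
      have ni: "s [^] i \<notin> I"
      proof (cases i)
        case 0 thus ?thesis using one by simp
      next
        case (Suc k) thus ?thesis using not_less_Least[of k "\<lambda>i. s [^] Suc i \<in> I"] unfolding i_def[symmetric] by simp
      qed
      define j where "j = (LEAST j. s [^] i \<otimes> t [^] Suc j \<in> I)"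
      have "s [^] i \<otimes> t [^] Suc b \<in> I" using subidealD(4)[OF I pw(1) subideal_r[OF sub I tD tI]] by simp
      hence j: "s [^] i \<otimes> t [^] Suc j \<in> I" unfolding j_def by (rule LeastI)
      have nj: "s [^] i \<otimes> t [^] j \<notin> I"
      proof (cases j)
        case 0 thus ?thesis using ni pw(3) by simp
      next
        case (Suc k) thus ?thesis using not_less_Least[of k "\<lambda>j. s [^] i \<otimes> t [^] Suc j \<in> I"] unfolding j_def[symmetric] by simp
      qed
      define u where "u = s [^] i \<otimes> t [^] j"
      have uD: "u \<in> D" "u \<in> carrier R" unfolding u_def using Dcl(7)[OF pw(1) pw(2)] pw by auto
      have su: "u \<otimes> s \<in> I"
      proof -
        have "u \<otimes> s = s [^] Suc i \<otimes> t [^] j" unfolding u_def nat_pow_Suc using pw(3)[of i] pw(4)[of j] st_carrier by algebra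
        thus ?thesis using subideal_r[OF sub I pw(2) i] by simp
      qed
      have tu: "u \<otimes> t \<in> I"
      proof -
        have "u \<otimes> t = s [^] i \<otimes> t [^] Suc j" unfolding u_def nat_pow_Suc using pw(3)[of i] pw(4)[of j] st_carrier by algebra
        thus ?thesis using j by simp
      qed
      have um: "u \<otimes> z \<in> I" if z: "z \<in> m" for z
      proof -
        obtain c d where cd: "c \<in> D" "d \<in> D" "z = s \<otimes> c \<oplus> t \<otimes> d" using z unfolding gen2_def by blast
        have "u \<otimes> z = (u \<otimes> s) \<otimes> c \<oplus> (u \<otimes> t) \<otimes> d" unfolding cd(3)
          using uD Dcl(1)[OF cd(1)] Dcl(1)[OF cd(2)] st_carrier by algebra
        thus ?thesis using subidealD(3)[OF I subideal_r[OF sub I cd(1) su] subideal_r[OF sub I cd(2) tu]] by simp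
      qed
      have ext: "subideal D {q \<oplus> u \<otimes> c | q c. q \<in> K \<and> c \<in> D}" (is "subideal D (?E K)") if "subideal D K" for K
        by (rule subideal_extend[OF sub that uD(1)])
      have KE: "K \<subseteq> ?E K" "u \<in> ?E K" if K: "subideal D K" for K
      proof -
        have "q = q \<oplus> u \<otimes> \<zero>" if "q \<in> K" for q using subidealD(1)[OF K that] Dcl(1) uD by simp
        thus "K \<subseteq> ?E K" using Dcl(2) by blast
        have "u = \<zero> \<oplus> u \<otimes> \<one>" using uD by simp
        thus "u \<in> ?E K" using subidealD(2)[OF K] Dcl(3) by blast
      qed
      have "I \<subset> ?E I" using KE[OF I] nj unfolding u_def by blast
      then obtain n where n: "len_le D (?E I) n" using IH[OF ext[OF I]] sI tI by blast
      have "len_le D I (Suc n)" unfolding len_le_def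
      proof (intro allI impI, elim conjE)
        fix k Q assume 1: "\<forall>i\<le>k. subideal D (Q i) \<and> I \<subseteq> Q i" and 2: "\<forall>i<k. Q i \<subset> Q (Suc i)"
        show "k \<le> Suc n"
        proof (cases k)
          case (Suc l)
          have Qmono: "Q i \<subseteq> Q (Suc i)" if "i < k" for i using 2 that by blast
          \<comment> \<open>the chain becomes one above \<open>I + u D\<close>: add \<open>u\<close> to the members without it and drop the first one with it\<close>
          define Q' where "Q' i = (if u \<in> Q i then Q (Suc i) else ?E (Q i))" for i
          have sub': "subideal D (Q' i)" if "i \<le> l" for i
            unfolding Q'_def using 1 ext that Suc by auto
          have uQ: "u \<in> Q' i" if "i \<le> l" for i
            unfolding Q'_def using KE(2)[of "Q i"] 1 that Suc Qmono[of i] by auto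
          have IQ: "?E I \<subseteq> Q' i" if i: "i \<le> l" for i
          proof
            fix z assume "z \<in> ?E I"
            then obtain q c where z: "q \<in> I" "c \<in> D" "z = q \<oplus> u \<otimes> c" by blast
            have "subideal D (Q i)" "I \<subseteq> Q i" "I \<subseteq> Q (Suc i)" using 1 i Suc by auto
            hence "I \<subseteq> Q' i" unfolding Q'_def using subset_trans[OF _ KE(1)[of "Q i"]] by simp
            thus "z \<in> Q' i" unfolding z(3)
              using subidealD(3)[OF sub'[OF i] _ subideal_r[OF sub sub'[OF i] z(2) uQ[OF i]]] z(1) by blast
          qed
          have strict: "Q' i \<subset> Q' (Suc i)" if i: "i < l" for i
          proof -
            have si: "subideal D (Q i)" "subideal D (Q (Suc i))" "I \<subseteq> Q i" using 1 i Suc by auto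
            have st: "Q i \<subset> Q (Suc i)" "Q (Suc i) \<subset> Q (Suc (Suc i))" using 2 i Suc by auto
            consider "u \<in> Q i" | "u \<notin> Q i" "u \<in> Q (Suc i)" | "u \<notin> Q (Suc i)" using st by blast
            thus ?thesis
            proof cases
              case 1
              thus ?thesis unfolding Q'_def using st by auto
            next
              case 2
              have "?E (Q i) \<subseteq> Q (Suc i)" using subidealD(3)[OF si(2)] subideal_r[OF sub si(2) _ 2(2)] st(1) by blast
              thus ?thesis unfolding Q'_def using 2 st by auto
            next
              case 3
              hence 4: "u \<notin> Q i" using st by blast
              have inc: "?E (Q i) \<subseteq> ?E (Q (Suc i))" using st(1) by blast
              obtain q where q: "q \<in> Q (Suc i)" "q \<notin> Q i" using st(1) by blast
              have "q \<notin> ?E (Q i)"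
              proof
                assume "q \<in> ?E (Q i)"
                then obtain q' c where qc: "q' \<in> Q i" "c \<in> D" "q = q' \<oplus> u \<otimes> c" by blast
                have cr: "q' \<in> carrier R" "c \<in> carrier R" using subidealD(1)[OF si(1) qc(1)] Dcl(1) qc(2) by auto
                have "q \<ominus> q' = u \<otimes> c" unfolding qc(3) using cr uD by algebra
                hence uc: "u \<otimes> c \<in> Q (Suc i)" using subideal_minus[OF sub si(2) q(1) subsetD[OF psubset_imp_subset[OF st(1)] qc(1)]] by simp
                show False
                proof (cases "c \<in> m")
                  case True
                  hence "u \<otimes> c \<in> Q i" using um si(3) by blast
                  thus False using qc(1,3) subidealD(3)[OF si(1)] q(2) by blast
                next
                  case False
                  then obtain d where d: "d \<in> D" "c \<otimes> d = \<one>" using loc qc(2) by blast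
                  have "(u \<otimes> c) \<otimes> d = u \<otimes> (c \<otimes> d)" using uD cr Dcl(1)[OF d(1)] by (simp add: m_assoc)
                  hence "u \<in> Q (Suc i)" using subideal_r[OF sub si(2) d(1) uc] d(2) uD by simp
                  thus False using 3 by blast
                qed
              qed
              moreover have "q \<in> ?E (Q (Suc i))" using subsetD[OF KE(1)[OF si(2)] q(1)] .
              moreover have "Q' i = ?E (Q i)" "Q' (Suc i) = ?E (Q (Suc i))" unfolding Q'_def using 3 4 by simp_all
              ultimately show ?thesis using inc by (metis psubsetI)
            qed
          qed
          have "l \<le> n" using len_leD[OF n, of l Q'] sub' IQ strict by blast
          thus ?thesis using Suc by simp
        qed simp
      qed
      thus ?thesis by blast
    qed
  qed
  thus ?thesis using assms(2,3) by blast
qed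

context
  fixes Pr assumes Pr: "subideal D Pr" "\<one> \<notin> Pr" "\<And>a b. a \<in> D \<Longrightarrow> b \<in> D \<Longrightarrow> a \<otimes> b \<in> Pr \<Longrightarrow> a \<in> Pr \<or> b \<in> Pr"
    and Pr_nz: "\<exists>b\<in>Pr. b \<noteq> \<zero>" and Pr_m: "\<not> m \<subseteq> Pr"
begin

lemma prime_pow: "a \<in> D \<Longrightarrow> a [^] (n::nat) \<in> Pr \<Longrightarrow> a \<in> Pr"
proof (induct n)
  case 0 thus ?case using Pr(2) by simp
next
  case (Suc n)
  thus ?case using Pr(3)[of "a [^] n" a] subring_pow[OF sub] by auto
qed

text \<open>
  A special case of Krull's principal ideal theorem. Let \<open>s ^ n \<in> t D\<close>. Then the given prime ideal
  does not contain \<open>t\<close>, so it is generated by some \<open>b\<close> by \<open>saturated_principal\<close>. Since \<open>b\<close> is in \<open>(s, t)\<close>, also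
  \<open>b ^ n = t e\<close>. The prime \<open>b\<close> does not divide \<open>t\<close>, so \<open>b ^ n\<close> divides \<open>e\<close>, and \<open>t\<close> is a unit.
\<close>
lemma spow_not_t: "c \<in> D \<Longrightarrow> s [^] (n::nat) \<noteq> t \<otimes> c"
proof
  assume c: "c \<in> D" and e: "s [^] n = t \<otimes> c"
  have cc: "c \<in> carrier R" using Dcl(1)[OF c] .
  have tP: "t \<notin> Pr"
  proof
    assume t: "t \<in> Pr"
    hence "s [^] n \<in> Pr" unfolding e using subideal_r[OF sub Pr(1) c] by blast
    hence "s \<in> Pr" using prime_pow[OF sD] by blast
    thus False using Pr_m gen2_least[OF Pr(1) sub _ t] by blast
  qed
  have PD: "a \<in> D" if "a \<in> Pr" for a using subidealD(1)[OF Pr(1) that] .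
  obtain b where b: "b \<in> Pr" "Pr = {b \<otimes> c | c. c \<in> D}"
    using saturated_principal[OF Pr(1) Pr_nz] Pr(3)[OF tD] tP by blast
  have bc: "b \<in> carrier R" using Dcl(1)[OF PD[OF b(1)]] .
  have b0: "b \<noteq> \<zero>" using Pr_nz b(2) Dcl(1) by auto
  have "b \<in> m"
  proof (rule ccontr)
    assume "b \<notin> m"
    then obtain v where "v \<in> D" "b \<otimes> v = \<one>" using loc PD[OF b(1)] by blast
    thus False using subideal_r[OF sub Pr(1) _ b(1)] Pr(2) by metis
  qed
  then obtain f g where fg: "f \<in> D" "g \<in> D" "b = s \<otimes> f \<oplus> t \<otimes> g" unfolding gen2_def by blast
  have fgc: "f \<in> carrier R" "g \<in> carrier R" using Dcl(1) fg by auto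
  have "\<exists>h\<in>D. b [^] (k::nat) = s [^] k \<otimes> f [^] k \<oplus> t \<otimes> h" for k
  proof (induct k)
    case 0
    have "b [^] (0::nat) = s [^] (0::nat) \<otimes> f [^] (0::nat) \<oplus> t \<otimes> \<zero>" using st_carrier by simp
    thus ?case using Dcl(2) by blast
  next
    case (Suc k)
    then obtain h where h: "h \<in> D" "b [^] k = s [^] k \<otimes> f [^] k \<oplus> t \<otimes> h" by blast
    have pk: "s [^] k \<in> carrier R" "f [^] k \<in> carrier R" "b [^] k \<in> carrier R" using st_carrier fgc bc by auto
    have "b [^] Suc k = b [^] k \<otimes> (s \<otimes> f \<oplus> t \<otimes> g)" using fg(3) by simp
    also have "\<dots> = (s [^] k \<otimes> f [^] k \<oplus> t \<otimes> h) \<otimes> (s \<otimes> f) \<oplus> b [^] k \<otimes> (t \<otimes> g)"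
      using h(2) pk fgc st_carrier Dcl(1)[OF h(1)] by (simp add: r_distr)
    also have "\<dots> = s [^] Suc k \<otimes> f [^] Suc k \<oplus> t \<otimes> (h \<otimes> (s \<otimes> f) \<oplus> b [^] k \<otimes> g)" unfolding nat_pow_Suc
      using pk fgc st_carrier Dcl(1)[OF h(1)] by algebra
    finally show ?case using Dcl(5,7) h(1) sD fg subring_pow[OF sub PD[OF b(1)]] by metis
  qed
  then obtain h where h: "h \<in> D" "b [^] n = s [^] n \<otimes> f [^] n \<oplus> t \<otimes> h" by blast
  define e where "e = c \<otimes> f [^] n \<oplus> h"
  have eD: "e \<in> D" unfolding e_def using Dcl(5,7) c h(1) subring_pow[OF sub fg(1)] by blast
  have bn: "b [^] n = t \<otimes> e" unfolding h(2) \<open>s [^] n = t \<otimes> c\<close> e_def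
    using cc st_carrier fgc nat_pow_closed[OF fgc(1), of n] Dcl(1)[OF h(1)] by algebra
  have "k \<le> n \<Longrightarrow> \<exists>e'\<in>D. e = b [^] k \<otimes> e'" for k
  proof (induct k)
    case 0
    have "e = b [^] (0::nat) \<otimes> e" using Dcl(1)[OF eD] by simp
    thus ?case using eD by blast
  next
    case (Suc k)
    then obtain e' where e': "e' \<in> D" "e = b [^] k \<otimes> e'" by auto
    have e'c: "e' \<in> carrier R" using Dcl(1)[OF e'(1)] .
    define i where "i = n - Suc k"
    have n: "n = k + Suc i" using Suc(2) unfolding i_def by simp
    have bk: "b [^] k \<in> carrier R" "b [^] k \<noteq> \<zero>" "b [^] Suc i \<in> carrier R" using bc b0 pow_nz by auto
    have "b [^] k \<otimes> b [^] Suc i = b [^] n" unfolding n using nat_pow_mult[OF bc, of k "Suc i"] .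
    also have "\<dots> = b [^] k \<otimes> (t \<otimes> e')" unfolding bn e'(2) using bk e'c st_carrier by algebra
    finally have "b [^] Suc i = t \<otimes> e'" using m_lcancel[OF bk(2,1,3) m_closed[OF st_carrier(2) e'c]] by blast
    moreover have "b [^] Suc i \<in> Pr" using subidealD(4)[OF Pr(1) subring_pow[OF sub PD[OF b(1)]] b(1)] by simp
    ultimately have "e' \<in> Pr" using Pr(3)[OF tD e'(1)] tP by simp
    then obtain e'' where e'': "e'' \<in> D" "e' = b \<otimes> e''" using b(2) by blast
    have "e = b [^] Suc k \<otimes> e''" unfolding e'(2) e''(2) using bk bc Dcl(1)[OF e''(1)] by (simp add: m_assoc)
    thus ?case using e''(1) by blast
  qed
  then obtain e' where e': "e' \<in> D" "e = b [^] n \<otimes> e'" by blast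
  have bk: "b [^] n \<in> carrier R" "b [^] n \<noteq> \<zero>" using bc b0 pow_nz by auto
  have "b [^] n \<otimes> \<one> = b [^] n \<otimes> (t \<otimes> e')" using bn unfolding e'(2) using bk Dcl(1)[OF e'(1)] st_carrier
    by (metis m_lcomm r_one)
  hence "\<one> = t \<otimes> e'" using m_lcancel[OF bk(2,1) one_closed] Dcl(1)[OF e'(1)] st_carrier by simp
  moreover have "t \<otimes> e' \<in> m" using subideal_r[OF sub m_ideal e'(1) st_m(2)] .
  ultimately show False using proper by simp
qed

lemma t_nonzero: "t \<noteq> \<zero>"
proof
  assume t: "t = \<zero>"
  obtain b where b: "b \<in> Pr" "b \<noteq> \<zero>" using Pr_nz by blast
  have bD: "b \<in> D" using subidealD(1)[OF Pr(1) b(1)] .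
  have "\<not> (\<exists>c\<in>D. b = t \<otimes> c)" using b(2) t Dcl(1) by auto
  then obtain j u v c where e: "u \<in> D" "v \<in> D" "c \<in> D" "u \<otimes> v = \<one>" "b = s [^] (j::nat) \<otimes> u \<oplus> t \<otimes> c"
    using expansion_cases[OF bD] unfolding expansion_def by blast
  have sj: "s [^] j \<in> carrier R" using st_carrier by simp
  have "b \<otimes> v = s [^] j \<otimes> (u \<otimes> v)" unfolding e(5) t using sj Dcl(1)[OF e(1)] Dcl(1)[OF e(2)] Dcl(1)[OF e(3)] by (simp add: m_assoc)
  hence "s [^] j \<in> Pr" using subideal_r[OF sub Pr(1) e(2) b(1)] e(4) sj by simp
  hence "s \<in> Pr" using prime_pow[OF sD] by blast
  moreover have "t \<in> Pr" using t subidealD(2)[OF Pr(1)] by simp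
  ultimately show False using gen2_least[OF Pr(1) sub] Pr_m by blast
qed

text \<open>
  If \<open>c \<notin> t D\<close>, then \<open>c\<close> is a unit times \<open>s ^ j\<close> modulo \<open>t\<close>, so \<open>c s \<in> t D\<close> gives \<open>s ^ (j + 1) \<in> t D\<close>.
\<close>
lemma s_t_regular:
  assumes c: "c \<in> D" and d: "d \<in> D" and e: "c \<otimes> s = t \<otimes> d" shows "\<exists>c'\<in>D. c = t \<otimes> c'"
proof (rule ccontr)
  assume "\<not> ?thesis"
  then obtain j u v f where x: "u \<in> D" "v \<in> D" "f \<in> D" "u \<otimes> v = \<one>" "c = s [^] (j::nat) \<otimes> u \<oplus> t \<otimes> f"
    using expansion_cases[OF c] unfolding expansion_def by blast
  have cr: "u \<in> carrier R" "v \<in> carrier R" "f \<in> carrier R" "d \<in> carrier R" "s [^] j \<in> carrier R" using x d Dcl(1) st_carrier by auto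
  have "s [^] Suc j = s [^] Suc j \<otimes> (u \<otimes> v)" unfolding x(4) using cr st_carrier by simp
  also have "\<dots> = (c \<otimes> s \<ominus> t \<otimes> (f \<otimes> s)) \<otimes> v" unfolding x(5) nat_pow_Suc using cr st_carrier by algebra
  also have "\<dots> = t \<otimes> ((d \<ominus> f \<otimes> s) \<otimes> v)" unfolding e using cr st_carrier by algebra
  finally show False using spow_not_t[of "(d \<ominus> f \<otimes> s) \<otimes> v" "Suc j"] Dcl(6,7) d x sD by simp
qed

lemma s_nonzero: "s \<noteq> \<zero>"
  using spow_not_t[OF Dcl(2), of "Suc 0"] st_carrier by auto

text \<open>
  Removing common factors first with respect to \<open>t\<close> and then with respect to \<open>s\<close> leaves a fraction whose
  ideal contains powers of both parameters.
\<close>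
lemma regular_pairI:
  assumes frac: "\<And>y. y \<in> carrier R \<Longrightarrow> \<exists>F\<in>D. F \<noteq> \<zero> \<and> y \<otimes> F \<in> D"
  shows "regular_pair R D s t"
proof (intro regular_pair.intro[OF local_pair_axioms] regular_pair_axioms.intro)
  show "\<exists>F\<in>D. \<exists>G\<in>D. \<exists>n. F \<noteq> \<zero> \<and> y \<otimes> F = G \<and> len_le D (gen2 D F G) n" if y: "y \<in> carrier R" "y \<noteq> \<zero>" for y
  proof -
    obtain F where F: "F \<in> D" "F \<noteq> \<zero>" "y \<otimes> F \<in> D" using frac y(1) by blast
    obtain b F' G' n where 1: "b \<in> D" "F' \<in> D" "G' \<in> D" "F = b \<otimes> F'" "y \<otimes> F = b \<otimes> G'" "t [^] (n::nat) \<in> gen2 D F' G'"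
      using common_factor[OF F t_nonzero] by blast
    have F'0: "F' \<noteq> \<zero>" using F(2) 1(4) Dcl(1)[OF 1(1)] by auto
    interpret sw: noetherian_pair R D t s by (rule swap)
    obtain b' F'' G'' k where 2: "b' \<in> D" "F'' \<in> D" "G'' \<in> D" "F' = b' \<otimes> F''" "G' = b' \<otimes> G''" "s [^] (k::nat) \<in> gen2 D F'' G''"
      using sw.common_factor[OF 1(2) F'0 1(3) s_nonzero] by blast
    have I: "subideal D (gen2 D F'' G'')" by (rule gen2_subideal[OF sub 2(2,3)])
    have "gen2 D F' G' \<subseteq> gen2 D F'' G''"
      unfolding 2(4,5) using gen2_least[OF I sub] subidealD(4)[OF I 2(1)] gen2_in[OF sub 2(2,3)] by blast
    hence "t [^] n \<in> gen2 D F'' G''" using 1(6) by blast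
    then obtain l where l: "len_le D (gen2 D F'' G'') l" using finite_length[OF I 2(6)] by blast
    have c: "b \<in> carrier R" "b' \<in> carrier R" "F'' \<in> carrier R" "G'' \<in> carrier R" using Dcl(1) 1 2 by auto
    have nz: "F'' \<noteq> \<zero>" "b \<otimes> b' \<noteq> \<zero>" using F(2) 1(4) 2(4) c by (auto simp: integral_iff)
    have "(b \<otimes> b') \<otimes> (y \<otimes> F'') = y \<otimes> F" unfolding 1(4) 2(4) using c y(1) by algebra
    also have "\<dots> = (b \<otimes> b') \<otimes> G''" unfolding 1(5) 2(5) using c by algebra
    finally have "y \<otimes> F'' = G''" using m_lcancel[OF nz(2)] c y(1) by simp
    thus ?thesis using 2(2,3) nz(1) l by blast
  qed
qed (use s_nonzero t_nonzero s_t_regular in auto)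

end

end

section \<open>Existence of valuation rings\<close>

context field
begin

lemma subring_Union_chain:
  assumes C: "C \<noteq> {}" "\<And>B. B \<in> C \<Longrightarrow> subring B R" "\<And>B B'. B \<in> C \<Longrightarrow> B' \<in> C \<Longrightarrow> B \<subseteq> B' \<or> B' \<subseteq> B"
  shows "subring (\<Union>C) R"
proof (rule subringI)
  have two: "\<exists>B\<in>C. a \<in> B \<and> b \<in> B" if "a \<in> \<Union>C" "b \<in> \<Union>C" for a b using that C(3) by blast
  show "\<Union>C \<subseteq> carrier R" using subringE(1)[OF C(2)] by blast
  show "\<one> \<in> \<Union>C" using subringE(3)[OF C(2)] C(1) by blast
  show "\<ominus> h \<in> \<Union>C" if "h \<in> \<Union>C" for h using subringE(5)[OF C(2)] that by blast
  show "a \<otimes> b \<in> \<Union>C" if "a \<in> \<Union>C" "b \<in> \<Union>C" for a b using two[OF that] subringE(6)[OF C(2)] by blast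
  show "a \<oplus> b \<in> \<Union>C" if "a \<in> \<Union>C" "b \<in> \<Union>C" for a b using two[OF that] subringE(7)[OF C(2)] by blast
qed

text \<open>
  Reversal of the coefficients, with \<open>y' = 1 / y\<close>.
\<close>
lemma polys_reverse:
  assumes B: "subring B R" and y: "y \<in> carrier R" "y' \<in> carrier R" "y \<otimes> y' = \<one>"
  shows "c \<in> polys y' B (Suc n) \<Longrightarrow> y [^] n \<otimes> c \<in> polys y B (Suc n)"
proof (induct n arbitrary: c)
  case 0
  then obtain a where "a \<in> B" "c = \<zero> \<oplus> a \<otimes> y' [^] (0::nat)" unfolding polys.simps by blast
  moreover have "a \<otimes> y [^] (0::nat) \<in> polys y B (Suc 0)" if "a \<in> B" for a
    using polys_monomial[OF B subideal_self[OF B] y(1) that] by blast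
  ultimately show ?case using subring_closed(1)[OF B] by simp
next
  case (Suc n)
  note BB = subideal_self[OF B]
  obtain d a where d: "d \<in> polys y' B (Suc n)" "a \<in> B" "c = d \<oplus> a \<otimes> y' [^] Suc n"
    using Suc(2) unfolding polys.simps(2)[where n = "Suc n"] by blast
  have cr: "d \<in> carrier R" "a \<in> carrier R" "y [^] n \<in> carrier R" "y [^] Suc n \<in> carrier R" "y' [^] Suc n \<in> carrier R"
    using polys_carrier[OF B BB y(2) d(1)] subring_closed(1)[OF B d(2)] y by auto
  have "y [^] Suc n \<otimes> y' [^] Suc n = (y \<otimes> y') [^] Suc n" using nat_pow_distrib[OF y(1,2)] by (rule sym)
  hence e: "y [^] Suc n \<otimes> y' [^] Suc n = \<one>" unfolding y(3) by simp
  have "y [^] Suc n \<otimes> c = y [^] Suc n \<otimes> d \<oplus> a \<otimes> (y [^] Suc n \<otimes> y' [^] Suc n)" unfolding d(3)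
    using cr by algebra
  also have "\<dots> = y \<otimes> (y [^] n \<otimes> d) \<oplus> a \<otimes> y [^] (0::nat)" unfolding e using cr y by (simp add: m_ac)
  also have "\<dots> \<in> polys y B (Suc (Suc n))"
    by (intro polys_add[OF B BB y(1)] polys_shift[OF B BB y(1)] Suc(1) d polys_monomial[OF B BB y(1)]) simp
  finally show ?case .
qed

lemma polys_low:
  assumes B: "subring B R" and y: "y \<in> carrier R"
  shows "c \<in> polys y B (Suc n) \<Longrightarrow> \<exists>a\<in>B. \<exists>d\<in>polys y B n. c = a \<oplus> y \<otimes> d"
proof (induct n arbitrary: c)
  case 0
  then obtain a where a: "a \<in> B" "c = \<zero> \<oplus> a \<otimes> y [^] (0::nat)" unfolding polys.simps by blast
  have "c = a \<oplus> y \<otimes> \<zero>" unfolding a(2) using y subring_closed(1)[OF B a(1)] by simp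
  thus ?case using a(1) by auto
next
  case (Suc n)
  note BB = subideal_self[OF B]
  obtain d a where d: "d \<in> polys y B (Suc n)" "a \<in> B" "c = d \<oplus> a \<otimes> y [^] Suc n"
    using Suc(2) unfolding polys.simps(2)[where n = "Suc n"] by blast
  obtain a' d' where d': "a' \<in> B" "d' \<in> polys y B n" "d = a' \<oplus> y \<otimes> d'" using Suc(1)[OF d(1)] by blast
  have cr: "d' \<in> carrier R" "a \<in> carrier R" "a' \<in> carrier R" "y [^] n \<in> carrier R"
    using polys_carrier[OF B BB y d'(2)] subring_closed(1)[OF B] d(2) d'(1) y by auto
  have "c = a' \<oplus> y \<otimes> (d' \<oplus> a \<otimes> y [^] n)" unfolding d(3) d'(3) nat_pow_Suc using cr y by algebra
  moreover have "d' \<oplus> a \<otimes> y [^] n \<in> polys y B (Suc n)" unfolding polys.simps using d'(2) d(2) by blast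
  ultimately show ?case using d'(1) by blast
qed

text \<open>
  The step in the existence proof for valuation rings that lowers the larger degree: the relation \<open>z c = 1\<close> gives
  \<open>1 - z c0 = z y' c1\<close>, and multiplying the relation \<open>z b = 1\<close> by the left hand side turns the top term of \<open>b\<close>
  into one of smaller degree.
\<close>
lemma degree_reduction:
  assumes B: "subring B R" and y: "y \<in> carrier R" "y' \<in> carrier R" "y \<otimes> y' = \<one>" and z: "z \<in> B"
    and b: "b \<in> polys y B (Suc (Suc n))" "z \<otimes> b = \<one>" and c: "c \<in> polys y' B (Suc (Suc k))" "z \<otimes> c = \<one>" and kn: "k \<le> n"
  shows "\<exists>b'\<in>polys y B (Suc n). z \<otimes> b' = \<one>"
proof -
  note BB = subideal_self[OF B]
  have zc: "z \<in> carrier R" using subring_closed(1)[OF B z] .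
  obtain c0 c1 where 1: "c0 \<in> B" "c1 \<in> polys y' B (Suc k)" "c = c0 \<oplus> y' \<otimes> c1" using polys_low[OF B y(2) c(1)] by blast
  obtain b1 e where 2: "b1 \<in> polys y B (Suc n)" "e \<in> B" "b = b1 \<oplus> e \<otimes> y [^] Suc n"
    using b(1) unfolding polys.simps(2)[where n = "Suc n"] by blast
  have cr: "c0 \<in> carrier R" "c1 \<in> carrier R" "b1 \<in> carrier R" "e \<in> carrier R" "y [^] n \<in> carrier R"
    using subring_closed(1)[OF B] polys_carrier[OF B BB] 1 2 y by auto
  have "y [^] (n - k) \<otimes> (y [^] k \<otimes> c1) \<in> polys y B (Suc k + (n - k))"
    by (rule polys_shift_pow[OF B BB y(1) polys_reverse[OF B y 1(2)]])
  moreover have "y [^] (n - k) \<otimes> (y [^] k \<otimes> c1) = y [^] n \<otimes> c1"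
    using kn cr y by (simp add: m_assoc[symmetric] nat_pow_mult)
  ultimately have yc: "y [^] n \<otimes> c1 \<in> polys y B (Suc n)" using kn by simp
  define b' where "b' = c0 \<oplus> (\<one> \<ominus> z \<otimes> c0) \<otimes> b1 \<oplus> (e \<otimes> z) \<otimes> (y [^] n \<otimes> c1)"
  have "c0 \<otimes> y [^] (0::nat) \<in> polys y B (Suc n)" using polys_monomial[OF B BB y(1) 1(1)] by blast
  hence "c0 \<in> polys y B (Suc n)" using cr by simp
  moreover have "\<one> \<ominus> z \<otimes> c0 \<in> B" "e \<otimes> z \<in> B" using subring_closed(3,6,7)[OF B] z 1(1) 2(2) by auto
  ultimately have b'P: "b' \<in> polys y B (Suc n)" unfolding b'_def
    using polys_add[OF B BB y(1)] polys_smult[OF B BB y(1)] 2(1) yc by simp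
  have zc0: "\<one> \<ominus> z \<otimes> c0 = z \<otimes> (y' \<otimes> c1)"
  proof -
    have "\<one> \<ominus> z \<otimes> c0 = z \<otimes> c \<ominus> z \<otimes> c0" using c(2) by simp
    also have "\<dots> = z \<otimes> (y' \<otimes> c1)" unfolding 1(3) using zc cr y by algebra
    finally show ?thesis .
  qed
  have "(\<one> \<ominus> z \<otimes> c0) \<otimes> (e \<otimes> y [^] Suc n) = (e \<otimes> z) \<otimes> (y [^] n \<otimes> c1) \<otimes> (y \<otimes> y')"
    unfolding zc0 nat_pow_Suc using zc cr y(1,2) by algebra
  hence k1: "(\<one> \<ominus> z \<otimes> c0) \<otimes> (e \<otimes> y [^] Suc n) = (e \<otimes> z) \<otimes> (y [^] n \<otimes> c1)" unfolding y(3) using zc cr by simp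
  have ySn: "y [^] Suc n \<in> carrier R" using y by simp
  have "z \<otimes> b' = z \<otimes> c0 \<oplus> z \<otimes> ((\<one> \<ominus> z \<otimes> c0) \<otimes> b1 \<oplus> (\<one> \<ominus> z \<otimes> c0) \<otimes> (e \<otimes> y [^] Suc n))"
    unfolding b'_def k1 using zc cr y by algebra
  also have "\<dots> = z \<otimes> c0 \<oplus> (\<one> \<ominus> z \<otimes> c0) \<otimes> (z \<otimes> b)" unfolding 2(3) using zc cr ySn by algebra
  also have "\<dots> = \<one>" unfolding b(2) using zc cr by algebra
  finally show ?thesis using b'P by blast
qed

text \<open>
  If neither \<open>y\<close> nor \<open>1 / y\<close> is in \<open>B\<close>, then \<open>z\<close> becomes a unit in both \<open>B[y]\<close> and \<open>B[1 / y]\<close>; for inverses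
  of least degrees this contradicts \<open>degree_reduction\<close>.
\<close>
lemma maximal_nonunit_ring_valuation:
  assumes B: "subring B R" and z: "z \<in> B" and nz: "\<not> (\<exists>b\<in>B. z \<otimes> b = \<one>)"
    and max: "\<And>C. subring C R \<Longrightarrow> B \<subseteq> C \<Longrightarrow> \<not> (\<exists>b\<in>C. z \<otimes> b = \<one>) \<Longrightarrow> C = B"
  shows "valuation_ring R B"
  unfolding valuation_ring_def
proof (intro conjI ballI)
  show "subring B R" by (rule B)
  fix y assume "y \<in> carrier R - {\<zero>}"
  hence y: "y \<in> carrier R" "y \<noteq> \<zero>" by auto
  note iy = inv_facts[OF y]
  note BB = subideal_self[OF B]
  have zc: "z \<in> carrier R" using subring_closed(1)[OF B z] .
  let ?A = "\<lambda>y n. \<exists>b\<in>polys y B (Suc (Suc n)). z \<otimes> b = \<one>"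
  have ext: "\<exists>n. ?A y n" if y: "y \<in> carrier R" "y \<notin> B" for y
  proof -
    have "polyring y B \<noteq> B" using polyring_var[OF B y(1)] y(2) by blast
    then obtain b where "b \<in> polyring y B" "z \<otimes> b = \<one>"
      using max[OF polyring_subring[OF B y(1)] polyring_const[OF B y(1)]] by blast
    moreover then obtain n where "b \<in> polys y B n" unfolding polyring_def by blast
    hence "b \<in> polys y B (Suc (Suc n))" using polys_Suc[OF B BB y(1)] by blast
    ultimately show ?thesis by blast
  qed
  have low: "\<not> (\<exists>b\<in>polys y B (Suc 0). z \<otimes> b = \<one>)" if y: "y \<in> carrier R" for y
  proof
    assume "\<exists>b\<in>polys y B (Suc 0). z \<otimes> b = \<one>"
    then obtain a b where a: "a \<in> B" "b = \<zero> \<oplus> a \<otimes> y [^] (0::nat)" "z \<otimes> b = \<one>" unfolding polys.simps by blast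
    have "b = a" using a(2) subring_closed(1)[OF B a(1)] by simp
    thus False using a nz by blast
  qed
  have no: False if y: "y \<in> carrier R" "y' \<in> carrier R" "y \<otimes> y' = \<one>"
    and A: "?A y n" "?A y' k" and min: "\<And>i. ?A y i \<Longrightarrow> n \<le> i" and kn: "k \<le> n" for y y' n k
  proof -
    have 1: "\<exists>b'\<in>polys y B (Suc n). z \<otimes> b' = \<one>"
      using degree_reduction[OF B y z _ _ _ _ kn] A by blast
    show False
    proof (cases n)
      case 0 thus False using 1 low[OF y(1)] by simp
    next
      case (Suc i) thus False using 1 min[of i] by simp
    qed
  qed
  show "y \<in> B \<or> inv y \<in> B"
  proof (rule ccontr)
    assume n: "\<not> ?thesis"
    define n1 where "n1 = (LEAST n. ?A y n)"
    define n2 where "n2 = (LEAST n. ?A (inv y) n)"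
    have A: "?A y n1" "?A (inv y) n2" unfolding n1_def n2_def 
      using LeastI_ex[OF ext[of y]] LeastI_ex[OF ext[of "inv y"]] y iy n by simp_all
    have m: "n1 \<le> i" if "?A y i" for i unfolding n1_def by (rule Least_le) (rule that)
    have m': "n2 \<le> i" if "?A (inv y) i" for i unfolding n2_def by (rule Least_le) (rule that)
    show False
    proof (cases "n2 \<le> n1")
      case True
      show False by (rule no[OF _ _ _ A m True]) (use y iy in auto)
    next
      case False
      show False by (rule no[OF _ _ _ A(2,1) m']) (use y iy False in auto)
    qed
  qed
qed

lemma polys_eval_list:
  "c \<in> polys x A n \<Longrightarrow> x \<in> carrier R \<Longrightarrow> subring A R \<Longrightarrow> \<exists>p. set p \<subseteq> A \<and> length p = n \<and> eval p x = c"
proof (induct n arbitrary: c)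
  case 0
  thus ?case by (intro exI[of _ "[]"]) simp
next
  case (Suc n)
  obtain d a where d: "d \<in> polys x A n" "a \<in> A" "c = d \<oplus> a \<otimes> x [^] n" using Suc(2) unfolding polys.simps by blast
  obtain p where p: "set p \<subseteq> A" "length p = n" "eval p x = d" using Suc(1)[OF d(1) Suc(3,4)] by blast
  have "d \<in> carrier R" using polys_carrier[OF Suc(4) subideal_self[OF Suc(4)] Suc(3) d(1)] .
  hence "eval (a # p) x = c" using p d subring_closed(1)[OF Suc(4) d(2)] Suc(3) by (simp add: a_comm)
  thus ?case using p d(2) by (intro exI[of _ "a # p"]) simp
qed

lemma integral_overI:
  assumes A: "subring A R" and x: "x \<in> carrier R" and l: "l \<in> polys x A n" "x [^] n \<oplus> l = \<zero>"
  shows "integral_over R A x"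
proof -
  obtain p where p: "set p \<subseteq> A" "length p = n" "eval p x = l" using polys_eval_list[OF l(1) x A] by blast
  have "eval (\<one> # p) x = \<zero>" using p l(2) x by simp
  moreover have "\<one> # p \<in> carrier (univ_poly R A)" unfolding univ_poly_carrier[symmetric] polynomial_def
    using p(1) subring_closed(3)[OF A] by simp
  ultimately show ?thesis unfolding integral_over_def using x by (intro conjI exI[of _ "\<one> # p"]) auto
qed

text \<open>
  If \<open>1 / x\<close> were a unit of \<open>A[1 / x]\<close>, reversing the polynomial for its inverse would show that \<open>x\<close> is
  integral over \<open>A\<close>. So there is, by Zorn's lemma, a maximal subring in which \<open>1 / x\<close> is a nonunit.
\<close>
lemma valuation_ring_avoiding:
  assumes A: "subring A R" and ic: "integrally_closed R A" and x: "x \<in> carrier R" "x \<notin> A"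
  shows "\<exists>V\<in>Zar R A. x \<notin> V"
proof -
  have x0: "x \<noteq> \<zero>" using x subring_closed(2)[OF A] by blast
  define z where "z = inv x"
  have z: "z \<in> carrier R" "x \<otimes> z = \<one>" "z \<otimes> x = \<one>" using inv_facts[OF x(1) x0] unfolding z_def by auto
  note AA = subideal_self[OF A]
  define \<B> where "\<B> = {B. subring B R \<and> A \<subseteq> B \<and> z \<in> B \<and> \<not> (\<exists>b\<in>B. z \<otimes> b = \<one>)}"
  have "\<not> (\<exists>b\<in>polyring z A. z \<otimes> b = \<one>)"
  proof
    assume "\<exists>b\<in>polyring z A. z \<otimes> b = \<one>"
    then obtain b n where b: "b \<in> polys z A n" "z \<otimes> b = \<one>" unfolding polyring_def by blast
    have bS: "b \<in> polys z A (Suc n)" using polys_Suc[OF A AA z(1) b(1)] .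
    have bc: "b \<in> carrier R" using polys_carrier[OF A AA z(1) b(1)] .
    have "x [^] n \<otimes> b \<in> polys x A (Suc n)" using polys_reverse[OF A x(1) z(1,2) bS] .
    moreover have "x [^] n \<otimes> b = x [^] Suc n"
    proof -
      have "x \<otimes> (z \<otimes> b) = b" using m_assoc[OF x(1) z(1) bc] z(2) bc by simp
      hence "x = b" unfolding b(2) using x by simp
      thus ?thesis by simp
    qed
    ultimately have "x [^] Suc n \<in> polys x A (Suc n)" by simp
    hence "\<zero> \<ominus> x [^] Suc n \<in> polys x A (Suc n)" using polys_minus[OF A AA x(1) polys_zero[OF A AA x(1)]] by blast
    moreover have "x [^] Suc n \<oplus> (\<zero> \<ominus> x [^] Suc n) = \<zero>" using nat_pow_closed[OF x(1), of "Suc n"] by algebra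
    ultimately have "integral_over R A x" using integral_overI[OF A x(1)] by blast
    thus False using ic x(2) unfolding integrally_closed_def by blast
  qed
  hence "polyring z A \<in> \<B>" unfolding \<B>_def
    using polyring_subring[OF A z(1)] polyring_const[OF A z(1)] polyring_var[OF A z(1)] by blast
  hence ne: "\<B> \<noteq> {}" by blast
  have "\<exists>B\<in>\<B>. \<forall>C\<in>\<B>. B \<subseteq> C \<longrightarrow> C = B"
  proof (rule subset_Zorn_nonempty[OF ne])
    fix \<C> assume C: "\<C> \<noteq> {}" "subset.chain \<B> \<C>"
    have CB: "B \<in> \<B>" if "B \<in> \<C>" for B using C(2) that unfolding subset_chain_def by blast
    have "subring (\<Union>\<C>) R"
    proof (rule subring_Union_chain[OF C(1)])
      show "subring B R" if "B \<in> \<C>" for B using CB[OF that] unfolding \<B>_def by simp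
      show "B \<subseteq> B' \<or> B' \<subseteq> B" if "B \<in> \<C>" "B' \<in> \<C>" for B B' using C(2) that unfolding subset_chain_def by blast
    qed
    moreover obtain B where "B \<in> \<C>" using C(1) by blast
    moreover have "A \<subseteq> B" "z \<in> B" if "B \<in> \<C>" for B using CB[OF that] unfolding \<B>_def by auto
    moreover have "\<not> (\<exists>b\<in>\<Union>\<C>. z \<otimes> b = \<one>)" using CB unfolding \<B>_def by fast
    ultimately show "\<Union>\<C> \<in> \<B>" unfolding \<B>_def by blast
  qed
  then obtain B where B: "B \<in> \<B>" and max: "\<And>C. C \<in> \<B> \<Longrightarrow> B \<subseteq> C \<Longrightarrow> C = B" by blast
  have B1: "subring B R" "A \<subseteq> B" "z \<in> B" "\<not> (\<exists>b\<in>B. z \<otimes> b = \<one>)" using B unfolding \<B>_def by auto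
  have "valuation_ring R B"
  proof (rule maximal_nonunit_ring_valuation[OF B1(1,3,4)])
    fix C assume "subring C R" "B \<subseteq> C" "\<not> (\<exists>b\<in>C. z \<otimes> b = \<one>)"
    thus "C = B" using max[of C] B1 unfolding \<B>_def by blast
  qed
  moreover have "x \<notin> B" using B1(4) z(3) by blast
  ultimately show ?thesis unfolding Zar_def using B1(2) by blast
qed

end

section \<open>The inverse topology\<close>

lemma zariski_base:
  assumes "openin (zariski_topology F A) U" "V \<in> U"
  shows "\<exists>S. finite S \<and> S \<subseteq> carrier F \<and> S \<subseteq> V \<and> {V' \<in> Zar F A. S \<subseteq> V'} \<subseteq> U"
proof -
  have "generate_topology_on {{V \<in> Zar F A. S \<subseteq> V} | S. finite S \<and> S \<subseteq> carrier F} U"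
    using assms(1) unfolding zariski_topology_def openin_topology_generated_by_iff .
  thus ?thesis using assms(2)
  proof (induct)
    case Empty
    thus ?case by simp
  next
    case (Int a b)
    hence V: "V \<in> a" "V \<in> b" by auto
    obtain S where S: "finite S" "S \<subseteq> carrier F" "S \<subseteq> V" "{V' \<in> Zar F A. S \<subseteq> V'} \<subseteq> a" using Int(2)[OF V(1)] by blast
    obtain S' where "finite S'" "S' \<subseteq> carrier F" "S' \<subseteq> V" "{V' \<in> Zar F A. S' \<subseteq> V'} \<subseteq> b" using Int(4)[OF V(2)] by blast
    thus ?case using S by (intro exI[of _ "S \<union> S'"]) auto
  next
    case (UN K)
    then obtain k where k: "k \<in> K" "V \<in> k" by blast
    obtain S where "finite S" "S \<subseteq> carrier F" "S \<subseteq> V" "{V' \<in> Zar F A. S \<subseteq> V'} \<subseteq> k" using UN(2)[OF k] by blast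
    thus ?case using k by (intro exI[of _ S]) auto
  next
    case (Basis b)
    thus ?case by blast
  qed
qed

lemma inverse_topspace: "topspace (inverse_topology F A) = Zar F A"
proof -
  have "Zar F A = Zar F A - {}" by simp
  moreover have "openin (zariski_topology F A) {}" "compactin (zariski_topology F A) {}" by auto
  ultimately have "Zar F A \<in> {Zar F A - U | U. openin (zariski_topology F A) U \<and> compactin (zariski_topology F A) U}" by blast
  thus ?thesis unfolding inverse_topology_def by auto
qed

text \<open>
  A basic neighbourhood of \<open>V\<close> in the inverse topology is the complement of the union of finitely many quasicompact Zariski open
  sets. Each of these is a finite union of sets \<open>{V'. S \<subseteq> V'}\<close>, and from each \<open>S\<close> an element outside \<open>V\<close> is chosen.
\<close>
lemma inverse_closed_separation:
  assumes Z: "closedin (inverse_topology F A) Z" and V: "V \<in> Zar F A" "V \<notin> Z"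
  shows "\<exists>S. finite S \<and> S \<subseteq> carrier F \<and> S \<inter> V = {} \<and> (\<forall>V'\<in>Z. V' \<inter> S \<noteq> {})"
proof -
  let ?S = "{Zar F A - U | U. openin (zariski_topology F A) U \<and> compactin (zariski_topology F A) U}"
  have main: "\<exists>S. finite S \<and> S \<subseteq> carrier F \<and> S \<inter> V = {} \<and> (\<forall>V'\<in>Zar F A - U. V' \<inter> S \<noteq> {})"
    if "generate_topology_on ?S U" "V \<in> U" for U
    using that
  proof (induct)
    case Empty
    thus ?case by simp
  next
    case (Int a b)
    hence V: "V \<in> a" "V \<in> b" by auto
    obtain S where S: "finite S" "S \<subseteq> carrier F" "S \<inter> V = {}" "\<forall>V'\<in>Zar F A - a. V' \<inter> S \<noteq> {}" using Int(2)[OF V(1)] by blast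
    obtain S' where "finite S'" "S' \<subseteq> carrier F" "S' \<inter> V = {}" "\<forall>V'\<in>Zar F A - b. V' \<inter> S' \<noteq> {}" using Int(4)[OF V(2)] by blast
    with S show ?case
    proof (intro exI[of _ "S \<union> S'"] conjI ballI)
      fix V' assume "V' \<in> Zar F A - a \<inter> b"
      thus "V' \<inter> (S \<union> S') \<noteq> {}" using S(4) \<open>\<forall>V'\<in>Zar F A - b. V' \<inter> S' \<noteq> {}\<close> by blast
    qed blast+
  next
    case (UN K)
    then obtain k where k: "k \<in> K" "V \<in> k" by blast
    obtain S where "finite S" "S \<subseteq> carrier F" "S \<inter> V = {}" "\<forall>V'\<in>Zar F A - k. V' \<inter> S \<noteq> {}" using UN(2)[OF k] by blast
    thus ?case using k by (intro exI[of _ S]) auto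
  next
    case (Basis b)
    then obtain W where W: "b = Zar F A - W" "openin (zariski_topology F A) W" "compactin (zariski_topology F A) W" by blast
    have VW: "V \<notin> W" using Basis(2) W(1) by blast
    define \<U> where "\<U> = {{V' \<in> Zar F A. S \<subseteq> V'} | S. finite S \<and> S \<subseteq> carrier F \<and> {V' \<in> Zar F A. S \<subseteq> V'} \<subseteq> W}"
    have WZ: "W \<subseteq> Zar F A"
    proof -
      have "topspace (zariski_topology F A) \<subseteq> Zar F A" unfolding zariski_topology_def by auto
      thus ?thesis using openin_subset[OF W(2)] by blast
    qed
    have "W \<subseteq> \<Union>\<U>"
    proof
      fix V' assume V': "V' \<in> W"
      obtain S where "finite S" "S \<subseteq> carrier F" "S \<subseteq> V'" "{V' \<in> Zar F A. S \<subseteq> V'} \<subseteq> W" using zariski_base[OF W(2) V'] by blast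
      thus "V' \<in> \<Union>\<U>" unfolding \<U>_def using V' WZ by blast
    qed
    moreover have "openin (zariski_topology F A) u" if "u \<in> \<U>" for u
      using that unfolding \<U>_def zariski_topology_def by (auto intro!: topology_generated_by_Basis)
    ultimately obtain \<F> where F: "finite \<F>" "\<F> \<subseteq> \<U>" "W \<subseteq> \<Union>\<F>" using W(3) unfolding compactin_def by meson
    have "\<exists>y. y \<in> carrier F \<and> y \<notin> V \<and> (\<forall>V'\<in>u. y \<in> V')" if "u \<in> \<F>" for u
    proof -
      obtain S where S: "u = {V' \<in> Zar F A. S \<subseteq> V'}" "S \<subseteq> carrier F" "u \<subseteq> W" using \<open>u \<in> \<F>\<close> F(2) unfolding \<U>_def by blast
      hence "\<not> S \<subseteq> V" using VW V(1) by blast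
      thus ?thesis using S by blast
    qed
    then obtain g where g: "\<And>u. u \<in> \<F> \<Longrightarrow> g u \<in> carrier F \<and> g u \<notin> V \<and> (\<forall>V'\<in>u. g u \<in> V')" by metis
    show ?case
    proof (intro exI[of _ "g ` \<F>"] conjI ballI)
      show "finite (g ` \<F>)" using F(1) by simp
      show "g ` \<F> \<subseteq> carrier F" "g ` \<F> \<inter> V = {}" using g by auto
      fix V' assume "V' \<in> Zar F A - b"
      then obtain u where "u \<in> \<F>" "V' \<in> u" using W(1) F(3) by blast
      thus "V' \<inter> g ` \<F> \<noteq> {}" using g by blast
    qed
  qed
  have "generate_topology_on ?S (Zar F A - Z)"
    using Z unfolding closedin_def inverse_topspace unfolding inverse_topology_def openin_topology_generated_by_iff by blast
  moreover have "Z \<subseteq> Zar F A" using closedin_subset[OF Z] inverse_topspace by blast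
  ultimately show ?thesis using main[of "Zar F A - Z"] V by (auto simp: double_diff)
qed

section \<open>Prime ideals and Krull dimension of a subring\<close>

context cring
begin

lemma ideal_iff_subideal:
  assumes D: "subring D R"
  shows "ideal I (R\<lparr>carrier := D\<rparr>) \<longleftrightarrow> subideal D I"
proof
  have cr: "cring (R\<lparr>carrier := D\<rparr>)"
    using subcringI'[OF D] subcring_iff[OF subringE(1)[OF D]] by blast
  interpret D: cring "R\<lparr>carrier := D\<rparr>" by (rule cr)
  show "subideal D I" if "ideal I (R\<lparr>carrier := D\<rparr>)"
  proof -
    interpret I: ideal I "R\<lparr>carrier := D\<rparr>" by (rule that)
    show ?thesis unfolding subideal_def
      using I.a_subset I.zero_closed I.a_closed I.I_l_closed by auto
  qed
  show "ideal I (R\<lparr>carrier := D\<rparr>)" if I: "subideal D I"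
  proof (rule idealI)
    show "ring (R\<lparr>carrier := D\<rparr>)" by (rule D.ring_axioms)
    show "subgroup I (add_monoid (R\<lparr>carrier := D\<rparr>))"
    proof (rule D.add.subgroupI)
      show "I \<subseteq> carrier (R\<lparr>carrier := D\<rparr>)" using subidealD(1)[OF I] by auto
      show "I \<noteq> {}" using subidealD(2)[OF I] by auto
      show "a \<oplus>\<^bsub>R\<lparr>carrier := D\<rparr>\<^esub> b \<in> I" if "a \<in> I" "b \<in> I" for a b using subidealD(3)[OF I that] by simp
      fix a assume a: "a \<in> I"
      have aD: "a \<in> carrier (R\<lparr>carrier := D\<rparr>)" using subidealD(1)[OF I a] by simp
      have "\<ominus>\<^bsub>R\<lparr>carrier := D\<rparr>\<^esub> a = (\<ominus>\<^bsub>R\<lparr>carrier := D\<rparr>\<^esub> \<one>\<^bsub>R\<lparr>carrier := D\<rparr>\<^esub>) \<otimes>\<^bsub>R\<lparr>carrier := D\<rparr>\<^esub> a"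
        using D.l_minus[OF D.one_closed aD] D.l_one[OF aD] by (rule_tac sym) simp
      also have "\<dots> \<in> I" using subidealD(4)[OF I _ a, of "\<ominus>\<^bsub>R\<lparr>carrier := D\<rparr>\<^esub> \<one>\<^bsub>R\<lparr>carrier := D\<rparr>\<^esub>"]
          D.a_inv_closed[OF D.one_closed] by simp
      finally show "\<ominus>\<^bsub>R\<lparr>carrier := D\<rparr>\<^esub> a \<in> I" .
    qed
    show "x \<otimes>\<^bsub>R\<lparr>carrier := D\<rparr>\<^esub> a \<in> I" "a \<otimes>\<^bsub>R\<lparr>carrier := D\<rparr>\<^esub> x \<in> I"
      if "a \<in> I" "x \<in> carrier (R\<lparr>carrier := D\<rparr>)" for a x
      using subidealD(4)[OF I _ that(1)] subideal_r[OF D I _ that(1)] that(2) by auto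
  qed
qed

definition subprime :: "'a set \<Rightarrow> 'a set \<Rightarrow> bool" where
  "subprime D I \<longleftrightarrow> subideal D I \<and> \<one> \<notin> I \<and> (\<forall>a\<in>D. \<forall>b\<in>D. a \<otimes> b \<in> I \<longrightarrow> a \<in> I \<or> b \<in> I)"

lemma primeideal_iff_subprime:
  assumes D: "subring D R"
  shows "primeideal I (R\<lparr>carrier := D\<rparr>) \<longleftrightarrow> subprime D I"
proof
  have cr: "cring (R\<lparr>carrier := D\<rparr>)"
    using subcringI'[OF D] subcring_iff[OF subringE(1)[OF D]] by blast
  show "subprime D I" if "primeideal I (R\<lparr>carrier := D\<rparr>)"
  proof -
    interpret I: primeideal I "R\<lparr>carrier := D\<rparr>" by (rule that)
    have s: "subideal D I" using I.ideal_axioms ideal_iff_subideal[OF D] by blast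
    moreover have "\<one> \<notin> I" using subideal_one[OF D s] I.I_notcarr by auto
    ultimately show ?thesis unfolding subprime_def using I.I_prime by auto
  qed
  show "primeideal I (R\<lparr>carrier := D\<rparr>)" if "subprime D I"
  proof (intro primeideal.intro primeideal_axioms.intro)
    show "ideal I (R\<lparr>carrier := D\<rparr>)" using that ideal_iff_subideal[OF D] unfolding subprime_def by blast
    show "cring (R\<lparr>carrier := D\<rparr>)" by (rule cr)
    show "carrier (R\<lparr>carrier := D\<rparr>) \<noteq> I" using that subring_closed(3)[OF D] unfolding subprime_def by auto
    show "a \<in> I \<or> b \<in> I" if "a \<in> carrier (R\<lparr>carrier := D\<rparr>)" "b \<in> carrier (R\<lparr>carrier := D\<rparr>)"
      "a \<otimes>\<^bsub>R\<lparr>carrier := D\<rparr>\<^esub> b \<in> I" for a b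
      using \<open>subprime D I\<close> that unfolding subprime_def by simp
  qed
qed

lemma maximal_above:
  assumes D: "subring D R" and I: "subideal D I" "\<one> \<notin> I"
  shows "\<exists>M. maximalideal M (R\<lparr>carrier := D\<rparr>) \<and> I \<subseteq> M"
proof -
  let ?A = "{J. subideal D J \<and> I \<subseteq> J \<and> \<one> \<notin> J}"
  have "\<exists>M\<in>?A. \<forall>J\<in>?A. M \<subseteq> J \<longrightarrow> J = M"
  proof (rule subset_Zorn_nonempty)
    show "?A \<noteq> {}" using I by blast
    fix C assume C: "C \<noteq> {}" "subset.chain ?A C"
    have CA: "J \<in> ?A" if "J \<in> C" for J using C(2) that unfolding subset_chain_def by blast
    have two: "\<exists>J\<in>C. a \<in> J \<and> b \<in> J" if "a \<in> \<Union>C" "b \<in> \<Union>C" for a b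
      using C(2) that unfolding subset_chain_def by blast
    have "subideal D (\<Union>C)" unfolding subideal_def
    proof (intro conjI ballI)
      show "\<Union>C \<subseteq> D" using CA unfolding subideal_def by blast
      obtain J where J: "J \<in> C" using C(1) by blast
      hence "subideal D J" using CA by blast
      thus "\<zero> \<in> \<Union>C" using subidealD(2) J by blast
      show "a \<oplus> b \<in> \<Union>C" if ab: "a \<in> \<Union>C" "b \<in> \<Union>C" for a b
      proof -
        obtain J where J: "J \<in> C" "a \<in> J" "b \<in> J" using two[OF ab] by blast
        have "subideal D J" using CA[OF J(1)] by blast
        thus ?thesis using subidealD(3) J by blast
      qed
      show "c \<otimes> a \<in> \<Union>C" if c: "c \<in> D" and a: "a \<in> \<Union>C" for c a
      proof -
        obtain J where J: "J \<in> C" "a \<in> J" using a by blast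
        have "subideal D J" using CA[OF J(1)] by blast
        thus ?thesis using subidealD(4) J c by blast
      qed
    qed
    thus "\<Union>C \<in> ?A" using CA C(1) by blast
  qed
  then obtain M where MA: "M \<in> ?A" and max: "\<forall>J\<in>?A. M \<subseteq> J \<longrightarrow> J = M" by (rule bexE)
  have M: "subideal D M" "I \<subseteq> M" "\<one> \<notin> M" using MA by auto
  have "maximalideal M (R\<lparr>carrier := D\<rparr>)"
  proof (rule maximalidealI)
    show "ideal M (R\<lparr>carrier := D\<rparr>)" using M(1) ideal_iff_subideal[OF D] by blast
    show "carrier (R\<lparr>carrier := D\<rparr>) \<noteq> M" using M(3) subring_closed(3)[OF D] by auto
    fix J assume J: "ideal J (R\<lparr>carrier := D\<rparr>)" "M \<subseteq> J"
    have J': "subideal D J" using J(1) ideal_iff_subideal[OF D] by blast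
    show "J = M \<or> J = carrier (R\<lparr>carrier := D\<rparr>)"
    proof (cases "\<one> \<in> J")
      case True thus ?thesis using subideal_one[OF D J'] by simp
    next
      case False
      hence "J \<in> ?A" using J' J(2) M(2) by auto
      thus ?thesis using max J(2) by simp
    qed
  qed
  thus ?thesis using M(2) by blast
qed

lemma local_ring_maximal:
  assumes D: "subring D R" and loc: "local_ring (R\<lparr>carrier := D\<rparr>)" and M: "maximalideal M (R\<lparr>carrier := D\<rparr>)"
  shows "subprime D M" "subideal D I \<Longrightarrow> \<one> \<notin> I \<Longrightarrow> I \<subseteq> M" "a \<in> D \<Longrightarrow> a \<notin> M \<Longrightarrow> \<exists>b\<in>D. a \<otimes> b = \<one>"
proof -
  have cr: "cring (R\<lparr>carrier := D\<rparr>)" using loc unfolding local_ring_def by blast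
  show "subprime D M" using cring.maximalideal_prime[OF cr M] primeideal_iff_subprime[OF D] by blast
  show le: "I \<subseteq> M" if "subideal D I" "\<one> \<notin> I" for I
    using maximal_above[OF D that] loc M unfolding local_ring_def by blast
  show "\<exists>b\<in>D. a \<otimes> b = \<one>" if a: "a \<in> D" "a \<notin> M"
  proof (rule ccontr)
    assume n: "\<not> ?thesis"
    have "\<one> \<notin> gen2 D a a"
    proof
      assume "\<one> \<in> gen2 D a a"
      then obtain c d where cd: "c \<in> D" "d \<in> D" "\<one> = a \<otimes> c \<oplus> a \<otimes> d" unfolding gen2_def by blast
      have "a \<otimes> c \<oplus> a \<otimes> d = a \<otimes> (c \<oplus> d)" using subring_closed(1)[OF D] a(1) cd(1,2) by (simp add: r_distr)
      hence "a \<otimes> (c \<oplus> d) = \<one>" using cd(3) by simp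
      thus False using n subring_closed(5)[OF D cd(1,2)] by blast
    qed
    hence "gen2 D a a \<subseteq> M" using le[OF gen2_subideal[OF D a(1) a(1)]] by blast
    thus False using gen2_in(1)[OF D a(1) a(1)] a(2) by blast
  qed
qed

end

lemma krull_dim_chain:
  assumes "krull_dim R = enat (Suc k)"
  shows "\<exists>P. (\<forall>i\<le>Suc k. primeideal (P i) R) \<and> (\<forall>i<Suc k. P i \<subset> P (Suc i))"
proof (rule ccontr)
  assume n: "\<not> ?thesis"
  let ?C = "\<lambda>n. \<exists>P :: nat \<Rightarrow> 'a set. (\<forall>i\<le>n. primeideal (P i) R) \<and> (\<forall>i<n. P i \<subset> P (Suc i))"
  have "enat n \<le> enat k" if c: "?C n" for n
  proof (rule ccontr)
    assume "\<not> enat n \<le> enat k"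
    hence kn: "Suc k \<le> n" by simp
    obtain P where P: "\<forall>i\<le>n. primeideal (P i) R" "\<forall>i<n. P i \<subset> P (Suc i)" using c by blast
    have "(\<forall>i\<le>Suc k. primeideal (P i) R) \<and> (\<forall>i<Suc k. P i \<subset> P (Suc i))" using P kn by auto
    thus False using n by blast
  qed
  hence "krull_dim R \<le> enat k" unfolding krull_dim_def by (intro Sup_least) blast
  thus False using assms by simp
qed

lemma krull_dim_bound:
  assumes "krull_dim R = enat k" "\<forall>i\<le>n. primeideal (P i) R" "\<forall>i<n. P i \<subset> P (Suc i)"
  shows "n \<le> k"
proof -
  have "enat n \<le> krull_dim R" unfolding krull_dim_def using assms(2,3) by (intro Sup_upper) blast
  thus ?thesis using assms(1) by simp
qed

context field
begin

lemma quotient_field_clear: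
  assumes q: "quotient_field R D" and y: "y \<in> carrier R"
  shows "\<exists>F\<in>D. F \<noteq> \<zero> \<and> y \<otimes> F \<in> D"
proof -
  have D: "subring D R" using q unfolding quotient_field_def by blast
  have "y \<in> {a \<otimes> inv b | a b. a \<in> D \<and> b \<in> D - {\<zero>}}" using q y unfolding quotient_field_def by blast
  then obtain a b where 1: "a \<in> D" "b \<in> D" "b \<noteq> \<zero>" "y = a \<otimes> inv b" by blast
  have c: "a \<in> carrier R" "b \<in> carrier R" using subring_closed(1)[OF D] 1 by auto
  have "y \<otimes> b = a" unfolding 1(4) using c inv_facts[OF c(2) 1(3)] by (simp add: m_assoc)
  thus ?thesis using 1 by blast
qed

text \<open>
  Embedding dimension two provides the parameters, and dimension two the prime ideal strictly between \<open>0\<close> and the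
  maximal ideal that \<open>regular_pairI\<close> asks for.
\<close>
lemma regular_local_ring_pair:
  assumes q: "quotient_field R D" and reg: "regular_local_ring (R\<lparr>carrier := D\<rparr>)" and dim: "krull_dim (R\<lparr>carrier := D\<rparr>) = 2"
  shows "\<exists>s t. regular_pair R D s t"
proof -
  let ?R = "R\<lparr>carrier := D\<rparr>"
  have D: "subring D R" using q unfolding quotient_field_def by blast
  note Dcl = subring_closed[OF D]
  have noeth: "noetherian_ring ?R" and loc: "local_ring ?R" and emb: "krull_dim ?R = enat (embedding_dim ?R)"
    using reg unfolding regular_local_ring_def by auto
  have "enat (embedding_dim ?R) = enat 2" using emb dim by (simp add: numeral_eq_enat)
  hence emb2: "embedding_dim ?R = 2" by simp
  interpret N: noetherian_ring ?R by (rule noeth)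
  obtain M where M: "maximalideal M ?R" using loc unfolding local_ring_def by blast
  note Mf = local_ring_maximal[OF D loc M]
  have "ideal M ?R" using M maximalideal.axioms(1) by blast
  then obtain S0 where S0: "S0 \<subseteq> carrier ?R" "finite S0" "M = Idl\<^bsub>?R\<^esub> S0" using N.finetely_gen by blast
  have "\<exists>n. \<exists>S \<subseteq> carrier ?R. finite S \<and> card S = n \<and> maximalideal (Idl\<^bsub>?R\<^esub> S) ?R" using S0 M by blast
  hence "\<exists>S \<subseteq> carrier ?R. finite S \<and> card S = embedding_dim ?R \<and> maximalideal (Idl\<^bsub>?R\<^esub> S) ?R"
    unfolding embedding_dim_def by (rule LeastI_ex)
  then obtain S where S: "S \<subseteq> carrier ?R" "finite S" "card S = 2" "maximalideal (Idl\<^bsub>?R\<^esub> S) ?R" using emb2 by auto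
  obtain s t where st: "S = {s, t}" using S(3) card_2_iff by metis
  have stD: "s \<in> D" "t \<in> D" using S(1) st by auto
  have MS: "Idl\<^bsub>?R\<^esub> S = M" using S(4) M loc unfolding local_ring_def by blast
  have I: "subideal D (gen2 D s t)" by (rule gen2_subideal[OF D stD])
  have M1: "subideal D M" "\<one> \<notin> M" using Mf(1) unfolding subprime_def by auto
  have Mg: "M = gen2 D s t"
  proof
    show "M \<subseteq> gen2 D s t" unfolding MS[symmetric]
      using N.genideal_minimal[of "gen2 D s t" S] I ideal_iff_subideal[OF D] gen2_in[OF D stD] st by simp
    have "S \<subseteq> M" using N.genideal_self[OF S(1)] MS by simp
    thus "gen2 D s t \<subseteq> M" using gen2_least[OF M1(1) D] st by blast
  qed
  have np: "noetherian_pair R D s t"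
  proof (intro noetherian_pair.intro local_pair.intro local_pair_axioms.intro
      noetherian_pair_axioms.intro field_axioms)
    show "subring D R" "s \<in> D" "t \<in> D" using D stD by auto
    show "\<one> \<notin> gen2 D s t" using M1 Mg by simp
    show "\<exists>b\<in>D. a \<otimes> b = \<one>" if "a \<in> D" "a \<notin> gen2 D s t" for a using Mf(3) that Mg by simp
    fix I :: "nat \<Rightarrow> 'a set" assume I: "\<And>n. subideal D (I n)" "\<And>n. I n \<subseteq> I (Suc n)"
    have mono: "I i \<subseteq> I j" if "i \<le> j" for i j using lift_Suc_mono_le[of I, OF I(2) that] .
    have "\<Union>(range I) \<in> range I"
    proof (rule N.ideal_chain_is_trivial)
      show "range I \<noteq> {}" by blast
      show "subset.chain {J. ideal J ?R} (range I)" unfolding subset_chain_def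
      proof (intro conjI ballI)
        show "range I \<subseteq> {J. ideal J ?R}" using I(1) ideal_iff_subideal[OF D] by auto
        fix J K assume "J \<in> range I" "K \<in> range I"
        then obtain i j where "J = I i" "K = I j" by blast
        thus "J \<subseteq> K \<or> K \<subseteq> J" using mono[of i j] mono[of j i] nle_le[of i j] by blast
      qed
    qed
    then obtain n where "\<Union>(range I) = I n" by blast
    hence "I (Suc n) \<subseteq> I n" by blast
    thus "\<exists>n. I (Suc n) = I n" using I(2) by blast
  qed
  interpret np: noetherian_pair R D s t by (rule np)
  have "krull_dim ?R = enat (Suc 1)" using dim by (simp add: numeral_eq_enat)
  then obtain P where "(\<forall>i\<le>Suc 1. primeideal (P i) ?R) \<and> (\<forall>i<Suc 1. P i \<subset> P (Suc i))"
    by (rule exE[OF krull_dim_chain])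
  hence P: "\<forall>i\<le>Suc 1. primeideal (P i) ?R" "\<forall>i<Suc 1. P i \<subset> P (Suc i)" by auto
  have P0: "subprime D (P 0)" "subprime D (P 1)" "subprime D (P (Suc 1))" "P 0 \<subset> P 1" "P 1 \<subset> P (Suc 1)"
    using P primeideal_iff_subprime[OF D] by auto
  have "P (Suc 1) \<subseteq> M" using Mf(2)[of "P (Suc 1)"] P0(3) unfolding subprime_def by simp
  hence nm: "\<not> gen2 D s t \<subseteq> P 1" using P0(5) Mg by blast
  obtain b where b: "b \<in> P 1" "b \<notin> P 0" using P0(4) by blast
  have "subideal D (P 0)" using P0(1) unfolding subprime_def by simp
  hence "b \<noteq> \<zero>" using b(2) subidealD(2) by blast
  hence nz: "\<exists>b\<in>P 1. b \<noteq> \<zero>" using b(1) by blast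
  have "regular_pair R D s t"
    by (rule np.regular_pairI[OF _ _ _ nz nm quotient_field_clear[OF q]]) (use P0(2) in \<open>auto simp: subprime_def\<close>)
  thus ?thesis by blast
qed

end

section \<open>Vacancy\<close>

context field
begin

lemma Zar_carrier: "subring A R \<Longrightarrow> carrier R \<in> Zar R A"
  unfolding Zar_def valuation_ring_def using carrier_is_subring subringE(1) by auto

lemma vacant_criterion:
  assumes q: "quotient_field R A" and ic: "integrally_closed R A"
    and dense: "\<And>Z V. inverse_closed_representation R A Z \<Longrightarrow> V \<in> Zar R A \<Longrightarrow> V \<in> Z"
  shows "vacant R A"
proof -
  have A: "subring A R" using q unfolding quotient_field_def by blast
  have Z1: "inverse_closed_representation R A (Zar R A)"
    unfolding inverse_closed_representation_def
  proof (intro conjI)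
    show "Zar R A \<noteq> {}" using Zar_carrier[OF A] by blast
    show "closedin (inverse_topology R A) (Zar R A)"
      using closedin_topspace[of "inverse_topology R A"] unfolding inverse_topspace .
    show "\<Inter> (Zar R A) = A"
    proof
      show "A \<subseteq> \<Inter> (Zar R A)" unfolding Zar_def by blast
      show "\<Inter> (Zar R A) \<subseteq> A"
      proof
        fix x assume x: "x \<in> \<Inter> (Zar R A)"
        hence "x \<in> carrier R" using Zar_carrier[OF A] by blast
        thus "x \<in> A" using valuation_ring_avoiding[OF A ic] x by blast
      qed
    qed
  qed
  have "Z = Zar R A" if Z: "inverse_closed_representation R A Z" for Z
  proof
    show "Z \<subseteq> Zar R A" using Z closedin_subset inverse_topspace unfolding inverse_closed_representation_def by metis
    show "Zar R A \<subseteq> Z" using dense[OF Z] by blast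
  qed
  thus ?thesis unfolding vacant_def using q ic Z1 by blast
qed

lemma quotient_field_overring:
  assumes "quotient_field R D" "overring R D A" shows "quotient_field R A"
proof -
  have D: "subring D R" and A: "subring A R" and DA: "D \<subseteq> A" using assms unfolding quotient_field_def overring_def by auto
  have "{a \<otimes> inv b | a b. a \<in> D \<and> b \<in> D - {\<zero>}} = carrier R" using assms(1) unfolding quotient_field_def by simp
  hence "carrier R \<subseteq> {a \<otimes> inv b | a b. a \<in> A \<and> b \<in> A - {\<zero>}}" using DA by blast
  moreover have "{a \<otimes> inv b | a b. a \<in> A \<and> b \<in> A - {\<zero>}} \<subseteq> carrier R"
    using subring_closed(1)[OF A] inv_facts by auto
  ultimately show ?thesis unfolding quotient_field_def using field_axioms A by auto
qed

text \<open>
  The centre is not \<open>0\<close>, because otherwise \<open>V\<close> would contain all fractions; and a nonzero prime of \<open>A\<close> is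
  maximal because the dimension is one.
\<close>
lemma one_dim_local_center:
  assumes q: "quotient_field R A" and loc: "local_ring (R\<lparr>carrier := A\<rparr>)" and dim: "krull_dim (R\<lparr>carrier := A\<rparr>) = 1"
    and M: "maximalideal M (R\<lparr>carrier := A\<rparr>)" and V: "V \<in> Zar R A" "V \<noteq> carrier R"
  shows "A \<inter> nonunits V = M"
proof -
  let ?P = "A \<inter> nonunits V"
  have A: "subring A R" using q unfolding quotient_field_def by blast
  note Acl = subring_closed[OF A]
  have Vv: "valuation_ring R V" and AV: "A \<subseteq> V" using V(1) unfolding Zar_def by auto
  have Vs: "subring V R" using Vv unfolding valuation_ring_def by blast
  note Vcl = subring_closed[OF Vs] and nid = nonunits_subideal[OF Vv]
  note Mf = local_ring_maximal[OF A loc M]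
  have id: "subideal A ?P" unfolding subideal_def
  proof (intro conjI ballI)
    show "\<zero> \<in> ?P" using Acl(2) subidealD(2)[OF nid] by blast
    show "a \<oplus> b \<in> ?P" if "a \<in> ?P" "b \<in> ?P" for a b using that Acl(5)[of a b] subidealD(3)[OF nid, of a b] by simp
    show "c \<otimes> a \<in> ?P" if "c \<in> A" "a \<in> ?P" for c a
      using that Acl(7)[of c a] subidealD(4)[OF nid, of c a] AV by auto
  qed blast
  have prime: "subprime A ?P" unfolding subprime_def
  proof (intro conjI ballI impI)
    show "subideal A ?P" by (rule id)
    show "\<one> \<notin> ?P" using nonunits_one[OF Vs] by blast
    show "a \<in> ?P \<or> b \<in> ?P" if "a \<in> A" "b \<in> A" "a \<otimes> b \<in> ?P" for a b
      using unit_mult(2)[OF Vs, of a b] that AV by auto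
  qed
  obtain y where y: "y \<in> carrier R" "y \<notin> V" using V(2) Vcl(1) by blast
  obtain F where F: "F \<in> A" "F \<noteq> \<zero>" "y \<otimes> F \<in> A" using quotient_field_clear[OF q y(1)] by blast
  have Fc: "F \<in> carrier R" using Acl(1)[OF F(1)] .
  have "F \<in> nonunits V"
  proof (rule ccontr)
    assume "F \<notin> nonunits V"
    hence "vdvd V F (y \<otimes> F)" using unit_vdvd[OF Vs] F(1,3) AV by blast
    thus False using vdvd_frac[OF Vs Fc F(2) y(1)] y(2) by blast
  qed
  hence FP: "F \<in> ?P" using F(1) by blast
  have PM: "?P \<subseteq> M" using Mf(2)[OF id] prime unfolding subprime_def by blast
  have zero: "subprime A {\<zero>}" unfolding subprime_def subideal_def
    using Acl(1,2) by (auto simp: integral_iff)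
  show ?thesis
  proof (rule ccontr)
    assume "?P \<noteq> M"
    hence PM': "?P \<subset> M" using PM by blast
    have zP: "{\<zero>} \<subset> ?P" using subidealD(2)[OF id] FP F(2) by blast
    define P where "P = (\<lambda>i::nat. if i = 0 then {\<zero>} else if i = 1 then ?P else M)"
    have "\<forall>i\<le>2. primeideal (P i) (R\<lparr>carrier := A\<rparr>)"
      unfolding P_def primeideal_iff_subprime[OF A] using zero prime Mf(1) by simp
    moreover have "\<forall>i<2. P i \<subset> P (Suc i)" unfolding P_def using PM' zP by (auto simp: less_2_cases_iff)
    moreover have "krull_dim (R\<lparr>carrier := A\<rparr>) = enat 1" using dim by (simp add: one_enat_def)
    ultimately have "2 \<le> (1::nat)" using krull_dim_bound by blast
    thus False by simp
  qed
qed

end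

theorem corollary4p5:
  fixes F :: "('a, 'b) ring_scheme" and D A :: "'a set"
  assumes "quotient_field F D"
    and "regular_local_ring (F\<lparr>carrier := D\<rparr>)"
    and "krull_dim (F\<lparr>carrier := D\<rparr>) = 2"
    and "overring F D A"
    and "integrally_closed F A"
    and "local_ring (F\<lparr>carrier := A\<rparr>)"
    and "krull_dim (F\<lparr>carrier := A\<rparr>) = 1"
  shows "vacant F A"
proof -
  interpret field F using assms(1) unfolding quotient_field_def by blast
  obtain s t where "regular_pair F D s t" using regular_local_ring_pair[OF assms(1-3)] by blast
  then interpret regular_pair F D s t .
  have qA: "quotient_field F A" using quotient_field_overring[OF assms(1,4)] .
  have A: "subring A F" and DA: "D \<subseteq> A" using assms(4) unfolding overring_def by auto
  note Acl = subring_closed[OF A]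
  obtain M where M: "maximalideal M (F\<lparr>carrier := A\<rparr>)" using assms(6) unfolding local_ring_def by blast
  note Mf = local_ring_maximal[OF A assms(6) M]
  note cent = one_dim_local_center[OF qA assms(6,7) M]
  have Mid: "subideal A M" "\<one>\<^bsub>F\<^esub> \<notin> M" using Mf(1) unfolding subprime_def by auto
  show ?thesis
  proof (rule vacant_criterion[OF qA assms(5)], rule ccontr)
    fix Z V assume Z: "inverse_closed_representation F A Z" and V: "V \<in> Zar F A" and VZ: "V \<notin> Z"
    have Vv: "valuation_ring F V" and AV: "A \<subseteq> V" using V unfolding Zar_def by auto
    have ZZ: "Z \<subseteq> Zar F A" and Zne: "Z \<noteq> {}" and ZA: "\<Inter>Z = A"
      using Z closedin_subset inverse_topspace unfolding inverse_closed_representation_def by metis+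
    obtain S where S: "finite S" "S \<subseteq> carrier F" "S \<inter> V = {}" "\<forall>V'\<in>Z. V' \<inter> S \<noteq> {}"
      using inverse_closed_separation[OF _ V VZ] Z unfolding inverse_closed_representation_def by blast
    have VF: "V \<noteq> carrier F" using S Zne by blast
    show False
    proof (cases "s \<in> M \<and> t \<in> M")
      case True
      have dom: "dominates V' D m" if V': "V' \<in> Zar F A" "V' \<noteq> carrier F" for V'
      proof -
        have "M \<subseteq> nonunits V'" using cent[OF V'] by blast
        moreover have "m \<subseteq> M"
        proof
          fix z assume "z \<in> m"
          then obtain c d where "c \<in> D" "d \<in> D" "z = s \<otimes>\<^bsub>F\<^esub> c \<oplus>\<^bsub>F\<^esub> t \<otimes>\<^bsub>F\<^esub> d" unfolding gen2_def by blast
          thus "z \<in> M"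
            using True DA subidealD(3)[OF Mid(1) subideal_r[OF A Mid(1), of c s] subideal_r[OF A Mid(1), of d t]] by blast
        qed
        ultimately show ?thesis using V'(1) DA unfolding dominates_def Zar_def by blast
      qed
      obtain w where w: "w \<in> carrier F" "w \<notin> V" "\<And>V'. dominates V' D m \<Longrightarrow> V' \<inter> S \<noteq> {} \<Longrightarrow> w \<in> V'"
        using common_pole_finite[OF dom[OF V VF] S(1-3)] by blast
      have "w \<in> V'" if "V' \<in> Z" for V'
      proof (cases "V' = carrier F")
        case False
        have "V' \<in> Zar F A" using that ZZ by blast
        thus ?thesis using w(3)[OF dom[OF _ False]] S(4) that by simp
      qed (use w(1) in simp)
      hence "w \<in> A" using ZA by blast
      thus False using AV w(2) by blast
    next
      case False
      have unit_or: "a \<notin> M \<or> b \<notin> M" if abD: "a \<in> D" "b \<in> D" and len: "len_le D (gen2 D a b) n" for a b n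
      proof (rule ccontr)
        assume ab: "\<not> ?thesis"
        interpret sw: regular_pair F D t s by (rule swap)
        have I: "subideal D (gen2 D a b)" using gen2_subideal[OF sub abD] .
        have "gen2 D a b \<subseteq> M"
        proof
          fix z assume "z \<in> gen2 D a b"
          then obtain c d where "c \<in> D" "d \<in> D" "z = a \<otimes>\<^bsub>F\<^esub> c \<oplus>\<^bsub>F\<^esub> b \<otimes>\<^bsub>F\<^esub> d" unfolding gen2_def by blast
          thus "z \<in> M"
            using ab DA subidealD(3)[OF Mid(1) subideal_r[OF A Mid(1), of c a] subideal_r[OF A Mid(1), of d b]] by blast
        qed
        moreover obtain i j where "t [^]\<^bsub>F\<^esub> (i::nat) \<in> gen2 D a b" "s [^]\<^bsub>F\<^esub> (j::nat) \<in> gen2 D a b"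
          using pow_in_ideal[OF I len] sw.pow_in_ideal[OF I len] by blast
        moreover have "z \<in> M" if "z \<in> A" "z [^]\<^bsub>F\<^esub> (i::nat) \<in> M" for z i
          using that(2)
        proof (induct i)
          case 0 thus ?case using Mid(2) by simp
        next
          case (Suc i)
          thus ?case using Mf(1) that(1) subring_pow[OF A that(1), of i] unfolding subprime_def by auto
        qed
        ultimately show False using False sD tD DA by blast
      qed
      have valA: "y \<in> A \<or> inv\<^bsub>F\<^esub> y \<in> A" if y: "y \<in> carrier F" "y \<noteq> \<zero>\<^bsub>F\<^esub>" for y
      proof -
        obtain a b n where 1: "a \<in> D" "b \<in> D" "a \<noteq> \<zero>\<^bsub>F\<^esub>" "y \<otimes>\<^bsub>F\<^esub> a = b" "len_le D (gen2 D a b) n" using rep[OF y] by blast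
        have c: "a \<in> carrier F" "b \<in> carrier F" "a \<in> A" "b \<in> A" using Dcl(1) 1 DA by auto
        note iy = inv_facts[OF y]
        consider "a \<notin> M" | "b \<notin> M" using unit_or[OF 1(1,2,5)] by blast
        thus ?thesis
        proof cases
          case 1
          then obtain d where d: "d \<in> A" "a \<otimes>\<^bsub>F\<^esub> d = \<one>\<^bsub>F\<^esub>" using Mf(3)[OF c(3)] by blast
          have "b \<otimes>\<^bsub>F\<^esub> d = y \<otimes>\<^bsub>F\<^esub> (a \<otimes>\<^bsub>F\<^esub> d)" unfolding \<open>y \<otimes>\<^bsub>F\<^esub> a = b\<close>[symmetric] using y c Acl(1)[OF d(1)] by (simp add: m_assoc)
          hence "y = b \<otimes>\<^bsub>F\<^esub> d" using d(2) y by simp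
          thus ?thesis using Acl(7)[OF c(4) d(1)] by simp
        next
          case 2
          then obtain d where d: "d \<in> A" "b \<otimes>\<^bsub>F\<^esub> d = \<one>\<^bsub>F\<^esub>" using Mf(3)[OF c(4)] by blast
          have "y \<otimes>\<^bsub>F\<^esub> (a \<otimes>\<^bsub>F\<^esub> d) = b \<otimes>\<^bsub>F\<^esub> d" unfolding \<open>y \<otimes>\<^bsub>F\<^esub> a = b\<close>[symmetric] using y c Acl(1)[OF d(1)] by (simp add: m_assoc)
          hence "y \<otimes>\<^bsub>F\<^esub> (a \<otimes>\<^bsub>F\<^esub> d) = y \<otimes>\<^bsub>F\<^esub> inv\<^bsub>F\<^esub> y" using d(2) iy by simp
          hence "a \<otimes>\<^bsub>F\<^esub> d = inv\<^bsub>F\<^esub> y"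
            using m_lcancel[OF y(2,1) m_closed[OF c(1) Acl(1)[OF d(1)]]] iy by blast
          thus ?thesis using Acl(7)[OF c(3) d(1)] by simp
        qed
      qed
      have only: "V' = A" if V': "V' \<in> Zar F A" "V' \<noteq> carrier F" for V'
      proof (rule ccontr)
        assume "V' \<noteq> A"
        have V's: "subring V' F" and AV': "A \<subseteq> V'" using V'(1) unfolding Zar_def valuation_ring_def by auto
        obtain y where y: "y \<in> V'" "y \<notin> A" using \<open>V' \<noteq> A\<close> AV' by blast
        have yc: "y \<in> carrier F" "y \<noteq> \<zero>\<^bsub>F\<^esub>" using subring_closed(1)[OF V's y(1)] y(2) Acl(2) by auto
        note iy = inv_facts[OF yc]
        have iA: "inv\<^bsub>F\<^esub> y \<in> A" using valA[OF yc] y(2) by blast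
        have "inv\<^bsub>F\<^esub> y \<in> M"
        proof (rule ccontr)
          assume "inv\<^bsub>F\<^esub> y \<notin> M"
          then obtain d where d: "d \<in> A" "inv\<^bsub>F\<^esub> y \<otimes>\<^bsub>F\<^esub> d = \<one>\<^bsub>F\<^esub>" using Mf(3)[OF iA] by blast
          have "inv\<^bsub>F\<^esub> y \<otimes>\<^bsub>F\<^esub> d = inv\<^bsub>F\<^esub> y \<otimes>\<^bsub>F\<^esub> y" using d(2) iy by simp
          hence "d = y" using m_lcancel[of "inv\<^bsub>F\<^esub> y" d y] iy yc Acl(1)[OF d(1)] by simp
          thus False using d(1) y(2) by simp
        qed
        hence "inv\<^bsub>F\<^esub> y \<in> nonunits V'" using cent[OF V'] by blast
        thus False using nonunitsD(2) y(1) iy unfolding vdvd_one by blast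
      qed
      have "Z \<subseteq> {carrier F}" using only[OF V VF] only ZZ VZ by blast
      hence "Z = {carrier F}" using Zne by blast
      hence "A = carrier F" using ZA by simp
      thus False using only[OF V VF] VF by simp
    qed
  qed
qed

end
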